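(* Let $\Omega\subset\mathbb{R}^2$ be a bounded strictly convex domain whose boundary is a $C^2$ curve of positive curvature, let $|\partial\Omega|$ be its perimeter, let $\beta^{4^{\rm th}}_\Omega$ be Mather's $\beta$-function of the outer length ($4^{\rm th}$) billiard map of $\Omega$, and let $\mathcal D$ be the unit disk (so $\beta^{4^{\rm th}}_{\mathcal D}(\rho)=2\tan(\pi\rho)$). (i) For every $\rho\in[0,\tfrac12)$, $$\beta^{4^{\rm th}}_\Omega(\rho)\le\frac{|\partial\Omega|}{2\pi}\,\beta^{4^{\rm th}}_{\mathcal D}(\rho).$$ (ii) If equality holds in (i) for some rotation number $\rho\in(0,\tfrac12)$, then $\Omega$ is a disk.
   Context: Outer length ($4^{\rm th}$) billiard: parametrize $\partial\Omega$ by the angle $\theta\in\mathbb{R}/2\pi\mathbb{Z}$ of the outer normal, $\theta\mapsto\gamma(\theta)$ (lifted to $\mathbb{R}$); arclength may be used equivalently. For $0<\theta_1-\theta_0<\pi$ let $M$ be the intersection point of the tangent lines to $\partial\Omega$ at $\gamma(\theta_0)$ and $\gamma(\theta_1)$. The outer length billiard map acts on the exterior of $\Omega$ as follows: given $M_0$ outside $\Omega$ with tangency points $\gamma(\theta_0),\gamma(\theta_1)$, take the circle tangent to $\partial\Omega$ at $\gamma(\theta_1)$ (lying on the other side of the tangent line from $\Omega$) and tangent to the tangent line at $\gamma(\theta_0)$; the image $M_1$ is the intersection of the tangent line at $\gamma(\theta_1)$ with the other common tangent line of this circle and $\partial\Omega$. It is a positive twist map with generating function $$S(\theta_0,\theta_1)=|M-\gamma(\theta_0)|+|M-\gamma(\theta_1)|,\qquad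 0<\theta_1-\theta_0<\pi .$$ Mather's $\beta$-function: an (admissible) configuration is a sequence of reals $(\theta_i)_{i\in\mathbb{Z}}$ with $0\le\theta_{i+1}-\theta_i<\pi$ (with $S(\theta,\theta)=0$). It is action-minimizing if every finite segment $(\theta_m,\dots,\theta_n)$ minimizes $\sum_{i=m}^{n-1}S(\theta_i,\theta_{i+1})$ among admissible segments with the same endpoints. Its rotation number is $\lim_{i\to\pm\infty}\theta_i/(2\pi i)$ when this limit exists. For $\rho\in(0,\frac12)$, $\beta^{4^{\rm th}}_\Omega(\rho):=\lim_{N\to\infty}\frac1{2N}\sum_{i=-N}^{N-1}S(\theta_i,\theta_{i+1})$ for any action-minimizing configuration of rotation number $\rho$ (such configurations exist and the value does not depend on the choice). The function is continuous and is extended by continuity to $\rho=0$, with value $0$. For coprime $p,q$ with $p/q\in(0,\frac12)$ one has $\beta^{4^{\rm th}}_\Omega(p/q)=\frac1q\mathcal L^{\rm circ}_\Omega(p/q)$, where $\mathcal L^{\rm circ}_\Omega(p/q)$ is the minimal perimeter of $q$-gons with winding number $p$ circumscribed about $\Omega$. *)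

theory Defs
  imports "HOL-Analysis.Analysis"
begin

text \<open>The Euclidean plane is \<^typ>\<open>complex\<close>, with inner product \<open>x \<bullet> y = Re x * Re y + Im x * Im y\<close>;
  \<^term>\<open>cis \<theta>\<close> is the unit vector of angle \<open>\<theta>\<close>.\<close>

definition strictly_convex :: "complex set \<Rightarrow> bool" where
  "strictly_convex S \<longleftrightarrow>
     (\<forall>x\<in>closure S. \<forall>y\<in>closure S. open_segment x y \<subseteq> interior S)"

definition C2_closed_curve :: "(real \<Rightarrow> complex) \<Rightarrow> bool" where
  "C2_closed_curve c \<longleftrightarrow>
     (\<forall>t. c (t + 1) = c t) \<and> inj_on c {0..<1} \<and>
     c C1_differentiable_on UNIV \<and>
     (\<lambda>t. vector_derivative c (at t)) C1_differentiable_on UNIV \<and>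
     (\<forall>t. vector_derivative c (at t) \<noteq> 0)"

text \<open>Signed curvature \<open>det (c', c'') / \<bar>c'\<bar>\<^sup>3\<close>. For a simple closed curve, positivity everywhere
  includes the convention that the curve runs counterclockwise.\<close>

definition curvature :: "(real \<Rightarrow> complex) \<Rightarrow> real \<Rightarrow> real" where
  "curvature c t =
     (let c1 = (\<lambda>s. vector_derivative c (at s));
          c2 = (\<lambda>s. vector_derivative c1 (at s))
      in (Re (c1 t) * Im (c2 t) - Im (c1 t) * Re (c2 t)) / norm (c1 t) ^ 3)"

definition closed_curve_length :: "(real \<Rightarrow> complex) \<Rightarrow> real" where
  "closed_curve_length c = integral {0..1} (\<lambda>t. norm (vector_derivative c (at t)))"

text \<open>The boundary point at which \<^term>\<open>cis \<theta>\<close> is an outer normal, i.e. \<open>\<Omega>\<close> lies in the half-plane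
  bounded by the line through that point orthogonal to \<^term>\<open>cis \<theta>\<close>, on the side opposite to
  \<^term>\<open>cis \<theta>\<close>. For bounded strictly convex nonempty \<open>\<Omega>\<close> the point exists and is unique.\<close>

definition bdry_point :: "complex set \<Rightarrow> real \<Rightarrow> complex" where
  "bdry_point \<Omega> \<theta> =
     (THE p. p \<in> frontier \<Omega> \<and> (\<forall>x\<in>\<Omega>. (x - p) \<bullet> cis \<theta> \<le> 0))"

definition tangent_line :: "complex set \<Rightarrow> real \<Rightarrow> complex set" where
  "tangent_line \<Omega> \<theta> = {x. (x - bdry_point \<Omega> \<theta>) \<bullet> cis \<theta> = 0}"

definition tangent_meet :: "complex set \<Rightarrow> real \<Rightarrow> real \<Rightarrow> complex" where
  "tangent_meet \<Omega> \<theta>0 \<theta>1 =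
     (THE M. M \<in> tangent_line \<Omega> \<theta>0 \<and> M \<in> tangent_line \<Omega> \<theta>1)"

text \<open>Only used for \<open>0 \<le> \<theta>1 - \<theta>0 < \<pi>\<close>.\<close>

definition gen_fun :: "complex set \<Rightarrow> real \<Rightarrow> real \<Rightarrow> real" where
  "gen_fun \<Omega> \<theta>0 \<theta>1 =
     (if \<theta>0 = \<theta>1 then 0
      else dist (tangent_meet \<Omega> \<theta>0 \<theta>1) (bdry_point \<Omega> \<theta>0)
         + dist (tangent_meet \<Omega> \<theta>0 \<theta>1) (bdry_point \<Omega> \<theta>1))"

definition admissible_segment :: "int \<Rightarrow> int \<Rightarrow> (int \<Rightarrow> real) \<Rightarrow> bool" where
  "admissible_segment m n \<theta> \<longleftrightarrow>
     (\<forall>i\<in>{m..<n}. 0 \<le> \<theta> (i + 1) - \<theta> i \<and> \<theta> (i + 1) - \<theta> i < pi)"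

definition admissible :: "(int \<Rightarrow> real) \<Rightarrow> bool" where
  "admissible \<theta> \<longleftrightarrow> (\<forall>i. 0 \<le> \<theta> (i + 1) - \<theta> i \<and> \<theta> (i + 1) - \<theta> i < pi)"

definition action :: "complex set \<Rightarrow> int \<Rightarrow> int \<Rightarrow> (int \<Rightarrow> real) \<Rightarrow> real" where
  "action \<Omega> m n \<theta> = (\<Sum>i\<in>{m..<n}. gen_fun \<Omega> (\<theta> i) (\<theta> (i + 1)))"

definition action_minimizing :: "complex set \<Rightarrow> (int \<Rightarrow> real) \<Rightarrow> bool" where
  "action_minimizing \<Omega> \<theta> \<longleftrightarrow> admissible \<theta> \<and>
     (\<forall>m n \<phi>. m < n \<and> admissible_segment m n \<phi> \<and> \<phi> m = \<theta> m \<and> \<phi> n = \<theta> n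
        \<longrightarrow> action \<Omega> m n \<theta> \<le> action \<Omega> m n \<phi>)"

definition has_rotation_number :: "(int \<Rightarrow> real) \<Rightarrow> real \<Rightarrow> bool" where
  "has_rotation_number \<theta> \<rho> \<longleftrightarrow>
     ((\<lambda>i. \<theta> i / (2 * pi * of_int i)) \<longlongrightarrow> \<rho>) at_top \<and>
     ((\<lambda>i. \<theta> i / (2 * pi * of_int i)) \<longlongrightarrow> \<rho>) at_bot"

text \<open>The value for \<open>0 < \<rho> < 1/2\<close>: the common mean action of the action-minimizing
  configurations of rotation number \<open>\<rho>\<close>.\<close>

definition mean_action :: "complex set \<Rightarrow> real \<Rightarrow> real" where
  "mean_action \<Omega> \<rho> =
     (THE b. \<exists>\<theta>. action_minimizing \<Omega> \<theta> \<and> has_rotation_number \<theta> \<rho> \<and>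
        (\<lambda>N. action \<Omega> (- int N) (int N) \<theta> / (2 * real N)) \<longlonglongrightarrow> b)"

text \<open>Extension to \<open>\<rho> = 0\<close> by continuity; not meaningful outside \<open>[0, 1/2)\<close>.\<close>

definition mather_beta :: "complex set \<Rightarrow> real \<Rightarrow> real" where
  "mather_beta \<Omega> \<rho> =
     (if \<rho> = 0 then Lim (at_right 0) (mean_action \<Omega>) else mean_action \<Omega> \<rho>)"

end

theory Submission
  imports Defs
begin

text \<open>
  Let \<open>h\<close> be the support function of \<open>\<Omega>\<close> about an interior point, so that \<open>h > 0\<close>. Solving for the
  vertex cut out by the tangent lines with normal angles \<open>\<theta>\<close> and \<open>\<theta>'\<close> turns the generating function into
  \<open>S(\<theta>, \<theta>') = (h(\<theta>) + h(\<theta>')) tan((\<theta>' - \<theta>)/2) + h'(\<theta>') - h'(\<theta>)\<close> (\<open>gen_fun_eq\<close>). The last two terms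
  telescope along a configuration, so minimizers and mean actions may be computed with
  \<open>G(\<theta>, \<theta>') = (h(\<theta>) + h(\<theta>')) tan((\<theta>' - \<theta>)/2)\<close>, which is nonnegative and involves no derivative of \<open>h\<close>.
  Moreover the mixed derivative of \<open>G\<close> is \<open>- (1 + tan\<^sup>2((\<theta>' - \<theta>)/2)) S / 2\<close>: the twist condition is just
  the positivity of the tangent lengths.

  The mean action has to be shown to be well defined. The twist condition makes \<open>G\<close> strictly
  submodular, and exchanging the pointwise minimum and maximum of two periodic minimizers shows that
  minimizers of the same type \<open>(p, n)\<close> never cross (\<open>periodic_min_ordered\<close>). In particular such a
  minimizer is comparable with all its translates, hence stays within \<open>2 \<pi>\<close> of a line of slope
  \<open>2 \<pi> p / n\<close>. Letting \<open>n\<close> tend to infinity with \<open>p = \<lfloor>\<rho> n\<rfloor>\<close> gives a minimizing configuration at bounded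
  distance from the line of slope \<open>2 \<pi> \<rho>\<close> (\<open>minimizing_exists\<close>). Two configurations can be joined
  to each other within a few equal steps at bounded cost (\<open>minimizing_compare\<close>). This makes the action
  of a minimizer almost additive, so its mean converges, and shows that all minimizers with the same
  rotation number have the same mean (\<open>mean_converges\<close>, \<open>mean_le\<close>).

  The same comparison with the configurations \<open>f(s + 2 \<pi> \<rho> i)\<close>, averaged over \<open>s\<close>, gives
  \<open>2 \<pi> \<beta>(\<rho>) \<le> \<integral> G(f(s), f(s + 2 \<pi> \<rho>)) ds\<close> for every admissible lift \<open>f\<close> of a circle map of degree one
  (\<open>mean_le_integral\<close>). For \<open>f = id\<close> the right-hand side is \<open>2 tan(\<pi> \<rho>) \<integral> h\<close>, and \<open>\<integral> h\<close> is the perimeter by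
  Cauchy's formula (\<open>curve_length_eq\<close>). This is the inequality; for the disk, convexity of the tangent
  gives the reverse estimate. If equality holds for some \<open>\<rho>\<close>, then \<open>f = id\<close> is a minimum of the right-hand
  side, and its first variation in the direction \<open>cos(k s + a)\<close> is a positive multiple of
  \<open>(k sin \<delta> - sin(k \<delta>)) \<integral> h(s) sin(k s + a) ds\<close> with \<open>\<delta> = 2 \<pi> \<rho>\<close>. As \<open>\<bar>sin(k \<delta>)\<bar> < k sin \<delta>\<close> for
  \<open>k \<ge> 2\<close>, all Fourier modes of \<open>h\<close> beyond the first vanish, that is \<open>h(\<theta>) = r + w \<bullet> cis \<theta>\<close>, which is the
  support function of a disk.\<close>

section \<open>Real and periodic functions\<close>

lemma periodic_int:
  fixes F :: "real \<Rightarrow> 'a"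
  assumes "\<And>x. F (x + 2 * pi) = F x"
  shows "F (x + 2 * pi * of_int k) = F x"
proof (induction k rule: int_induct[where k = 0])
  case (step1 i)
  then show ?case using assms[of "x + 2 * pi * of_int i"] by (simp add: algebra_simps)
next
  case (step2 i)
  then show ?case using assms[of "x + 2 * pi * of_int (i - 1)"] by (simp add: algebra_simps)
qed simp

lemma periodic_cis:
  fixes F :: "real \<Rightarrow> 'a"
  assumes "\<And>x. F (x + 2 * pi) = F x" "cis s = cis t"
  shows "F s = F t"
proof -
  from assms(2) have "sin s = sin t \<and> cos s = cos t" by (simp add: complex_eq_iff)
  then obtain n :: int where "s = t + 2 * pi * n" using sin_cos_eq_iff by blast
  then show ?thesis using periodic_int[of F t n] assms(1) by simp
qed

lemma periodic_reduce: "\<exists>k::int. x + 2 * pi * of_int k \<in> {0..2*pi}"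
proof
  have "of_int \<lfloor>x / (2*pi)\<rfloor> * (2*pi) \<le> x" "x < (of_int \<lfloor>x / (2*pi)\<rfloor> + 1) * (2*pi)"
    by (rule floor_divide_lower floor_divide_upper, simp)+
  then show "x + 2 * pi * of_int (- \<lfloor>x / (2*pi)\<rfloor>) \<in> {0..2*pi}"
    by (simp add: algebra_simps)
qed

lemma one_plus_sq_pos: "0 < 1 + (t::real)\<^sup>2"
  by (simp add: add_pos_nonneg)

lemma tan_half_deriv:
  assumes "\<bar>u\<bar> < pi"
  shows "((\<lambda>u. tan (u / 2)) has_real_derivative (1 + (tan (u / 2))\<^sup>2) / 2) (at u)"
proof -
  have "cos (u / 2) \<noteq> 0"
    using assms by (intro less_imp_neq[symmetric] cos_gt_zero_pi) auto
  then show ?thesis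
    by (auto intro!: derivative_eq_intros simp: tan_sec power_inverse)
qed

lemma two_arctan_less_pi: "2 * arctan t < pi"
  using arctan_ubound[of t] by simp

lemma floor_ratio_tendsto: "(\<lambda>n. of_int \<lfloor>\<rho> * real n\<rfloor> / real n) \<longlonglongrightarrow> \<rho>"
proof (rule tendsto_sandwich[of "\<lambda>n. \<rho> - 1 / real n" _ _ "\<lambda>n. \<rho>"])
  have "\<rho> - 1 / real n \<le> of_int \<lfloor>\<rho> * real n\<rfloor> / real n \<and> of_int \<lfloor>\<rho> * real n\<rfloor> / real n \<le> \<rho>" if "0 < n" for n
  proof -
    have "\<rho> * real n - 1 \<le> of_int \<lfloor>\<rho> * real n\<rfloor>" "of_int \<lfloor>\<rho> * real n\<rfloor> \<le> \<rho> * real n" by linarith+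
    then have "\<rho> * real n / real n - 1 / real n \<le> of_int \<lfloor>\<rho> * real n\<rfloor> / real n"
      "of_int \<lfloor>\<rho> * real n\<rfloor> / real n \<le> \<rho> * real n / real n"
      unfolding diff_divide_distrib[symmetric] by (intro divide_right_mono; simp)+
    moreover have "\<rho> * real n / real n = \<rho>" using that by simp
    ultimately show ?thesis by (simp only:)
  qed
  then show "\<forall>\<^sub>F n in sequentially. \<rho> - 1 / real n \<le> of_int \<lfloor>\<rho> * real n\<rfloor> / real n"
    "\<forall>\<^sub>F n in sequentially. of_int \<lfloor>\<rho> * real n\<rfloor> / real n \<le> \<rho>"
    by - (rule eventually_mono[OF eventually_gt_at_top[of "0::nat"]], blast)+
  show "(\<lambda>n. \<rho> - 1 / real n) \<longlonglongrightarrow> \<rho>"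
    using tendsto_diff[OF tendsto_const[of \<rho>] lim_1_over_n] by simp
qed simp

lemma sum_telescope_int:
  fixes f :: "int \<Rightarrow> real"
  assumes "m \<le> n" shows "(\<Sum>i\<in>{m..<n}. f (i + 1) - f i) = f n - f m"
  using assms
proof (induction n rule: int_ge_induct)
  case (step i)
  then have "{m..<i + 1} = insert i {m..<i}" by auto
  then show ?case using step by simp
qed simp

text \<open>The tangent function is convex on \<open>[0, \<pi>/2)\<close> and so lies above its tangent lines.\<close>
lemma tan_ge_tangent:
  assumes "0 \<le> u" "u < pi / 2" "0 \<le> v" "v < pi / 2"
  shows "tan u \<ge> tan v + (1 + (tan v)\<^sup>2) * (u - v)"
proof -
  have der: "(tan has_real_derivative 1 + (tan t)\<^sup>2) (at t)" if "0 \<le> t" "t < pi / 2" for t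
  proof -
    have "cos t \<noteq> 0" using that by (intro less_imp_neq[symmetric] cos_gt_zero_pi) auto
    then show ?thesis using DERIV_tan[of t] by (simp add: tan_sec power_inverse)
  qed
  have mono: "(tan s)\<^sup>2 \<le> (tan t)\<^sup>2" if "0 \<le> s" "s \<le> t" "t < pi / 2" for s t
  proof -
    have "0 \<le> tan s" using that by (cases "s = 0") (auto intro!: less_imp_le tan_gt_zero)
    moreover have "tan s \<le> tan t" using that by (intro tan_mono_le) auto
    ultimately show ?thesis by (intro power_mono)
  qed
  consider "u = v" | "u < v" | "v < u" by linarith
  then show ?thesis
  proof cases
    case 2
    obtain t where t: "u < t" "t < v" "tan v - tan u = (v - u) * (1 + (tan t)\<^sup>2)"
      using MVT2[of u v tan "\<lambda>t. 1 + (tan t)\<^sup>2"] 2 der assms by force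
    have "(v - u) * (1 + (tan t)\<^sup>2) \<le> (v - u) * (1 + (tan v)\<^sup>2)"
      using mono[of t v] t assms 2 by (intro mult_left_mono) auto
    moreover have "(1 + (tan v)\<^sup>2) * (u - v) = - ((v - u) * (1 + (tan v)\<^sup>2))" by (simp add: algebra_simps)
    ultimately show ?thesis using t by linarith
  next
    case 3
    obtain t where t: "v < t" "t < u" "tan u - tan v = (u - v) * (1 + (tan t)\<^sup>2)"
      using MVT2[of v u tan "\<lambda>t. 1 + (tan t)\<^sup>2"] 3 der assms by force
    have "(u - v) * (1 + (tan v)\<^sup>2) \<le> (u - v) * (1 + (tan t)\<^sup>2)"
      using mono[of v t] t assms 3 by (intro mult_left_mono) auto
    moreover have "(1 + (tan v)\<^sup>2) * (u - v) = (u - v) * (1 + (tan v)\<^sup>2)" by (rule mult.commute)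
    ultimately show ?thesis using t by linarith
  qed simp
qed

lemma norm_cis_diff_le: "norm (cis a - cis b) \<le> 2 * \<bar>a - b\<bar>"
proof -
  have half: "\<bar>sin ((a - b) / 2)\<bar> \<le> \<bar>a - b\<bar> / 2" "\<bar>sin ((b - a) / 2)\<bar> \<le> \<bar>a - b\<bar> / 2"
    using abs_sin_x_le_abs_x[of "(a - b) / 2"] abs_sin_x_le_abs_x[of "(b - a) / 2"] by simp_all
  have "\<bar>cos a - cos b\<bar> = 2 * (\<bar>sin ((a + b) / 2)\<bar> * \<bar>sin ((b - a) / 2)\<bar>)"
    by (simp add: cos_diff_cos abs_mult)
  also have "\<dots> \<le> 2 * (1 * (\<bar>a - b\<bar> / 2))" using half by (intro mult_left_mono mult_mono) auto
  finally have 1: "\<bar>cos a - cos b\<bar> \<le> \<bar>a - b\<bar>" by simp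
  have "\<bar>sin a - sin b\<bar> = 2 * (\<bar>sin ((a - b) / 2)\<bar> * \<bar>cos ((a + b) / 2)\<bar>)"
    by (simp add: sin_diff_sin abs_mult)
  also have "\<dots> \<le> 2 * ((\<bar>a - b\<bar> / 2) * 1)" using half by (intro mult_left_mono mult_mono) auto
  finally have 2: "\<bar>sin a - sin b\<bar> \<le> \<bar>a - b\<bar>" by simp
  show ?thesis using cmod_le[of "cis a - cis b"] 1 2 by simp
qed

lemma has_vector_derivative_Re_Im:
  assumes "(f has_vector_derivative d) (at t)"
  shows "((\<lambda>s. Re (f s)) has_real_derivative Re d) (at t)" "((\<lambda>s. Im (f s)) has_real_derivative Im d) (at t)"
  using bounded_linear.has_vector_derivative[OF bounded_linear_Re assms]
    bounded_linear.has_vector_derivative[OF bounded_linear_Im assms]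
  by (simp_all add: has_real_derivative_iff_has_vector_derivative)

section \<open>Fourier modes of a periodic function\<close>

text \<open>The integral over the window \<open>[t, t + p]\<close> has derivative \<open>F(t + p) - F(t) = 0\<close> in \<open>t\<close>.\<close>
lemma integral_period_shift:
  fixes F :: "real \<Rightarrow> real"
  assumes cont: "continuous_on UNIV F" and per: "\<And>x. F (x + p) = F x" and p: "0 \<le> p"
  shows "integral {0..p} (\<lambda>s. F (s + a)) = integral {0..p} F"
proof -
  define c where "c = - \<bar>a\<bar> - 1"
  define d where "d = \<bar>a\<bar> + p + 1"
  define \<Phi> where "\<Phi> = (\<lambda>t. integral {c..t} F)"
  have cF: "continuous_on full_gen F" for full_gen using cont continuous_on_subset by blast
  have der: "(\<Phi> has_real_derivative F t) (at t)" if "c < t" "t < d" for t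
  proof -
    have "(\<Phi> has_real_derivative F t) (at t within {c..d})"
      unfolding \<Phi>_def using that by (intro integral_has_real_derivative cF) auto
    then show ?thesis using that by (simp add: at_within_Icc_at)
  qed
  have int: "F integrable_on {u..v}" for u v by (intro integrable_continuous_real cF)
  have comb: "integral {u..u + p} F = \<Phi> (u + p) - \<Phi> u" if "c \<le> u" for u
    using Henstock_Kurzweil_Integration.integral_combine[of c u "u + p" F] that p int by (simp add: \<Phi>_def)
  have "\<Phi> (a + p) - \<Phi> a = \<Phi> (0 + p) - \<Phi> 0"
  proof (rule DERIV_isconst3[where f = "\<lambda>t. \<Phi> (t + p) - \<Phi> t" and a = c and b = "\<bar>a\<bar> + 1"])
    fix t assume t: "t \<in> {c<..<\<bar>a\<bar> + 1}"
    have "((\<lambda>t. \<Phi> (t + p)) has_real_derivative F (t + p)) (at t)"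
      using DERIV_shift[of \<Phi> "F (t + p)" t p] der[of "t + p"] t p by (simp add: d_def c_def)
    moreover have "(\<Phi> has_real_derivative F t) (at t)" using der[of t] t p by (simp add: d_def)
    ultimately show "((\<lambda>t. \<Phi> (t + p) - \<Phi> t) has_real_derivative 0) (at t)"
      using DERIV_diff per[of t] by fastforce
  qed (auto simp: c_def)
  moreover have "integral {0..p} (\<lambda>s. F (s + a)) = integral {a..a + p} F"
    using integral_shift_Icc_real[of 0 p F a] by (simp add: o_def add.commute)
  ultimately show ?thesis using comb[of a] comb[of 0] by (simp add: c_def)
qed

lemma integral_trig_period:
  fixes k :: int
  assumes "k \<noteq> 0"
  shows "integral {0..2*pi} (\<lambda>s. sin (of_int k * s + a)) = 0"
proof -
  have "((\<lambda>s. sin (of_int k * s + a)) has_integral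
      (- cos (of_int k * (2*pi) + a) / of_int k) - (- cos (of_int k * 0 + a) / of_int k)) {0..2*pi}"
    using assms by (intro fundamental_theorem_of_calculus)
      (auto intro!: derivative_eq_intros simp flip: has_real_derivative_iff_has_vector_derivative)
  moreover have "cos (of_int k * (2*pi) + a) = cos a"
    using cos_int_2pin[of k] sin_int_2pin[of k] by (simp add: cos_add mult.commute)
  ultimately show ?thesis by (simp add: integral_unique)
qed

text \<open>The shifts \<open>a\<close> cover sine and cosine modes at once. Allowing negative \<open>k\<close> makes the property stable
  under multiplication by \<open>cos(s + b)\<close>, which moves \<open>k\<close> by one in both directions.\<close>
definition fourier_free :: "(real \<Rightarrow> real) \<Rightarrow> bool" where
  "fourier_free \<psi> \<longleftrightarrow> continuous_on UNIV \<psi> \<and> (\<forall>(k::int) a. integral {0..2*pi} (\<lambda>s. \<psi> s * sin (of_int k * s + a)) = 0)"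

lemma fourier_free_cos:
  assumes "fourier_free \<psi>" shows "fourier_free (\<lambda>s. \<psi> s * cos (s + b))"
  unfolding fourier_free_def
proof (intro conjI allI)
  have c: "continuous_on full_gen \<psi>" for full_gen using assms continuous_on_subset unfolding fourier_free_def by blast
  show "continuous_on UNIV (\<lambda>s. \<psi> s * cos (s + b))" by (intro continuous_intros c)
  fix k :: int and a
  have "\<psi> s * cos (s + b) * sin (of_int k * s + a) =
     (1/2) * (\<psi> s * sin (of_int (k + 1) * s + (a + b))) + (1/2) * (\<psi> s * sin (of_int (k - 1) * s + (a - b)))" for s
  proof -
    have e: "of_int (k + 1) * s + (a + b) = (of_int k * s + a) + (s + b)"
      "of_int (k - 1) * s + (a - b) = (of_int k * s + a) - (s + b)" by (simp_all add: algebra_simps)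
    show ?thesis unfolding e sin_add[of "of_int k * s + a"] sin_diff[of "of_int k * s + a"]
      by (simp add: distrib_left right_diff_distrib)
  qed
  moreover have "integral {0..2*pi} (\<lambda>s. (1/2) * (\<psi> s * sin (of_int (k + 1) * s + (a + b))) + (1/2) * (\<psi> s * sin (of_int (k - 1) * s + (a - b)))) = 0"
  proof (subst integral_add)
    show "(\<lambda>s. (1/2) * (\<psi> s * sin (of_int (k + 1) * s + (a + b)))) integrable_on {0..2*pi}"
      "(\<lambda>s. (1/2) * (\<psi> s * sin (of_int (k - 1) * s + (a - b)))) integrable_on {0..2*pi}"
      by (intro integrable_continuous_real continuous_intros c)+
    have z: "integral {0..2*pi} (\<lambda>s. \<psi> s * sin (of_int j * s + e)) = 0" for j :: int and e
      using assms by (auto simp: fourier_free_def)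
    show "integral {0..2*pi} (\<lambda>s. (1/2) * (\<psi> s * sin (of_int (k + 1) * s + (a + b))))
       + integral {0..2*pi} (\<lambda>s. (1/2) * (\<psi> s * sin (of_int (k - 1) * s + (a - b)))) = 0"
      unfolding integral_mult_right z by simp
  qed
  ultimately show "integral {0..2*pi} (\<lambda>s. \<psi> s * cos (s + b) * sin (of_int k * s + a)) = 0" by simp
qed

lemma fourier_free_scale:
  assumes "fourier_free \<psi>" shows "fourier_free (\<lambda>s. c * \<psi> s)"
  using assms unfolding fourier_free_def by (auto intro!: continuous_intros simp: mult.assoc)

lemma fourier_free_add:
  assumes "fourier_free \<phi>" "fourier_free \<psi>" shows "fourier_free (\<lambda>s. \<phi> s + \<psi> s)"
proof -
  have c: "continuous_on full_gen \<phi>" "continuous_on full_gen \<psi>" for full_gen 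
    using assms continuous_on_subset unfolding fourier_free_def by blast+
  have "integral {0..2*pi} (\<lambda>s. (\<phi> s + \<psi> s) * sin (of_int k * s + a)) = 
    integral {0..2*pi} (\<lambda>s. \<phi> s * sin (of_int k * s + a)) + integral {0..2*pi} (\<lambda>s. \<psi> s * sin (of_int k * s + a))" for k :: int and a
    unfolding distrib_right by (intro integral_add integrable_continuous_real continuous_intros c)
  then show ?thesis using assms unfolding fourier_free_def by (auto intro!: continuous_intros)
qed

text \<open>Trigonometric polynomials are generated by \<open>cos s\<close> and \<open>sin s\<close>, so stability under multiplication by
  a single cosine extends to all of them.\<close>
lemma fourier_free_polynomial:
  assumes "real_polynomial_function (p :: complex \<Rightarrow> real)" "fourier_free \<psi>"
  shows "fourier_free (\<lambda>s. \<psi> s * p (cis s))"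
  using assms
proof (induction p arbitrary: \<psi> rule: real_polynomial_function.induct)
  case (linear f)
  have "f (cis s) = f 1 * cos (s + 0) + f \<i> * cos (s + (- (pi / 2)))" for s
  proof -
    interpret bounded_linear f by fact
    have "cis s = cos s *\<^sub>R 1 + sin s *\<^sub>R \<i>" by (simp add: complex_eq_iff)
    then have "f (cis s) = cos s * f 1 + sin s * f \<i>" by (simp add: add scaleR)
    then show ?thesis using cos_diff[of s "pi/2"] by simp
  qed
  then have "(\<lambda>s. \<psi> s * f (cis s)) = (\<lambda>s. f 1 * (\<psi> s * cos (s + 0)) + f \<i> * (\<psi> s * cos (s + (- (pi / 2)))))"
    by (auto simp: algebra_simps)
  then show ?case
    by (simp only:) (intro fourier_free_add fourier_free_scale fourier_free_cos linear)
next
  case (const c)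
  then show ?case using fourier_free_scale[of \<psi> c] by (simp add: mult.commute)
next
  case (add f g)
  then show ?case using fourier_free_add[OF add.IH(1)[OF add.prems] add.IH(2)[OF add.prems]]
    by (simp add: distrib_left)
next
  case (mult f g)
  then show ?case using mult.IH(2)[OF mult.IH(1)[OF mult.prems]] by (simp add: mult.assoc)
qed

text \<open>A periodic function descends to the circle. The branch cut of \<^const>\<open>Arg\<close> is avoided by using
  the argument of \<open>- z\<close> near the negative real axis.\<close>
lemma continuous_on_circle:
  fixes g :: "real \<Rightarrow> real"
  assumes cont: "continuous_on UNIV g" and per: "\<And>x. g (x + 2 * pi) = g x"
  shows "continuous_on (sphere 0 1) (\<lambda>z. g (Arg z))"
proof (intro continuous_at_imp_continuous_on ballI)
  fix z :: complex assume "z \<in> sphere 0 1"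
  then have z: "z \<noteq> 0" by auto
  have ig: "isCont g t" for t using cont by (simp add: continuous_on_eq_continuous_at)
  show "isCont (\<lambda>z. g (Arg z)) z"
  proof (cases "z \<in> \<real>\<^sub>\<le>\<^sub>0")
    case False
    then show ?thesis by (intro isCont_o2[OF continuous_at_Arg ig])
  next
    case True
    have neg: "- z \<notin> \<real>\<^sub>\<le>\<^sub>0"
    proof
      assume "- z \<in> \<real>\<^sub>\<le>\<^sub>0"
      then have "Re z = 0" "Im z = 0" using True by (auto simp: complex_nonpos_Reals_iff)
      then show False using z by (simp add: complex_eq_iff)
    qed
    have "isCont (\<lambda>w. - w) z" by (intro continuous_intros)
    then have "isCont (\<lambda>w. Arg (- w)) z" using continuous_at_Arg[OF neg] by (rule isCont_o2)
    moreover have "isCont (\<lambda>t. g (t + pi)) t" for t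
      by (rule isCont_o2[OF _ ig]) (intro continuous_intros)
    ultimately have c: "isCont (\<lambda>w. g (Arg (- w) + pi)) z" by (rule isCont_o2)
    have "g (Arg w) = g (Arg (- w) + pi)" if "w \<noteq> 0" for w
    proof (rule periodic_cis[where F = g, OF per])
      have "cis (Arg (- w) + pi) = - sgn (- w)" using that by (simp add: cis_Arg flip: cis_mult)
      then show "cis (Arg w) = cis (Arg (- w) + pi)" using that by (simp add: cis_Arg sgn_minus)
    qed
    then have "\<forall>\<^sub>F w in nhds z. g (Arg w) = g (Arg (- w) + pi)"
      using t1_space_nhds[OF z] by (auto elim: eventually_mono)
    then show ?thesis using c by (simp add: isCont_cong)
  qed
qed

text \<open>By Stone-Weierstrass \<open>g\<close> is a uniform limit of trigonometric polynomials, and it is orthogonal to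
  each of them; hence \<open>\<integral> g\<^sup>2 = 0\<close>.\<close>
lemma fourier_free_zero:
  assumes g: "fourier_free g" and per: "\<And>x. g (x + 2 * pi) = g x"
  shows "g x = 0"
proof -
  have cont: "continuous_on UNIV g" using g by (simp add: fourier_free_def)
  then have c: "continuous_on full_gen g" for full_gen using continuous_on_subset by blast
  have int: "(\<lambda>s. g s * g s) integrable_on {0..2*pi}" "(\<lambda>s. \<bar>g s\<bar>) integrable_on {0..2*pi}"
    by (intro integrable_continuous_real continuous_intros c)+
  define A where "A = integral {0..2*pi} (\<lambda>s. \<bar>g s\<bar>)"
  have A: "0 \<le> A" unfolding A_def by (intro integral_nonneg int) auto
  have small: "integral {0..2*pi} (\<lambda>s. g s * g s) \<le> e * A" if e: "0 < e" for e
  proof -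
    obtain p where p: "real_polynomial_function p" "\<And>z. z \<in> sphere 0 1 \<Longrightarrow> \<bar>g (Arg z) - p z\<bar> < e"
      using Stone_Weierstrass_real_polynomial_function[OF compact_sphere continuous_on_circle[OF cont per] e] by blast
    have np: "fourier_free (\<lambda>s. g s * p (cis s))" by (rule fourier_free_polynomial[OF p(1) g])
    then have "integral {0..2*pi} (\<lambda>s. g s * p (cis s) * sin (of_int 0 * s + pi / 2)) = 0"
      unfolding fourier_free_def by blast
    then have 0: "integral {0..2*pi} (\<lambda>s. g s * p (cis s)) = 0" by simp
    have "continuous_on {0..2*pi} (\<lambda>s. g s * p (cis s))"
      using np continuous_on_subset unfolding fourier_free_def by blast
    then have ip: "(\<lambda>s. g s * p (cis s)) integrable_on {0..2*pi}" by (rule integrable_continuous_real)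
    have "integral {0..2*pi} (\<lambda>s. g s * g s) = integral {0..2*pi} (\<lambda>s. g s * g s - g s * p (cis s))"
      using integral_diff[OF int(1) ip] 0 by simp
    also have "\<dots> \<le> integral {0..2*pi} (\<lambda>s. e * \<bar>g s\<bar>)"
    proof (rule integral_le)
      fix s :: real
      have "g (Arg (cis s)) = g s"
        by (rule periodic_cis[where F = g, OF per]) (simp add: cis_Arg sgn_div_norm)
      then have "\<bar>g s - p (cis s)\<bar> \<le> e" using p(2)[of "cis s"] by (simp add: less_imp_le)
      then have "\<bar>g s\<bar> * \<bar>g s - p (cis s)\<bar> \<le> \<bar>g s\<bar> * e" by (intro mult_left_mono) auto
      then have "g s * (g s - p (cis s)) \<le> \<bar>g s\<bar> * e"
        using abs_ge_self[of "g s * (g s - p (cis s))"] unfolding abs_mult by linarith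
      then show "g s * g s - g s * p (cis s) \<le> e * \<bar>g s\<bar>" by (simp add: algebra_simps)
    qed (intro integrable_diff integrable_continuous_real continuous_intros c int ip)+
    also have "\<dots> = e * A" by (simp add: A_def)
    finally show ?thesis .
  qed
  have "integral {0..2*pi} (\<lambda>s. g s * g s) \<le> 0"
  proof (rule ccontr)
    assume "\<not> ?thesis"
    then have pos: "0 < integral {0..2*pi} (\<lambda>s. g s * g s)" (is "0 < ?I") by simp
    have "?I \<le> ?I / (2 * (A + 1)) * A" using pos A by (intro small) auto
    also have "\<dots> < ?I"
    proof -
      have "?I * A < ?I * (2 * (A + 1))" using pos A by (intro mult_strict_left_mono) auto
      then show ?thesis using A by (simp add: pos_divide_less_eq)
    qed
    finally show False by simp
  qed
  moreover have "0 \<le> integral {0..2*pi} (\<lambda>s. g s * g s)" by (intro integral_nonneg int) auto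
  ultimately have "integral {0..2*pi} (\<lambda>s. g s * g s) = 0" by simp
  then have "((\<lambda>s. g s * g s) has_integral 0) (cbox 0 (2*pi))" using int(1) by (simp add: has_integral_integral)
  moreover have cg: "continuous_on (cbox 0 (2*pi)) (\<lambda>s. g s * g s)" by (intro continuous_intros c)
  ultimately have z: "g s * g s = 0" if "s \<in> {0..2*pi}" for s
    using has_integral_0_cbox_imp_0[of 0 "2*pi" "\<lambda>s. g s * g s" s] that cg pi_gt_zero by simp
  obtain k :: int where "x + 2 * pi * of_int k \<in> {0..2*pi}" using periodic_reduce by blast
  then show ?thesis using z periodic_int[of g x k] per by simp
qed

text \<open>Induction through the addition theorem; the strict inequality comes from \<open>\<bar>cos \<delta>\<bar> < 1\<close>.\<close>
lemma sin_mult_less: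
  assumes "0 < \<delta>" "\<delta> < pi" "2 \<le> k"
  shows "\<bar>sin (real k * \<delta>)\<bar> < real k * sin \<delta>"
  using assms(3)
proof (induction k rule: dec_induct)
  have s: "0 < sin \<delta>" using assms sin_gt_zero by blast
  have c: "\<bar>cos \<delta>\<bar> < 1"
  proof -
    have "(cos \<delta>)\<^sup>2 < 1" using sin_squared_eq[of \<delta>] s by (metis diff_gt_0_iff_gt zero_less_power)
    then show ?thesis by (simp add: abs_square_less_1)
  qed
  have step: "\<bar>sin (real (Suc k) * \<delta>)\<bar> < real (Suc k) * sin \<delta>" if "\<bar>sin (real k * \<delta>)\<bar> \<le> real k * sin \<delta>" "0 < k" for k
  proof -
    have "sin (real (Suc k) * \<delta>) = sin (real k * \<delta>) * cos \<delta> + cos (real k * \<delta>) * sin \<delta>"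
      using sin_add[of "real k * \<delta>" \<delta>] by (simp add: algebra_simps)
    then have "\<bar>sin (real (Suc k) * \<delta>)\<bar> \<le> \<bar>sin (real k * \<delta>)\<bar> * \<bar>cos \<delta>\<bar> + \<bar>cos (real k * \<delta>)\<bar> * sin \<delta>"
      using abs_triangle_ineq[of "sin (real k * \<delta>) * cos \<delta>" "cos (real k * \<delta>) * sin \<delta>"] s by (simp add: abs_mult)
    also have "\<dots> \<le> real k * sin \<delta> * \<bar>cos \<delta>\<bar> + 1 * sin \<delta>"
      using that s by (intro add_mono mult_right_mono) auto
    also have "\<dots> < real k * sin \<delta> * 1 + 1 * sin \<delta>"
      using that s c by (intro add_strict_right_mono mult_strict_left_mono) auto
    finally show ?thesis by (simp add: algebra_simps)
  qed
  show "\<bar>sin (real 2 * \<delta>)\<bar> < real 2 * sin \<delta>" using step[of 1] s by (simp add: numeral_2_eq_2)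
  fix k assume "2 \<le> k" "\<bar>sin (real k * \<delta>)\<bar> < real k * sin \<delta>"
  then show "\<bar>sin (real (Suc k) * \<delta>)\<bar> < real (Suc k) * sin \<delta>" using step[of k] by simp
qed

text \<open>After subtraction of its constant and first modes, a function without modes of order at least two
  has no modes at all.\<close>
lemma first_harmonic:
  assumes cont: "continuous_on UNIV h" and per: "\<And>x. h (x + 2 * pi) = h x"
    and modes: "\<And>k a. 2 \<le> k \<Longrightarrow> integral {0..2*pi} (\<lambda>s. h s * sin (real k * s + a)) = 0"
  shows "\<exists>r w. \<forall>s. h s = r + w \<bullet> cis s"
proof -
  have c: "continuous_on full_gen h" for full_gen using cont continuous_on_subset by blast
  define A where "A = integral {0..2*pi} h / (2*pi)"
  define B where "B = integral {0..2*pi} (\<lambda>s. h s * cos s) / pi"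
  define C where "C = integral {0..2*pi} (\<lambda>s. h s * sin s) / pi"
  define g where "g = (\<lambda>s. h s - (A + B * cos s + C * sin s))"
  define t where "t = (\<lambda>(k::int) a s. sin (of_int k * s + a) :: real)"
  have tc: "continuous_on full_gen (t k a)" for full_gen k a unfolding t_def by (intro continuous_intros)
  have t0: "integral {0..2*pi} (t k a) = (if k = 0 then 2 * pi * sin a else 0)" for k a
    using integral_trig_period[of k a] by (auto simp: t_def)
  have J: "integral {0..2*pi} (\<lambda>s. g s * t k a s) = integral {0..2*pi} (\<lambda>s. h s * t k a s)
     - A * integral {0..2*pi} (t k a)
     - B / 2 * (integral {0..2*pi} (t (k + 1) a) + integral {0..2*pi} (t (k - 1) a))
     - C / 2 * (integral {0..2*pi} (t (k + 1) (a - pi / 2)) + integral {0..2*pi} (t (k - 1) (a + pi / 2)))" for k a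
  proof -
    have ti: "t k a integrable_on {0..2*pi}" for k a by (intro integrable_continuous_real tc)
    have hi: "(\<lambda>s. h s * t k a s) integrable_on {0..2*pi}" by (intro integrable_continuous_real continuous_intros tc c)
    have "g s * t k a s = h s * t k a s - A * t k a s - B / 2 * (t (k + 1) a s + t (k - 1) a s)
       - C / 2 * (t (k + 1) (a - pi / 2) s + t (k - 1) (a + pi / 2) s)" for s
    proof -
      have e: "of_int (k + 1) * s + a = (of_int k * s + a) + s" "of_int (k - 1) * s + a = (of_int k * s + a) - s"
        "of_int (k + 1) * s + (a - pi / 2) = ((of_int k * s + a) + s) - pi / 2"
        "of_int (k - 1) * s + (a + pi / 2) = ((of_int k * s + a) - s) + pi / 2" by (simp_all add: algebra_simps)
      have q: "sin (u - pi / 2) = - cos u" "sin (u + pi / 2) = cos u" for u :: real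
        by (simp_all add: sin_diff sin_add)
      define u where "u = of_int k * s + a"
      have prod: "(sin (u + s) + sin (u - s)) / 2 = cos s * sin u" "(- cos (u + s) + cos (u - s)) / 2 = sin s * sin u"
        by (simp_all add: sin_add sin_diff cos_add cos_diff)
      have "g s * sin u = h s * sin u - A * sin u - B * (cos s * sin u) - C * (sin s * sin u)"
        by (simp add: g_def algebra_simps)
      then show ?thesis unfolding t_def e q u_def[symmetric] prod[symmetric] by simp
    qed
    then have "integral {0..2*pi} (\<lambda>s. g s * t k a s) = integral {0..2*pi} (\<lambda>s. h s * t k a s - A * t k a s - B / 2 * (t (k + 1) a s + t (k - 1) a s)
       - C / 2 * (t (k + 1) (a - pi / 2) s + t (k - 1) (a + pi / 2) s))" by simp
    also have "\<dots> = integral {0..2*pi} (\<lambda>s. h s * t k a s)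
     - A * integral {0..2*pi} (t k a)
     - B / 2 * (integral {0..2*pi} (t (k + 1) a) + integral {0..2*pi} (t (k - 1) a))
     - C / 2 * (integral {0..2*pi} (t (k + 1) (a - pi / 2)) + integral {0..2*pi} (t (k - 1) (a + pi / 2)))"
      by (intro integral_unique has_integral_diff has_integral_mult_right has_integral_add
          integrable_integral ti hi)
    finally show ?thesis .
  qed
  have hcs: "integral {0..2*pi} (\<lambda>s. h s * (p * cos s + q * sin s)) = pi * (p * B + q * C)" for p q
  proof -
    have i: "(\<lambda>s. h s * cos s) integrable_on {0..2*pi}" "(\<lambda>s. h s * sin s) integrable_on {0..2*pi}"
      by (intro integrable_continuous_real continuous_intros c)+
    have "integral {0..2*pi} (\<lambda>s. h s * (p * cos s + q * sin s)) = integral {0..2*pi} (\<lambda>s. p * (h s * cos s) + q * (h s * sin s))"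
      by (simp add: algebra_simps)
    also have "\<dots> = p * integral {0..2*pi} (\<lambda>s. h s * cos s) + q * integral {0..2*pi} (\<lambda>s. h s * sin s)"
      by (intro integral_unique has_integral_add has_integral_mult_right integrable_integral i)
    finally show ?thesis by (simp add: B_def C_def algebra_simps)
  qed
  have nonneg: "integral {0..2*pi} (\<lambda>s. g s * t k a s) = 0" if k: "0 \<le> k" for k a
  proof -
    consider "k = 0" | "k = 1" | "2 \<le> k" using k by linarith
    then show ?thesis
    proof cases
      case 1
      then show ?thesis unfolding J t0 by (simp add: t_def A_def)
    next
      case 2
      have "integral {0..2*pi} (\<lambda>s. h s * t k a s) = pi * (sin a * B + cos a * C)"
        unfolding 2 t_def using hcs[of "sin a" "cos a"] by (simp add: sin_add algebra_simps)
      then show ?thesis unfolding J t0 using 2 by (simp add: sin_add algebra_simps)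
    next
      case 3
      then have "integral {0..2*pi} (\<lambda>s. h s * t k a s) = 0" using modes[of "nat k" a] by (simp add: t_def)
      then show ?thesis unfolding J t0 using 3 by simp
    qed
  qed
  have "integral {0..2*pi} (\<lambda>s. g s * t k a s) = 0" for k a
  proof (cases "0 \<le> k")
    case False
    have "t k a s = - t (- k) (- a) s" for s
    proof -
      have "of_int k * s + a = - (of_int (- k) * s + (- a))" by simp
      then show ?thesis unfolding t_def by (metis sin_minus)
    qed
    then have "integral {0..2*pi} (\<lambda>s. g s * t k a s) = - integral {0..2*pi} (\<lambda>s. g s * t (- k) (- a) s)"
      by simp
    then show ?thesis using nonneg[of "- k" "- a"] False by simp
  qed (rule nonneg)
  then have "fourier_free g"
    unfolding fourier_free_def t_def by (auto simp: g_def intro!: continuous_intros c)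
  moreover have "g (x + 2 * pi) = g x" for x using per by (simp add: g_def)
  ultimately have "g s = 0" for s using fourier_free_zero by blast
  then have "h s = A + Complex B C \<bullet> cis s" for s
    by (simp add: g_def inner_complex_def add_eq_0_iff algebra_simps)
  then show ?thesis by blast
qed

lemma cos_affine_period: "cos (real k * (s + 2 * pi) + a) = cos (real k * s + a)"
  by (rule cos_eq_periodic_intro[of _ _ "int k"]) (simp add: algebra_simps)

section \<open>Configurations\<close>

lemma admissibleD: "admissible x \<Longrightarrow> x i \<le> x (i + 1)" "admissible x \<Longrightarrow> x (i + 1) < x i + pi"
  by (auto simp: admissible_def algebra_simps)

lemma admissible_mono:
  assumes "admissible x" "m \<le> n" shows "x m \<le> x n"
  using assms(2)
proof (induction n rule: int_ge_induct)
  case (step i) then show ?case using admissibleD[OF assms(1), of i] by simp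
qed simp

lemma admissible_imp_segment: "admissible x \<Longrightarrow> admissible_segment m n x"
  by (auto simp: admissible_def admissible_segment_def)

lemma admissible_min_max:
  assumes "admissible x" "admissible y"
  shows "admissible (\<lambda>i. min (x i) (y i))" "admissible (\<lambda>i. max (x i) (y i))"
  using assms unfolding admissible_def by (auto simp: min_def max_def; smt (verit))+

lemma admissible_translate:
  assumes "admissible x" shows "admissible (\<lambda>i. x (i + j) + a)"
  unfolding admissible_def
proof
  fix i
  have eq: "i + 1 + j = (i + j) + 1" by simp
  show "0 \<le> x (i + 1 + j) + a - (x (i + j) + a) \<and> x (i + 1 + j) + a - (x (i + j) + a) < pi"
    using assms[unfolded admissible_def, rule_format, of "i + j"] unfolding eq by simp
qed

text \<open>Lifts of closed \<open>n\<close>-gons of winding number \<open>p\<close>.\<close>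
definition winds :: "int \<Rightarrow> int \<Rightarrow> (int \<Rightarrow> real) \<Rightarrow> bool" where
  "winds p n x \<longleftrightarrow> (\<forall>i. x (i + n) = x i + 2 * pi * of_int p)"

lemma winds_mult: "winds p n x \<Longrightarrow> x (i + k * n) = x i + 2 * pi * of_int (p * k)"
proof (induction k rule: int_induct[where k = 0])
  case (step1 k)
  then show ?case unfolding winds_def by (simp add: algebra_simps)
      (metis add.assoc add.commute)
next
  case (step2 k)
  have "x (i + (k - 1) * n + n) = x (i + (k - 1) * n) + 2 * pi * of_int p"
    using step2.prems by (simp add: winds_def)
  then show ?case using step2 by (simp add: algebra_simps)
qed simp

text \<open>A segment that closes up after \<open>n\<close> steps extends periodically. This lets competitors on a window of
  length \<open>n\<close> compete with periodic minimizers.\<close>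
lemma winds_extension:
  assumes n: "0 < n" and seg: "admissible_segment m (m + n) \<psi>"
    and close: "\<psi> (m + n) = \<psi> m + 2 * pi * of_int p"
  obtains y where "admissible y" "winds p n y" "\<And>i. m \<le> i \<Longrightarrow> i \<le> m + n \<Longrightarrow> y i = \<psi> i"
proof -
  define y where "y = (\<lambda>i. \<psi> (m + (i - m) mod n) + 2 * pi * of_int (p * ((i - m) div n)))"
  have winds: "winds p n y"
  proof -
    have "i + n - m = (i - m) + n" for i by simp
    then have "(i + n - m) mod n = (i - m) mod n" "(i + n - m) div n = (i - m) div n + 1" for i
      using n by (metis mod_add_self2, metis div_add_self2 less_irrefl)
    then show ?thesis unfolding winds_def y_def by (simp add: algebra_simps)
  qed
  have agree: "y i = \<psi> i" if "m \<le> i" "i \<le> m + n" for i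
  proof (cases "i = m + n")
    case True then show ?thesis using n close by (simp add: y_def)
  next
    case False then have "(i - m) mod n = i - m" "(i - m) div n = 0" using that by auto
    then show ?thesis by (simp add: y_def)
  qed
  have "0 \<le> y (i + 1) - y i \<and> y (i + 1) - y i < pi" for i
  proof -
    define k where "k = (i - m) div n"
    define j where "j = m + (i - m) mod n"
    have ij: "i = j + k * n" by (simp add: j_def k_def)
    have j: "m \<le> j" "j < m + n" using n by (auto simp: j_def)
    have shift: "y (l + k * n) = y l + 2 * pi * of_int (p * k)" for l
    proof (induction k rule: int_induct[where k = 0])
      case (step1 i) then show ?case using winds[unfolded winds_def, rule_format, of "l + i * n"]
        by (simp add: algebra_simps)
    next
      case (step2 i) then show ?case using winds[unfolded winds_def, rule_format, of "l + (i - 1) * n"]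
        by (simp add: algebra_simps)
    qed simp
    have "y (i + 1) - y i = y (j + 1) - y j"
      using shift[of j] shift[of "j + 1"] ij by (simp add: algebra_simps)
    also have "\<dots> = \<psi> (j + 1) - \<psi> j" using j agree by simp
    finally show ?thesis using seg j by (simp add: admissible_segment_def)
  qed
  then have "admissible y" by (simp add: admissible_def)
  then show ?thesis using that winds agree by blast
qed

definition bounded_steps :: "real \<Rightarrow> (int \<Rightarrow> real) set" where
  "bounded_steps D = {x. x 0 \<in> {0..2*pi} \<and> (\<forall>i. 0 \<le> x (i + 1) - x i \<and> x (i + 1) - x i \<le> D)}"

text \<open>Tychonoff: the configurations form a closed subset of a product of compact intervals.\<close>
lemma compact_bounded_steps: "compact (bounded_steps D)"
proof -
  define B where "B = (\<lambda>i::int. {- \<bar>D\<bar> * \<bar>of_int i\<bar> .. 2 * pi + \<bar>D\<bar> * \<bar>of_int i\<bar>})"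
  have "compactin (product_topology (\<lambda>i. euclidean) UNIV) (PiE UNIV B)"
    by (simp add: compactin_PiE B_def)
  then have comp: "compact (PiE UNIV B)" 
    by (simp add: euclidean_product_topology)
  have cl: "closed (bounded_steps D)"
  proof -
    have "bounded_steps D = {x. 0 \<le> x 0} \<inter> {x. x 0 \<le> 2 * pi}
        \<inter> (\<Inter>i. {x. 0 \<le> x (i + 1) - x i}) \<inter> (\<Inter>i. {x. x (i + 1) - x i \<le> D})"
      by (auto simp: bounded_steps_def)
    then show ?thesis
      by (auto intro!: closed_Int closed_INT closed_Collect_le continuous_intros)
  qed
  have "x i \<in> B i" if x: "x \<in> bounded_steps D" for x i
  proof -
    have st: "0 \<le> x (i + 1) - x i" "x (i + 1) - x i \<le> D" for i using x by (simp_all add: bounded_steps_def)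
    have "D \<ge> 0" using x unfolding bounded_steps_def by (smt (verit) mem_Collect_eq)
    have "\<bar>x i - x 0\<bar> \<le> D * \<bar>of_int i\<bar>"
    proof (induction i rule: int_induct[where k = 0])
      case (step1 i)
      then show ?case using st[of "i"]
        by (simp add: algebra_simps abs_if split: if_splits)
    next
      case (step2 i)
      then show ?case using st[of "i - 1"]
        by (simp add: algebra_simps abs_if split: if_splits)
    qed simp
    then show ?thesis using x \<open>D \<ge> 0\<close> by (auto simp: B_def bounded_steps_def)
  qed
  then have "bounded_steps D \<subseteq> PiE UNIV B" by auto
  then show ?thesis using comp cl by (metis compact_Int_closed inf.absorb_iff2)
qed

lemma tendsto_coordinate:
  fixes X :: "nat \<Rightarrow> int \<Rightarrow> real"
  assumes "X \<longlonglongrightarrow> x" shows "(\<lambda>n. X n i) \<longlonglongrightarrow> x i"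
proof -
  have "continuous_on UNIV (\<lambda>x::int \<Rightarrow> real. x i)" by simp
  from continuous_on_tendsto_compose[OF this assms] show ?thesis by simp
qed

definition linear_path :: "int \<Rightarrow> int \<Rightarrow> real \<Rightarrow> real \<Rightarrow> int \<Rightarrow> real" where
  "linear_path m K a b i = a + of_int (i - m) * ((b - a) / of_int K)"

lemma linear_path:
  assumes "0 < K" "a \<le> b" "b - a \<le> of_int K * d"
  shows "linear_path m K a b m = a" "linear_path m K a b (m + K) = b"
    "linear_path m K a b i \<le> linear_path m K a b (i + 1)" "linear_path m K a b (i + 1) \<le> linear_path m K a b i + d"
proof -
  have "0 \<le> (b - a) / of_int K" "(b - a) / of_int K \<le> d" using assms 
    by (simp_all add: pos_divide_le_eq mult.commute)
  moreover have "linear_path m K a b (i + 1) = linear_path m K a b i + (b - a) / of_int K"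
  proof -
    have "real_of_int (i + 1 - m) = of_int (i - m) + 1" by simp
    then show ?thesis unfolding linear_path_def by (simp only: distrib_right mult_1_left add.assoc)
  qed
  ultimately show "linear_path m K a b i \<le> linear_path m K a b (i + 1)" "linear_path m K a b (i + 1) \<le> linear_path m K a b i + d"
    by simp_all
qed (use assms in \<open>auto simp: linear_path_def\<close>)

text \<open>A step size strictly between the mean step \<open>2 \<pi> \<rho>\<close> and the forbidden value \<open>\<pi>\<close>. Equal steps of at most this size
  let a configuration catch up with one of rotation number \<open>\<rho>\<close>.\<close>
definition mid_step :: "real \<Rightarrow> real" where "mid_step \<rho> = (pi + 2 * pi * \<rho>) / 2"

lemma mid_step: "\<rho> < 1/2 \<Longrightarrow> 2 * pi * \<rho> < mid_step \<rho>" "\<rho> < 1/2 \<Longrightarrow> mid_step \<rho> < pi"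
  "0 < \<rho> \<Longrightarrow> 0 < mid_step \<rho>"
proof -
  assume "\<rho> < 1/2"
  then have "2 * pi * \<rho> < 2 * pi * (1/2)" by (intro mult_strict_left_mono) auto
  then show "2 * pi * \<rho> < mid_step \<rho>" "mid_step \<rho> < pi" by (simp_all add: mid_step_def)
qed (simp add: mid_step_def add_pos_pos)

lemma rotation_deviation:
  assumes rot: "has_rotation_number x \<rho>" and \<eta>: "0 < \<eta>"
  shows "\<exists>I. \<forall>i. I \<le> \<bar>i\<bar> \<longrightarrow> \<bar>x i - 2 * pi * \<rho> * of_int i\<bar> \<le> \<eta> * of_int \<bar>i\<bar>"
proof -
  have e: "0 < \<eta> / (2 * pi)" using \<eta> by simp
  have "\<forall>\<^sub>F i in at_top. dist (x i / (2 * pi * of_int i)) \<rho> < \<eta> / (2 * pi)"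
    "\<forall>\<^sub>F i in at_bot. dist (x i / (2 * pi * of_int i)) \<rho> < \<eta> / (2 * pi)"
    using rot unfolding has_rotation_number_def by (auto intro: tendstoD[OF _ e])
  then obtain I1 I2 where I: "\<And>i. I1 \<le> i \<Longrightarrow> dist (x i / (2 * pi * of_int i)) \<rho> < \<eta> / (2 * pi)"
    "\<And>i. i \<le> I2 \<Longrightarrow> dist (x i / (2 * pi * of_int i)) \<rho> < \<eta> / (2 * pi)"
    by (auto simp: eventually_at_top_linorder eventually_at_bot_linorder)
  show ?thesis
  proof (intro exI[of _ "max 1 (max I1 (- I2))"] allI impI)
    fix i assume i: "max 1 (max I1 (- I2)) \<le> \<bar>i\<bar>"
    then have i0: "i \<noteq> 0" and "I1 \<le> i \<or> i \<le> I2" by auto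
    then have "dist (x i / (2 * pi * of_int i)) \<rho> < \<eta> / (2 * pi)" using I by blast
    then have "\<bar>x i / (2 * pi * of_int i) - \<rho>\<bar> * (2 * pi * of_int \<bar>i\<bar>) \<le> \<eta> / (2 * pi) * (2 * pi * of_int \<bar>i\<bar>)"
      by (intro mult_right_mono) (auto simp: dist_real_def)
    moreover have "\<bar>x i / (2 * pi * of_int i) - \<rho>\<bar> * (2 * pi * of_int \<bar>i\<bar>) = \<bar>(x i / (2 * pi * of_int i) - \<rho>) * (2 * pi * of_int i)\<bar>"
      by (simp add: abs_mult)
    moreover have "(x i / (2 * pi * of_int i) - \<rho>) * (2 * pi * of_int i) = x i - 2 * pi * \<rho> * of_int i"
      using i0 by (simp add: field_simps)
    ultimately show "\<bar>x i - 2 * pi * \<rho> * of_int i\<bar> \<le> \<eta> * of_int \<bar>i\<bar>" by simp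
  qed
qed

lemma bounded_deviation_rotation:
  assumes "\<And>i. \<bar>x i - 2 * pi * \<rho> * of_int i\<bar> \<le> C"
  shows "has_rotation_number x \<rho>"
proof -
  have bnd: "norm (x i / (2 * pi * of_int i) - \<rho>) \<le> C / (2 * pi) / \<bar>of_int i\<bar>" if "i \<noteq> 0" for i
  proof -
    have "x i / (2 * pi * of_int i) - \<rho> = (x i - 2 * pi * \<rho> * of_int i) / (2 * pi * of_int i)"
      using that by (simp add: field_simps)
    then have "\<bar>x i / (2 * pi * of_int i) - \<rho>\<bar> = \<bar>x i - 2 * pi * \<rho> * of_int i\<bar> / (2 * pi * \<bar>of_int i\<bar>)"
      by (simp add: abs_mult)
    also have "\<dots> \<le> C / (2 * pi * \<bar>of_int i\<bar>)" by (intro divide_right_mono assms) auto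
    finally show ?thesis unfolding real_norm_def divide_divide_eq_left .
  qed
  have inv: "((\<lambda>i::int. C / (2 * pi) / \<bar>real_of_int i\<bar>) \<longlongrightarrow> 0) F"
    if "filterlim (\<lambda>i::int. \<bar>real_of_int i\<bar>) at_top F" for F
    using tendsto_mult_right_zero[OF tendsto_inverse_0_at_top[OF that], of "C / (2 * pi)"]
    by (simp only: divide_inverse[symmetric])
  have top: "filterlim (\<lambda>i::int. \<bar>real_of_int i\<bar>) at_top at_top"
    by (rule filterlim_at_top_mono[OF filterlim_real_of_int_at_top]) (intro always_eventually allI abs_ge_self)
  have bot: "filterlim (\<lambda>i::int. \<bar>real_of_int i\<bar>) at_top at_bot"
    unfolding filterlim_at_top
  proof
    fix Z :: real
    show "\<forall>\<^sub>F i::int in at_bot. Z \<le> \<bar>real_of_int i\<bar>"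
      by (rule eventually_mono[OF eventually_le_at_bot[of "- \<lceil>\<bar>Z\<bar>\<rceil>"]]) linarith
  qed
  have ne: "\<forall>\<^sub>F i::int in at_top. i \<noteq> 0" "\<forall>\<^sub>F i::int in at_bot. i \<noteq> 0"
    using eventually_gt_at_top[of "0::int"] eventually_gt_at_bot[of "0::int"] by (auto elim: eventually_mono)
  show ?thesis unfolding has_rotation_number_def
  proof
    show "((\<lambda>i. x i / (2 * pi * of_int i)) \<longlongrightarrow> \<rho>) at_top"
      by (rule LIM_zero_cancel, rule Lim_null_comparison[OF eventually_mono[OF ne(1) bnd] inv[OF top]])
    show "((\<lambda>i. x i / (2 * pi * of_int i)) \<longlongrightarrow> \<rho>) at_bot"
      by (rule LIM_zero_cancel, rule Lim_null_comparison[OF eventually_mono[OF ne(2) bnd] inv[OF bot]])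
  qed
qed

section \<open>The reduced generating function\<close>

text \<open>The analytic properties of a support function on which the variational theory rests. The last one,
  positivity of the generating function, is what makes the billiard map twist.\<close>
locale support_data =
  fixes h h' :: "real \<Rightarrow> real"
  assumes h_pos: "h x > 0"
    and h_per: "h (x + 2 * pi) = h x"
    and h_deriv: "(h has_real_derivative h' x) (at x)"
    and h'_cont: "continuous_on UNIV h'"
    and twist: "x < y \<Longrightarrow> y < x + pi \<Longrightarrow> 0 < (h x + h y) * tan ((y - x) / 2) + h' y - h' x"
begin

definition half_tan :: "real \<Rightarrow> real \<Rightarrow> real" where
  "half_tan x y = tan ((y - x) / 2)"

text \<open>The generating function \<open>full_gen\<close> below differs from \<open>gen\<close> by a term that telescopes, so both have the
  same minimizing segments.\<close>
definition gen :: "real \<Rightarrow> real \<Rightarrow> real" where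
  "gen x y = (h x + h y) * half_tan x y"

definition full_gen :: "real \<Rightarrow> real \<Rightarrow> real" where
  "full_gen x y = gen x y + h' y - h' x"

text \<open>The partial derivatives of \<open>gen\<close>.\<close>
definition D1 :: "real \<Rightarrow> real \<Rightarrow> real" where
  "D1 x y = h' x * half_tan x y - (h x + h y) * (1 + (half_tan x y)\<^sup>2) / 2"

definition D2 :: "real \<Rightarrow> real \<Rightarrow> real" where
  "D2 x y = h' y * half_tan x y + (h x + h y) * (1 + (half_tan x y)\<^sup>2) / 2"

lemma half_tan_deriv1:
  assumes "\<bar>y - x\<bar> < pi"
  shows "((\<lambda>x. half_tan x y) has_real_derivative - ((1 + (half_tan x y)\<^sup>2) / 2)) (at x)"
proof -
  have "((\<lambda>x. y - x) has_real_derivative - 1) (at x)" by (auto intro!: derivative_eq_intros)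
  from DERIV_chain2[where g = "\<lambda>x. y - x" and x = x, OF tan_half_deriv[OF assms] this]
  show ?thesis by (simp add: half_tan_def)
qed

lemma half_tan_deriv2:
  assumes "\<bar>y - x\<bar> < pi"
  shows "((\<lambda>y. half_tan x y) has_real_derivative (1 + (half_tan x y)\<^sup>2) / 2) (at y)"
proof -
  have "((\<lambda>y. y - x) has_real_derivative 1) (at y)" by (auto intro!: derivative_eq_intros)
  from DERIV_chain2[where g = "\<lambda>y. y - x" and x = y, OF tan_half_deriv[OF assms] this]
  show ?thesis by (simp add: half_tan_def)
qed

lemma gen_deriv1: "\<bar>y - x\<bar> < pi \<Longrightarrow> ((\<lambda>x. gen x y) has_real_derivative D1 x y) (at x)"
  unfolding gen_def D1_def
  by (auto intro!: derivative_eq_intros half_tan_deriv1 h_deriv simp: field_simps)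

lemma gen_deriv2: "\<bar>y - x\<bar> < pi \<Longrightarrow> ((\<lambda>y. gen x y) has_real_derivative D2 x y) (at y)"
  unfolding gen_def D2_def
  by (auto intro!: derivative_eq_intros half_tan_deriv2 h_deriv simp: field_simps)

text \<open>This identity is the reason why tangent lengths control the twist: the mixed second derivative of
  \<open>gen\<close> is a negative multiple of the full generating function.\<close>
lemma D1_deriv2:
  assumes "\<bar>y - x\<bar> < pi"
  shows "((\<lambda>y. D1 x y) has_real_derivative - ((1 + (half_tan x y)\<^sup>2) / 2 * full_gen x y)) (at y)"
  unfolding D1_def full_gen_def gen_def
  by (auto intro!: derivative_eq_intros half_tan_deriv2 h_deriv assms) (simp add: field_simps power2_eq_square)

lemma D2_deriv1:
  assumes "\<bar>y - x\<bar> < pi"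
  shows "((\<lambda>x. D2 x y) has_real_derivative - ((1 + (half_tan x y)\<^sup>2) / 2 * full_gen x y)) (at x)"
  unfolding D2_def full_gen_def gen_def
  by (auto intro!: derivative_eq_intros half_tan_deriv1 h_deriv assms) (simp add: field_simps power2_eq_square)

lemma twist_deriv_neg:
  "x < y \<Longrightarrow> y < x + pi \<Longrightarrow> - ((1 + (half_tan x y)\<^sup>2) / 2 * full_gen x y) < 0"
  using twist[of x y] one_plus_sq_pos[of "half_tan x y"] by (simp add: full_gen_def gen_def half_tan_def)

lemma D1_strict:
  assumes "x \<le> y" "y < y'" "y' < x + pi"
  shows "D1 x y' < D1 x y"
proof (rule DERIV_neg_imp_decreasing_open[OF assms(2)])
  fix u assume u: "y < u" "u < y'"
  then show "\<exists>d. ((\<lambda>y. D1 x y) has_real_derivative d) (at u) \<and> d < 0"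
    using assms D1_deriv2[of u x] twist_deriv_neg[of x u]
    by (intro exI[of _ "- ((1 + (half_tan x u)\<^sup>2) / 2 * full_gen x u)"]) simp
next
  show "continuous_on {y..y'} (D1 x)"
    using assms by (intro continuous_at_imp_continuous_on ballI DERIV_isCont[OF D1_deriv2]) auto
qed

lemma D2_strict:
  assumes "x < x'" "x' \<le> y" "y < x + pi"
  shows "D2 x' y < D2 x y"
proof (rule DERIV_neg_imp_decreasing_open[OF assms(1)])
  fix u assume u: "x < u" "u < x'"
  then show "\<exists>d. ((\<lambda>x. D2 x y) has_real_derivative d) (at u) \<and> d < 0"
    using assms D2_deriv1[of y u] twist_deriv_neg[of u y]
    by (intro exI[of _ "- ((1 + (half_tan u y)\<^sup>2) / 2 * full_gen u y)"]) simp
next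
  show "continuous_on {x..x'} (\<lambda>x. D2 x y)"
    using assms by (intro continuous_at_imp_continuous_on ballI DERIV_isCont[OF D2_deriv1]) auto
qed

text \<open>Aubry's inequality: crossing pairs cost more than uncrossed ones. It integrates the monotonicity
  of \<open>D1\<close> in its second argument.\<close>
lemma gen_submodular:
  assumes "a < a'" "a' \<le> b" "b < b'" "b' < a + pi"
  shows "gen a b + gen a' b' < gen a b' + gen a' b"
proof -
  have "gen a' b' - gen a' b < gen a b' - gen a b"
  proof (rule DERIV_neg_imp_decreasing_open[OF assms(1)])
    fix u assume u: "a < u" "u < a'"
    have "((\<lambda>u. gen u b' - gen u b) has_real_derivative D1 u b' - D1 u b) (at u)"
      using u assms by (intro DERIV_diff gen_deriv1) auto
    moreover have "D1 u b' < D1 u b" using u assms by (intro D1_strict) auto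
    ultimately show "\<exists>d. ((\<lambda>u. gen u b' - gen u b) has_real_derivative d) (at u) \<and> d < 0"
      by (intro exI conjI) auto
  next
    show "continuous_on {a..a'} (\<lambda>u. gen u b' - gen u b)"
      using assms by (intro continuous_at_imp_continuous_on ballI isCont_diff DERIV_isCont[OF gen_deriv1]) auto
  qed
  then show ?thesis by simp
qed

lemma D_diag: "D2 x x + D1 x x = 0"
  by (simp add: D1_def D2_def half_tan_def)

text \<open>At an interior minimum this is stationarity. When \<open>c\<close> coincides with a neighbour, only one
  one-sided inequality comes from minimality; the other follows from \<open>D2 c c + D1 c c = 0\<close> and the
  monotonicity of the partial derivatives. The equation thus holds for zero steps as well.\<close>
lemma euler_lagrange_triple:
  assumes "a \<le> c" "c \<le> r" "c < a + pi" "r < c + pi"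
    and min: "\<And>u. a \<le> u \<Longrightarrow> u \<le> r \<Longrightarrow> u < a + pi \<Longrightarrow> r < u + pi \<Longrightarrow> gen a c + gen c r \<le> gen a u + gen u r"
  shows "D2 a c + D1 c r = 0"
proof (rule antisym)
  have der: "((\<lambda>u. gen a u + gen u r) has_real_derivative D2 a c + D1 c r) (at c)"
    using assms by (intro DERIV_add gen_deriv1 gen_deriv2) auto
  show "D2 a c + D1 c r \<le> 0"
  proof (cases "a < c")
    case True
    show ?thesis
    proof (rule ccontr)
      assume "\<not> ?thesis"
      then have "0 < D2 a c + D1 c r" by simp
      from DERIV_pos_inc_left[OF der this] obtain d where d: "d > 0"
        "\<And>u. 0 < u \<Longrightarrow> u < d \<Longrightarrow> gen a (c - u) + gen (c - u) r < gen a c + gen c r" by auto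
      define u where "u = min (d / 2) (min (c - a) ((c + pi - r) / 2))"
      have u: "0 < u" "u < d" "u \<le> c - a" "u \<le> (c + pi - r) / 2" 
        using d(1) True assms by (auto simp: u_def min_def)
      have "c - u \<le> r" "a \<le> c - u" "c - u < a + pi" "r < c - u + pi" using u assms by auto
      with d(2)[of u] min[of "c - u"] u show False by linarith
    qed
  next
    case False
    then have [simp]: "a = c" using assms by simp
    have "D1 c r \<le> D1 c c" using D1_strict[of c c r] assms by (cases "r = c") auto
    then show ?thesis using D_diag[of c] by simp
  qed
  show "0 \<le> D2 a c + D1 c r"
  proof (cases "c < r")
    case True
    show ?thesis
    proof (rule ccontr)
      assume "\<not> ?thesis"
      then have "D2 a c + D1 c r < 0" by simp
      from DERIV_neg_dec_right[OF der this] obtain d where d: "d > 0"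
        "\<And>u. 0 < u \<Longrightarrow> u < d \<Longrightarrow> gen a (c + u) + gen (c + u) r < gen a c + gen c r" by auto
      define u where "u = min (d / 2) (min (r - c) ((a + pi - c) / 2))"
      have u: "0 < u" "u < d" "u \<le> r - c" "u \<le> (a + pi - c) / 2" 
        using d(1) True assms by (auto simp: u_def min_def)
      have "c + u \<le> r" "a \<le> c + u" "c + u < a + pi" "r < c + u + pi" using u assms by auto
      with d(2)[of u] min[of "c + u"] u show False by linarith
    qed
  next
    case False
    then have [simp]: "r = c" using assms by simp
    have "D2 c c \<le> D2 a c" using D2_strict[of a c c] assms by (cases "a = c") auto
    then show ?thesis using D_diag[of c] by simp
  qed
qed

lemma h_per_int: "h (x + 2 * pi * of_int k) = h x"
  by (rule periodic_int[where F = h, OF h_per])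

lemma gen_shift: "gen (x + 2 * pi * of_int k) (y + 2 * pi * of_int k) = gen x y"
  by (simp add: gen_def half_tan_def h_per_int)

lemma h_cont: "continuous_on A h"
  by (meson DERIV_continuous_on has_field_derivative_at_within h_deriv)

lemma h_bounds: obtains lo hi where "0 < lo" "\<And>x. lo \<le> h x" "\<And>x. h x \<le> hi"
proof -
  have ne: "compact {0..2*pi}" "{0..2*pi} \<noteq> {}" by auto
  obtain a where a: "a \<in> {0..2*pi}" "\<And>y. y \<in> {0..2*pi} \<Longrightarrow> h a \<le> h y"
    using continuous_attains_inf[OF ne h_cont] by blast
  obtain b where b: "b \<in> {0..2*pi}" "\<And>y. y \<in> {0..2*pi} \<Longrightarrow> h y \<le> h b"
    using continuous_attains_sup[OF ne h_cont] by blast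
  show ?thesis
  proof (rule that[of "h a" "h b"])
    show "0 < h a" by (rule h_pos)
    fix x
    obtain k where "x + 2 * pi * of_int k \<in> {0..2*pi}" using periodic_reduce by blast
    from a(2)[OF this] b(2)[OF this] show "h a \<le> h x" "h x \<le> h b"
      by (simp_all add: h_per_int)
  qed
qed

section \<open>Periodic minimizers do not cross\<close>

definition gen_action :: "int \<Rightarrow> int \<Rightarrow> (int \<Rightarrow> real) \<Rightarrow> real" where
  "gen_action m n x = (\<Sum>i\<in>{m..<n}. gen (x i) (x (i + 1)))"

abbreviation mean_gen :: "(int \<Rightarrow> real) \<Rightarrow> nat \<Rightarrow> real" where
  "mean_gen x \<equiv> \<lambda>N. gen_action (- int N) (int N) x / (2 * real N)"

definition minimizing :: "(int \<Rightarrow> real) \<Rightarrow> bool" where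
  "minimizing x \<longleftrightarrow> admissible x \<and>
     (\<forall>m n \<phi>. m < n \<and> admissible_segment m n \<phi> \<and> \<phi> m = x m \<and> \<phi> n = x n
        \<longrightarrow> gen_action m n x \<le> gen_action m n \<phi>)"

definition periodic_min :: "int \<Rightarrow> int \<Rightarrow> (int \<Rightarrow> real) \<Rightarrow> bool" where
  "periodic_min p n x \<longleftrightarrow> admissible x \<and> winds p n x \<and>
     (\<forall>y. admissible y \<and> winds p n y \<longrightarrow> gen_action 0 n x \<le> gen_action 0 n y)"

lemma gen_action_append: "m \<le> k \<Longrightarrow> k \<le> n \<Longrightarrow> gen_action m n x = gen_action m k x + gen_action k n x"
  unfolding gen_action_def by (subst sum.union_disjoint[symmetric]) (auto intro!: sum.cong)

lemma gen_action_cong: "(\<And>i. m \<le> i \<Longrightarrow> i \<le> n \<Longrightarrow> x i = y i) \<Longrightarrow> gen_action m n x = gen_action m n y"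
  unfolding gen_action_def by (intro sum.cong) auto

lemma gen_action_single: "gen_action m (m + 1) x = gen (x m) (x (m + 1))"
proof -
  have "{m..<m + 1} = {m}" by auto
  then show ?thesis by (simp add: gen_action_def)
qed

lemma gen_action_per: 
  assumes "winds p n x" "0 \<le> n"
  shows "gen_action m (m + n) x = gen_action 0 n x"
proof -
  have step: "gen_action (k + 1) (k + 1 + n) x = gen_action k (k + n) x" for k
  proof -
    have "gen_action k (k + 1 + n) x = gen (x k) (x (k + 1)) + gen_action (k + 1) (k + 1 + n) x"
      using gen_action_append[of k "k + 1" "k + 1 + n" x] assms(2) by (simp add: gen_action_single)
    moreover have "gen_action k (k + 1 + n) x = gen_action k (k + n) x + gen (x (k + n)) (x (k + n + 1))"
      using gen_action_append[of k "k + n" "k + 1 + n" x] assms(2) gen_action_single[of "k + n" x]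
      by (simp add: ac_simps)
    moreover have "gen (x (k + n)) (x (k + n + 1)) = gen (x k) (x (k + 1))"
    proof -
      have "x (k + n) = x k + 2 * pi * of_int p" "x (k + n + 1) = x (k + 1) + 2 * pi * of_int p"
        using assms(1)[unfolded winds_def, rule_format, of k] assms(1)[unfolded winds_def, rule_format, of "k + 1"]
        by (simp_all add: ac_simps)
      then show ?thesis by (simp add: gen_shift)
    qed
    ultimately show ?thesis by simp
  qed
  show ?thesis
  proof (induction m rule: int_induct[where k = 0])
    case (step1 i) then show ?case using step[of i] by (simp add: ac_simps)
  next
    case (step2 i) then show ?case using step[of "i - 1"] by simp
  qed simp
qed

text \<open>Over windows no longer than the period, periodic minimizers minimize with fixed end points.\<close>
lemma periodic_min_segment:
  assumes x: "periodic_min p n x" and n': "0 \<le> n'" "n' \<le> n" "0 < n"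
    and seg: "admissible_segment m (m + n') \<phi>" and ends: "\<phi> m = x m" "\<phi> (m + n') = x (m + n')"
  shows "gen_action m (m + n') x \<le> gen_action m (m + n') \<phi>"
proof -
  define \<psi> where "\<psi> = (\<lambda>i. if i \<le> m + n' then \<phi> i else x i)"
  have adm: "admissible x" and winds: "winds p n x" using x by (auto simp: periodic_min_def)
  have "admissible_segment m (m + n) \<psi>"
    unfolding admissible_segment_def
  proof
    fix i assume i: "i \<in> {m..<m + n}"
    consider "i < m + n'" | "i = m + n'" | "i > m + n'" by linarith
    then show "0 \<le> \<psi> (i + 1) - \<psi> i \<and> \<psi> (i + 1) - \<psi> i < pi"
      by cases (use seg i adm ends in \<open>auto simp: admissible_segment_def admissible_def \<psi>_def\<close>)
  qed
  moreover have "\<psi> (m + n) = \<psi> m + 2 * pi * of_int p"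
    using winds n' ends by (auto simp: winds_def \<psi>_def)
  ultimately obtain y where y: "admissible y" "winds p n y" "\<And>i. m \<le> i \<Longrightarrow> i \<le> m + n \<Longrightarrow> y i = \<psi> i"
    using winds_extension[OF n'(3)] by blast
  have "gen_action m (m + n) x \<le> gen_action m (m + n) y"
    using x y gen_action_per[OF winds] gen_action_per[OF y(2)] n' by (simp add: periodic_min_def)
  also have "\<dots> = gen_action m (m + n) \<psi>" by (intro gen_action_cong) (use y in auto)
  also have "\<dots> = gen_action m (m + n') \<psi> + gen_action (m + n') (m + n) \<psi>" using n' by (intro gen_action_append) auto
  also have "gen_action m (m + n') \<psi> = gen_action m (m + n') \<phi>" by (intro gen_action_cong) (auto simp: \<psi>_def)
  also have "gen_action (m + n') (m + n) \<psi> = gen_action (m + n') (m + n) x"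
    by (intro gen_action_cong) (use ends in \<open>auto simp: \<psi>_def\<close>)
  also have "gen_action m (m + n) x = gen_action m (m + n') x + gen_action (m + n') (m + n) x"
    using n' by (intro gen_action_append) auto
  finally show ?thesis by simp
qed

lemma gen_min_max:
  assumes "a \<le> b" "b < a + pi" "a' \<le> b'" "b' < a' + pi"
  shows "gen (min a a') (min b b') + gen (max a a') (max b b') \<le> gen a b + gen a' b'"
    and "a < a' \<Longrightarrow> b' < b \<Longrightarrow> gen (min a a') (min b b') + gen (max a a') (max b b') < gen a b + gen a' b'"
proof -
  show "a < a' \<Longrightarrow> b' < b \<Longrightarrow> gen (min a a') (min b b') + gen (max a a') (max b b') < gen a b + gen a' b'"
    using gen_submodular[of a a' b' b] assms by (simp add: min_def max_def)
  show "gen (min a a') (min b b') + gen (max a a') (max b b') \<le> gen a b + gen a' b'"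
    using gen_submodular[of a a' b' b] gen_submodular[of a' a b b'] assms
    by (cases a a' rule: linorder_cases; cases b b' rule: linorder_cases)
       (simp_all add: min_def max_def)
qed

text \<open>The minimum and the maximum of two minimizers together cost at most as much as the two minimizers.
  As neither can do better, equality holds along every edge, which by strict submodularity excludes
  transversal crossings.\<close>
lemma periodic_min_min_max:
  assumes x: "periodic_min p n x" and y: "periodic_min p n y" and n: "0 < n"
  shows "periodic_min p n (\<lambda>i. max (x i) (y i))" and "x i < y i \<Longrightarrow> x (i + 1) \<le> y (i + 1)"
proof -
  let ?z = "\<lambda>i. min (x i) (y i)" and ?w = "\<lambda>i. max (x i) (y i)"
  have adm: "admissible x" "admissible y" and winds: "winds p n x" "winds p n y"
    using x y by (auto simp: periodic_min_def)
  have zw: "admissible ?z" "admissible ?w" using adm by (rule admissible_min_max)+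
  have pzw: "winds p n ?z" "winds p n ?w" using winds by (auto simp: winds_def min_def max_def)
  have edge: "gen (?z i) (?z (i + 1)) + gen (?w i) (?w (i + 1)) \<le> gen (x i) (x (i + 1)) + gen (y i) (y (i + 1))" for i
    by (intro gen_min_max admissibleD adm)
  have sum: "gen_action m k ?z + gen_action m k ?w \<le> gen_action m k x + gen_action m k y" for m k
    unfolding gen_action_def sum.distrib[symmetric] by (intro sum_mono edge)
  have eq: "gen_action 0 n x = gen_action 0 n y" using x y by (auto simp: periodic_min_def intro: antisym)
  have zge: "gen_action 0 n x \<le> gen_action 0 n ?z" and wge: "gen_action 0 n x \<le> gen_action 0 n ?w"
    using x zw pzw by (auto simp: periodic_min_def)
  then have "gen_action 0 n ?w = gen_action 0 n x" using sum[of 0 n] eq by linarith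
  then show "periodic_min p n ?w" using x zw pzw by (simp add: periodic_min_def)
  assume less: "x i < y i"
  show "x (i + 1) \<le> y (i + 1)"
  proof (rule ccontr)
    assume "\<not> ?thesis"
    then have gt: "y (i + 1) < x (i + 1)" by simp
    have "gen_action i (i + n) ?z + gen_action i (i + n) ?w < gen_action i (i + n) x + gen_action i (i + n) y"
      unfolding gen_action_def sum.distrib[symmetric]
    proof (rule sum_strict_mono_ex1)
      show "\<exists>j\<in>{i..<i + n}. gen (?z j) (?z (j + 1)) + gen (?w j) (?w (j + 1))
          < gen (x j) (x (j + 1)) + gen (y j) (y (j + 1))"
        using n by (intro bexI[of _ i] gen_min_max(2) admissibleD adm less gt) auto
    qed (use edge in auto)
    then show False using zge wge eq n by (simp add: gen_action_per[OF winds(1)] gen_action_per[OF winds(2)]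
        gen_action_per[OF pzw(1)] gen_action_per[OF pzw(2)])
  qed
qed

lemma gen_action_two: "gen_action m (m + 2) x = gen (x m) (x (m + 1)) + gen (x (m + 1)) (x (m + 2))"
  using gen_action_append[of m "m + 1" "m + 2" x] gen_action_single[of m x] gen_action_single[of "m + 1" x] by (simp add: add.assoc)

lemma periodic_min_euler_lagrange:
  assumes x: "periodic_min p n x" and n: "2 \<le> n"
  shows "D2 (x i) (x (i + 1)) + D1 (x (i + 1)) (x (i + 2)) = 0"
proof (rule euler_lagrange_triple)
  have adm: "admissible x" using x by (simp add: periodic_min_def)
  show "x i \<le> x (i + 1)" "x (i + 1) \<le> x (i + 2)" "x (i + 1) < x i + pi" "x (i + 2) < x (i + 1) + pi"
    using admissibleD[OF adm, of i] admissibleD[OF adm, of "i + 1"] by (simp_all add: add.assoc)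
  fix u assume u: "x i \<le> u" "u \<le> x (i + 2)" "u < x i + pi" "x (i + 2) < u + pi"
  have "admissible_segment i (i + 2) (x(i + 1 := u))"
  proof -
    have "{i..<i + 2} = {i, i + 1}" by auto
    then show ?thesis using u by (simp add: admissible_segment_def add.assoc)
  qed
  then have "gen_action i (i + 2) x \<le> gen_action i (i + 2) (x(i + 1 := u))"
    using n by (intro periodic_min_segment[OF x]) auto
  then show "gen (x i) (x (i + 1)) + gen (x (i + 1)) (x (i + 2)) \<le> gen (x i) u + gen u (x (i + 2))"
    by (simp add: gen_action_two)
qed

text \<open>It remains to exclude that \<open>x\<close> and \<open>y\<close> meet at \<open>i + 1\<close>. Then two minimizers, chosen among \<open>x\<close>, \<open>y\<close> and
  their maximum, share the middle vertex, and their Euler-Lagrange equations are incompatible with the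
  strict monotonicity of \<open>D1\<close> and \<open>D2\<close>.\<close>
lemma periodic_min_order_step:
  assumes x: "periodic_min p n x" and y: "periodic_min p n y" and n: "2 \<le> n" and less: "x i < y i"
  shows "x (i + 1) < y (i + 1)"
proof (rule ccontr)
  assume "\<not> ?thesis"
  moreover have "x (i + 1) \<le> y (i + 1)" using periodic_min_min_max(2)[OF x y] n less by simp
  ultimately have eq: "y (i + 1) = x (i + 1)" by simp
  have adm: "admissible x" "admissible y" using x y by (auto simp: periodic_min_def)
  have 1: "D2 (y i) (x (i + 1)) < D2 (x i) (x (i + 1))"
    using less admissibleD[OF adm(1), of i] admissibleD[OF adm(2), of i] eq by (intro D2_strict) auto
  have ex: "D2 (x i) (x (i + 1)) + D1 (x (i + 1)) (x (i + 2)) = 0"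
    by (rule periodic_min_euler_lagrange[OF x n])
  show False
  proof (cases "x (i + 2) < y (i + 2)")
    case True
    have "D1 (x (i + 1)) (y (i + 2)) < D1 (x (i + 1)) (x (i + 2))"
      using True admissibleD[OF adm(1), of "i + 1"] admissibleD[OF adm(2), of "i + 1"] eq
      by (intro D1_strict) (auto simp: add.assoc)
    with 1 ex periodic_min_euler_lagrange[OF y n, of i] eq show False by simp
  next
    case False
    have "periodic_min p n (\<lambda>i. max (x i) (y i))" using periodic_min_min_max(1)[OF x y] n by simp
    from periodic_min_euler_lagrange[OF this n, of i] have "D2 (y i) (x (i + 1)) + D1 (x (i + 1)) (x (i + 2)) = 0"
      using False less eq by (simp add: max_def)
    with 1 ex show False by simp
  qed
qed

lemma periodic_min_ordered:
  assumes x: "periodic_min p n x" and y: "periodic_min p n y" and n: "2 \<le> n" and less: "x i < y i"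
  shows "x j < y j"
proof -
  have *: "x (i + int k) < y (i + int k)" for k
    by (induction k) (use less periodic_min_order_step[OF x y n] in \<open>auto simp: add.assoc[symmetric] add.commute[of 1]\<close>)
  define a where "a = \<bar>j - i\<bar>"
  have "a * 1 \<le> a * n" using n by (intro mult_left_mono) (auto simp: a_def)
  moreover have "i - j \<le> a" by (simp add: a_def)
  ultimately have "0 \<le> j - i + a * n" by linarith
  then have "i + int (nat (j - i + a * n)) = j + a * n" by simp
  with *[of "nat (j - i + a * n)"] have "x (j + a * n) < y (j + a * n)" by simp
  moreover have "winds p n x" "winds p n y" using x y by (auto simp: periodic_min_def)
  ultimately show ?thesis by (simp add: winds_mult)
qed

lemma gen_action_translate: "gen_action m n (\<lambda>i. x (i + j) + 2 * pi * of_int k) = gen_action (m + j) (n + j) x"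
  unfolding gen_action_def gen_shift
  by (rule sum.reindex_bij_witness[of _ "\<lambda>i. i - j" "\<lambda>i. i + j"]) (auto simp: algebra_simps)

lemma periodic_min_translate:
  assumes x: "periodic_min p n x" and n: "0 \<le> n"
  shows "periodic_min p n (\<lambda>i. x (i + j) + 2 * pi * of_int k)"
proof -
  let ?y = "\<lambda>i. x (i + j) + 2 * pi * of_int k"
  have adm: "admissible x" and winds: "winds p n x" using x by (auto simp: periodic_min_def)
  have "winds p n ?y" using winds
    unfolding winds_def by (auto simp: algebra_simps) (metis add.assoc add.commute)
  moreover have "gen_action 0 n ?y = gen_action 0 n x"
    using gen_action_translate[of 0 n x j k] gen_action_per[OF winds n, of j] by (simp add: add.commute)
  ultimately show ?thesis using x admissible_translate[OF adm] by (simp add: periodic_min_def)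
qed

text \<open>A translate that is larger at one index is larger everywhere; iterating it \<open>n\<close> times and comparing
  with the winding number bounds the translation vector.\<close>
lemma periodic_min_deviation:
  assumes x: "periodic_min p n x" and n: "2 \<le> n"
  shows "\<bar>x (i + j) - x i - 2 * pi * of_int p / of_int n * of_int j\<bar> \<le> 2 * pi"
proof -
  have winds: "winds p n x" using x by (auto simp: periodic_min_def)
  have tr: "periodic_min p n (\<lambda>i. x (i + j) + 2 * pi * of_int k)" for k
    using periodic_min_translate[OF x] n by simp
  have pj: "x (l + n * j) = x l + 2 * pi * of_int (p * j)" for l
    using winds_mult[OF winds, of l j] by (simp add: mult.commute)
  define q where "q = (x (i + j) - x i) / (2 * pi)"
  have q: "x (i + j) = x i + 2 * pi * q" by (simp add: q_def)
  have n0: "real_of_int n > 0" using n by simp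
  have "q \<le> of_int p * of_int j / of_int n + 1"
  proof -
    (* The largest integer strictly below q, so that the translate lies strictly above x at i. *)
    define k where "k = \<lceil>q\<rceil> - 1"
    have k: "of_int k < q" "q \<le> of_int k + 1" unfolding k_def by linarith+
    have "x i < x (i + j) + 2 * pi * of_int (- k)" using k q by simp
    from periodic_min_ordered[OF x tr n this] have *: "x l < x (l + j) + 2 * pi * of_int (- k)" for l .
    have "x l + 2 * pi * of_int k * of_nat m \<le> x (l + int m * j)" for l m
      by (induction m) (use * in \<open>auto simp: algebra_simps\<close>, smt (verit) add.assoc add.commute)
    from this[of 0 "nat n"] pj[of 0] n have "2 * pi * of_int k * of_int n \<le> 2 * pi * of_int (p * j)"
      by simp
    then have "of_int k * of_int n \<le> (of_int p * of_int j :: real)" by simp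
    then have "of_int k \<le> (of_int p * of_int j / of_int n :: real)" using n0 by (simp add: pos_le_divide_eq)
    then show ?thesis using k by simp
  qed
  moreover have "of_int p * of_int j / of_int n - 1 \<le> q"
  proof -
    (* The smallest integer strictly above q, for the reverse comparison. *)
    define k where "k = \<lfloor>q\<rfloor> + 1"
    have k: "q < of_int k" "of_int k - 1 \<le> q" unfolding k_def by linarith+
    have "x (i + j) + 2 * pi * of_int (- k) < x i" using k q by simp
    from periodic_min_ordered[OF tr x n this] have *: "x (l + j) + 2 * pi * of_int (- k) < x l" for l .
    have "x (l + int m * j) \<le> x l + 2 * pi * of_int k * of_nat m" for l m
      by (induction m) (use * in \<open>auto simp: algebra_simps\<close>, smt (verit) add.assoc add.commute)
    from this[of 0 "nat n"] pj[of 0] n have "2 * pi * of_int (p * j) \<le> 2 * pi * of_int k * of_int n"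
      by simp
    then have "of_int p * of_int j \<le> (of_int k * of_int n :: real)" by simp
    then have "(of_int p * of_int j / of_int n :: real) \<le> of_int k" using n0 by (simp add: pos_divide_le_eq)
    then show ?thesis using k by simp
  qed
  ultimately have "\<bar>q - of_int p * of_int j / of_int n\<bar> \<le> 1" by linarith
  then have "2 * pi * \<bar>q - of_int p * of_int j / of_int n\<bar> \<le> 2 * pi" by simp
  moreover have "x (i + j) - x i - 2 * pi * of_int p / of_int n * of_int j = 2 * pi * (q - of_int p * of_int j / of_int n)"
    using q by (simp add: algebra_simps)
  ultimately show ?thesis by (simp add: abs_mult)
qed

section \<open>Existence of minimizing configurations\<close>

definition h_lower where "h_lower = (SOME l. 0 < l \<and> (\<forall>x. l \<le> h x))"
definition h_upper where "h_upper = (SOME u. \<forall>x. h x \<le> u)"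

lemma h_lower: "0 < h_lower" "h_lower \<le> h x" and h_upper: "h x \<le> h_upper"
proof -
  have "\<exists>l. 0 < l \<and> (\<forall>x. l \<le> h x)" "\<exists>u. \<forall>x. h x \<le> u" using h_bounds by metis+
  from someI_ex[OF this(1)] someI_ex[OF this(2)]
  show "0 < h_lower" "h_lower \<le> h x" "h x \<le> h_upper" by (simp_all add: h_lower_def h_upper_def)
qed

lemma h_upper_pos: "0 < h_upper" using h_lower h_upper[of 0] h_lower(2)[of 0] by linarith

lemma half_tan_nonneg: "x \<le> y \<Longrightarrow> y < x + pi \<Longrightarrow> 0 \<le> half_tan x y"
  unfolding half_tan_def by (cases "x = y") (auto intro!: less_imp_le tan_gt_zero)

lemma gen_nonneg: "x \<le> y \<Longrightarrow> y < x + pi \<Longrightarrow> 0 \<le> gen x y"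
  unfolding gen_def using half_tan_nonneg[of x y] h_pos[of x] h_pos[of y] by simp

lemma gen_same [simp]: "gen x x = 0"
  by (simp add: gen_def half_tan_def)

text \<open>An upper bound for \<open>gen\<close> over steps of size at most \<open>d\<close>.\<close>
definition cost :: "real \<Rightarrow> real" where "cost d = 2 * h_upper * tan (d / 2)"

lemma gen_le_cost:
  assumes "x \<le> y" "y \<le> x + d" "d < pi"
  shows "gen x y \<le> cost d"
proof -
  have "half_tan x y \<le> tan (d / 2)"
    unfolding half_tan_def using assms by (intro tan_mono_le) auto
  moreover have "0 \<le> half_tan x y" using assms by (intro half_tan_nonneg) auto
  ultimately show ?thesis unfolding gen_def cost_def
    using h_upper[of x] h_upper[of y] h_upper_pos by (intro mult_mono) auto
qed

text \<open>A bound on the cost of an edge keeps its step away from \<open>\<pi>\<close>, where \<open>gen\<close> blows up. This is the source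
  of compactness.\<close>
lemma step_le_of_gen_le:
  assumes "x \<le> y" "y < x + pi" "gen x y \<le> C"
  shows "y - x \<le> 2 * arctan (C / (2 * h_lower))"
proof (rule ccontr)
  assume "\<not> ?thesis"
  then have "arctan (C / (2 * h_lower)) < (y - x) / 2" by simp
  then have "tan (arctan (C / (2 * h_lower))) < tan ((y - x) / 2)"
    using assms arctan_lbound by (intro tan_monotone) auto
  then have *: "C / (2 * h_lower) < half_tan x y" by (simp add: half_tan_def tan_arctan)
  have "C < 2 * h_lower * half_tan x y" using * h_lower(1) by (simp add: pos_divide_less_eq mult.commute)
  also have "\<dots> \<le> (h x + h y) * half_tan x y"
    using h_lower(2)[of x] h_lower(2)[of y] half_tan_nonneg[OF assms(1,2)] by (intro mult_right_mono) auto
  finally show False using assms(3) by (simp add: gen_def)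
qed

lemma gen_action_nonneg: "admissible_segment m n x \<Longrightarrow> 0 \<le> gen_action m n x"
  unfolding gen_action_def by (intro sum_nonneg gen_nonneg) (auto simp: admissible_segment_def algebra_simps)

lemma gen_action_ge_edge:
  assumes "admissible_segment m n x" "m \<le> i" "i < n"
  shows "gen (x i) (x (i + 1)) \<le> gen_action m n x"
  unfolding gen_action_def using assms
  by (intro member_le_sum[of i _ "\<lambda>i. gen (x i) (x (i + 1))"] gen_nonneg)
     (auto simp: admissible_segment_def algebra_simps)

lemma gen_action_arith_le:
  assumes "\<And>i. m \<le> i \<Longrightarrow> i < n \<Longrightarrow> x i \<le> x (i + 1) \<and> x (i + 1) \<le> x i + d" "m \<le> n" "d < pi"
  shows "gen_action m n x \<le> of_int (n - m) * cost d"
proof -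
  have "gen_action m n x \<le> of_nat (card {m..<n}) * cost d"
    unfolding gen_action_def using assms by (intro sum_bounded_above gen_le_cost) auto
  then show ?thesis using assms by simp
qed

lemma tendsto_gen:
  assumes "(f \<longlongrightarrow> a) F" "(g \<longlongrightarrow> b) F" "a \<le> b" "b < a + pi"
  shows "((\<lambda>t. gen (f t) (g t)) \<longlongrightarrow> gen a b) F"
proof -
  have "isCont h a" "isCont h b" using h_cont[of UNIV] by (auto simp: continuous_on_eq_continuous_at)
  moreover have "cos ((b - a) / 2) \<noteq> 0"
    using assms by (intro less_imp_neq[symmetric] cos_gt_zero_pi) auto
  ultimately show ?thesis unfolding gen_def half_tan_def
    by (intro tendsto_mult tendsto_add isCont_tendsto_compose[of _ tan] isCont_tan
        isCont_tendsto_compose[of _ h] tendsto_divide tendsto_diff tendsto_const assms) auto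
qed

lemma tendsto_gen_action:
  assumes "\<And>i. m \<le> i \<Longrightarrow> i \<le> n \<Longrightarrow> ((\<lambda>t. X t i) \<longlongrightarrow> x i) F" "admissible_segment m n x"
  shows "((\<lambda>t. gen_action m n (X t)) \<longlongrightarrow> gen_action m n x) F"
  unfolding gen_action_def using assms
  by (intro tendsto_sum tendsto_gen) (auto simp: admissible_segment_def algebra_simps)

text \<open>The equally spaced configuration has finite action, so configurations with a step close to \<open>\<pi>\<close> can
  be discarded; what remains is compact.\<close>
lemma periodic_min_exists:
  assumes "0 \<le> p" "2 * p < n"
  shows "\<exists>x. periodic_min p n x \<and> x 0 \<in> {0..2*pi}"
proof -
  define s where "s = 2 * pi * of_int p / of_int n"
  have n: "0 < n" using assms by simp
  have sn: "s * of_int n = 2 * pi * of_int p" using n by (simp add: s_def)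
  have s: "0 \<le> s" "s < pi"
  proof -
    show "0 \<le> s" using assms by (simp add: s_def)
    have "pi * (2 * of_int p) < pi * of_int n" using assms(2)
      by (intro mult_strict_left_mono) (auto simp flip: of_int_less_iff[where 'a=real])
    then show "s < pi" using n by (simp add: s_def pos_divide_less_eq algebra_simps)
  qed
  define e where "e = (\<lambda>i::int. s * of_int i)"
  have e: "winds p n e" "admissible e" using s sn
    by (auto simp: winds_def e_def admissible_def algebra_simps)
  define C where "C = max (2 * h_lower * tan (s / 2)) (gen_action 0 n e)"
  define D where "D = 2 * arctan (C / (2 * h_lower))"
  have D: "D < pi" by (simp add: D_def two_arctan_less_pi)
  have sD: "s \<le> D"
  proof -
    have "tan (s / 2) \<le> C / (2 * h_lower)" using h_lower(1) by (simp add: C_def pos_le_divide_eq mult.commute)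
    then have "arctan (tan (s / 2)) \<le> arctan (C / (2 * h_lower))" by (simp add: arctan_le_iff)
    then show ?thesis using s by (simp add: D_def arctan_tan)
  qed
  define K where "K = bounded_steps D \<inter> {x. winds p n x}"
  have eK: "e \<in> K" using e sD s by (auto simp: K_def bounded_steps_def e_def algebra_simps)
  have "{x::int \<Rightarrow> real. winds p n x} = (\<Inter>i. {x. x (i + n) = x i + 2 * pi * of_int p})" by (auto simp: winds_def)
  then have "closed {x::int \<Rightarrow> real. winds p n x}"
    by (auto intro!: closed_INT closed_Collect_eq continuous_intros)
  then have comp: "compact K" unfolding K_def by (intro compact_Int_closed compact_bounded_steps)
  have adm: "admissible x" if "x \<in> K" for x
    using that D by (auto simp: K_def bounded_steps_def admissible_def) (meson le_less_trans)
  have "continuous_on K (gen_action 0 n)"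
    unfolding continuous_on_def
  proof
    fix x assume x: "x \<in> K"
    have "((\<lambda>y. y i) \<longlongrightarrow> x i) (at x within K)" for i
    proof -
      have "continuous_on K (\<lambda>y::int \<Rightarrow> real. y i)" by (rule continuous_on_subset[of UNIV]) auto
      then show ?thesis using x by (simp add: continuous_on_def)
    qed
    then show "(gen_action 0 n \<longlongrightarrow> gen_action 0 n x) (at x within K)"
      by (intro tendsto_gen_action[where X = "\<lambda>y. y"] admissible_imp_segment adm x)
  qed
  with comp eK obtain x where x: "x \<in> K" "\<And>y. y \<in> K \<Longrightarrow> gen_action 0 n x \<le> gen_action 0 n y"
    by (metis continuous_attains_inf empty_iff)
  have "gen_action 0 n x \<le> gen_action 0 n y" if y: "admissible y" "winds p n y" for y
  proof -
    obtain k where k: "y 0 + 2 * pi * of_int k \<in> {0..2*pi}" using periodic_reduce by blast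
    define y' where "y' = (\<lambda>i. y (i + 0) + 2 * pi * of_int k)"
    have y': "admissible y'" "winds p n y'" "y' 0 \<in> {0..2*pi}" "gen_action 0 n y' = gen_action 0 n y"
      using y k gen_action_translate[of 0 n y 0 k] by (auto simp: y'_def admissible_def winds_def)
    show ?thesis
    proof (cases "y' \<in> bounded_steps D")
      case True
      then show ?thesis using x(2)[of y'] y' by (simp add: K_def)
    next
      case False
      then obtain i where i: "\<not> y' (i + 1) - y' i \<le> D"
        using y' by (auto simp: bounded_steps_def admissible_def)
      have "C \<le> gen (y' i) (y' (i + 1))"
        using step_le_of_gen_le[of "y' i" "y' (i + 1)" C] i admissibleD[OF y'(1), of i] by (force simp: D_def)
      also have "\<dots> \<le> gen_action i (i + n) y'"
        using y' n by (intro gen_action_ge_edge admissible_imp_segment) auto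
      also have "\<dots> = gen_action 0 n y" using gen_action_per[OF y'(2)] n y' by simp
      finally show ?thesis using x(2)[OF eK] by (simp add: C_def)
    qed
  qed
  then have "periodic_min p n x" using x adm by (auto simp: periodic_min_def K_def)
  then show ?thesis using x by (auto simp: K_def bounded_steps_def)
qed

lemma gen_action_linear_path:
  assumes "0 < K" "a \<le> b" "b - a \<le> of_int K * d" "d < pi"
  shows "admissible_segment m (m + K) (linear_path m K a b)" "gen_action m (m + K) (linear_path m K a b) \<le> of_int K * cost d"
proof -
  show "admissible_segment m (m + K) (linear_path m K a b)"
    unfolding admissible_segment_def using linear_path(3,4)[OF assms(1-3), of m] assms(4) by (smt (verit))
  show "gen_action m (m + K) (linear_path m K a b) \<le> of_int K * cost d"
    using gen_action_arith_le[of m "m + K" "linear_path m K a b" d] linear_path(3,4)[OF assms(1-3)] assms by simp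
qed

text \<open>A competitor of the limit is turned into competitors of the approximating configurations by an affine
  change of its values that fits the end points. If the end points of the segment coincide, the limit is
  constant there and has zero action.\<close>
lemma minimizing_limit:
  assumes conv: "\<And>i. (\<lambda>n. X n i) \<longlonglongrightarrow> x i" and adm: "admissible x"
    and min: "\<And>m k \<phi>. m < k \<Longrightarrow> \<forall>\<^sub>F n in sequentially. admissible_segment m k (\<phi> n) \<and> \<phi> n m = X n m \<and> \<phi> n k = X n k
        \<longrightarrow> gen_action m k (X n) \<le> gen_action m k (\<phi> n)"
  shows "minimizing x"
  unfolding minimizing_def
proof (intro conjI allI impI adm, elim conjE)
  fix m k \<phi> assume mk: "m < k" and seg: "admissible_segment m k \<phi>" and ends: "\<phi> m = x m" "\<phi> k = x k"
  show "gen_action m k x \<le> gen_action m k \<phi>"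
  proof (cases "x m = x k")
    case True
    have const: "x i = x m" if "m \<le> i" "i \<le> k" for i
      using admissible_mono[OF adm that(1)] admissible_mono[OF adm that(2)] True by linarith
    have "gen_action m k x = gen_action m k (\<lambda>i. x m)" by (rule gen_action_cong) (rule const)
    also have "\<dots> = 0" by (simp add: gen_action_def)
    finally show ?thesis using gen_action_nonneg[OF seg] by simp
  next
    case False
    define s where "s = (\<lambda>n. (X n k - X n m) / (x k - x m))"
    have le: "x m < x k" using False admissible_mono[OF adm, of m k] mk by simp
    have s1: "s \<longlonglongrightarrow> 1"
    proof -
      have "s \<longlonglongrightarrow> (x k - x m) / (x k - x m)" unfolding s_def
        by (intro tendsto_divide tendsto_diff conv tendsto_const) (use le in auto)
      then show ?thesis using le by simp
    qed
    define \<psi> where "\<psi> = (\<lambda>n i. X n m + (\<phi> i - x m) * s n)"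
    have psi_lim: "(\<lambda>n. \<psi> n i) \<longlonglongrightarrow> \<phi> i" for i
    proof -
      have "(\<lambda>n. \<psi> n i) \<longlonglongrightarrow> x m + (\<phi> i - x m) * 1"
        unfolding \<psi>_def by (intro tendsto_add tendsto_mult tendsto_const conv s1)
      then show ?thesis by simp
    qed
    have psi_ends: "\<psi> n m = X n m" "\<psi> n k = X n k" for n
      using ends le by (simp_all add: \<psi>_def s_def)
    have "\<forall>\<^sub>F n in sequentially. s n > 0" using order_tendstoD(1)[OF s1] by simp
    moreover have "\<forall>\<^sub>F n in sequentially. \<forall>i\<in>{m..<k}. \<psi> n (i + 1) - \<psi> n i < pi"
    proof (intro eventually_ball_finite ballI)
      fix i assume "i \<in> {m..<k}"
      then have "\<phi> (i + 1) - \<phi> i < pi" using seg by (simp add: admissible_segment_def)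
      with order_tendstoD(2)[OF tendsto_diff[OF psi_lim[of "i + 1"] psi_lim[of i]]]
      show "\<forall>\<^sub>F n in sequentially. \<psi> n (i + 1) - \<psi> n i < pi" by blast
    qed auto
    ultimately have "\<forall>\<^sub>F n in sequentially. admissible_segment m k (\<psi> n)"
    proof eventually_elim
      case (elim n)
      show ?case unfolding admissible_segment_def
      proof
        fix i assume i: "i \<in> {m..<k}"
        have "\<psi> n (i + 1) - \<psi> n i = (\<phi> (i + 1) - \<phi> i) * s n" by (simp add: \<psi>_def algebra_simps)
        moreover have "0 \<le> (\<phi> (i + 1) - \<phi> i) * s n"
          using elim(1) i seg by (intro mult_nonneg_nonneg) (auto simp: admissible_segment_def)
        ultimately show "0 \<le> \<psi> n (i + 1) - \<psi> n i \<and> \<psi> n (i + 1) - \<psi> n i < pi"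
          using bspec[OF elim(2) i] by simp
      qed
    qed
    with min[OF mk, of \<psi>] have ev: "\<forall>\<^sub>F n in sequentially. gen_action m k (X n) \<le> gen_action m k (\<psi> n)"
      by eventually_elim (simp add: psi_ends)
    show ?thesis
      by (rule tendsto_le[OF _ tendsto_gen_action[OF psi_lim seg] tendsto_gen_action[OF conv admissible_imp_segment[OF adm]] ev]) simp
  qed
qed

text \<open>The approximating minimizers have period \<open>n\<close> itself, without reducing the fraction \<open>\<lfloor>\<rho> n\<rfloor> / n\<close>: windows
  of any fixed length are then eventually shorter than the period.\<close>
theorem minimizing_exists:
  assumes \<rho>: "0 < \<rho>" "\<rho> < 1/2"
  shows "\<exists>x. minimizing x \<and> (\<forall>i. \<bar>x i - 2 * pi * \<rho> * of_int i\<bar> \<le> 4 * pi)"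
proof -
  define p where "p = (\<lambda>n::nat. \<lfloor>\<rho> * real n\<rfloor>)"
  have "\<exists>x. periodic_min (p n) (int n) x \<and> x 0 \<in> {0..2*pi}" if "n \<ge> 1" for n
  proof (rule periodic_min_exists)
    show "0 \<le> p n" using \<rho> by (simp add: p_def)
    have "2 * real_of_int (p n) \<le> 2 * (\<rho> * real n)" unfolding p_def by linarith
    also have "\<dots> < real n" using mult_strict_right_mono[OF \<rho>(2), of "real n"] that by simp
    finally show "2 * p n < int n" by linarith
  qed
  note ex = this
  define X where "X = (\<lambda>n. SOME x. periodic_min (p n) (int n) x \<and> x 0 \<in> {0..2*pi})"
  have X: "periodic_min (p n) (int n) (X n)" "X n 0 \<in> {0..2*pi}" if "1 \<le> n" for n
    using someI_ex[OF ex[OF that]] by (simp_all add: X_def)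
  have dev: "\<bar>X n (i + j) - X n i - 2 * pi * (of_int (p n) / of_nat n) * of_int j\<bar> \<le> 2 * pi" if "2 \<le> n" for n i j
    using periodic_min_deviation[OF X(1), of n i j] that by simp
  have ratio: "of_int (p n) / of_nat n \<le> \<rho>" if "2 \<le> n" for n
  proof -
    have "of_int (p n) \<le> \<rho> * real n" unfolding p_def by linarith
    then show ?thesis using that by (simp add: pos_divide_le_eq)
  qed
  define d where "d = mid_step \<rho>"
  have d: "2 * pi * \<rho> < d" "d < pi" using mid_step \<rho> by (simp_all add: d_def)
  (* K steps of size at most d cover the displacement of any minimizer over K indices. Replacing such a
     window by equal steps bounds its action, hence each of its edges. *)
  (* At least two steps are taken, since the deviation bound is stated for periods of length at least 2. *)
  obtain K0 :: nat where K0: "2 * pi / (d - 2 * pi * \<rho>) \<le> real K0" using real_arch_simple by blast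
  define K where "K = K0 + 2"
  have K: "2 * pi \<le> real K * (d - 2 * pi * \<rho>)" "2 \<le> K"
  proof -
    have "2 * pi / (d - 2 * pi * \<rho>) \<le> real K" using K0 by (simp add: K_def)
    then show "2 * pi \<le> real K * (d - 2 * pi * \<rho>)" using d by (simp add: pos_divide_le_eq)
  qed (simp add: K_def)
  define D where "D = 2 * arctan (real K * cost d / (2 * h_lower))"
  have D: "D < pi" by (simp add: D_def two_arctan_less_pi)
  have adm: "admissible (X n)" if "K \<le> n" for n using X(1)[of n] that K by (simp add: periodic_min_def)
  have step: "X n (i + 1) - X n i \<le> D" if n: "K \<le> n" for n i
  proof -
    have le: "X n i \<le> X n (i + int K)" using admissible_mono[OF adm[OF n], of i "i + int K"] by simp
    have "X n (i + int K) - X n i \<le> 2 * pi * (of_int (p n) / of_nat n) * real K + 2 * pi"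
      using dev[of n i "int K"] n K by simp
    also have "\<dots> \<le> 2 * pi * \<rho> * real K + 2 * pi"
      using ratio[of n] n K by (intro add_right_mono mult_right_mono mult_left_mono) auto
    also have "\<dots> \<le> real K * d" using K by (simp add: algebra_simps)
    finally have KD: "X n (i + int K) - X n i \<le> of_int (int K) * d" by simp
    let ?\<phi> = "linear_path i (int K) (X n i) (X n (i + int K))"
    have Kp: "0 < int K" using K by simp
    have "gen (X n i) (X n (i + 1)) \<le> gen_action i (i + int K) (X n)"
      using K by (intro gen_action_ge_edge admissible_imp_segment adm n) auto
    also have "\<dots> \<le> gen_action i (i + int K) ?\<phi>"
    proof (rule periodic_min_segment[OF X(1)])
      show "admissible_segment i (i + int K) ?\<phi>" by (rule gen_action_linear_path(1)[OF Kp le KD d(2)])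
    qed (use n K linear_path(1,2)[OF Kp le KD, of i] in auto)
    also have "\<dots> \<le> real K * cost d" using gen_action_linear_path(2)[OF Kp le KD d(2), of i] by simp
    finally show ?thesis unfolding D_def
      by (intro step_le_of_gen_le admissibleD[OF adm[OF n]])
  qed
  have XD: "X (n + K) \<in> bounded_steps D" for n
    using X(2)[of "n + K"] step[of "n + K"] K admissibleD(1)[OF adm, of "n + K"]
    unfolding bounded_steps_def by simp
  obtain x r where x: "x \<in> bounded_steps D" and r: "strict_mono r"
    and lim: "((\<lambda>n. X (n + K)) \<circ> r) \<longlonglongrightarrow> x"
    by (rule seq_compactE[OF compact_bounded_steps[of D, unfolded compact_eq_seq_compact_metric], of "\<lambda>n. X (n + K)"])
       (use XD in auto)
  define N where "N = (\<lambda>n. r n + K)"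
  have NK: "K \<le> N n" "2 \<le> N n" for n using K by (auto simp: N_def)
  have Nlim: "filterlim N at_top sequentially"
    by (rule filterlim_at_top_mono[OF filterlim_subseq[OF r]]) (simp add: N_def)
  have conv: "(\<lambda>n. X (N n) i) \<longlonglongrightarrow> x i" for i
    using tendsto_coordinate[OF lim, of i] by (simp add: N_def)
  have admx: "admissible x" using x D by (auto simp: bounded_steps_def admissible_def) (meson le_less_trans)
  have "minimizing x"
  proof (rule minimizing_limit[OF conv admx])
    fix m k :: int and \<phi> assume "m < k"
    have "\<forall>\<^sub>F n in sequentially. nat (k - m) \<le> N n" 
      using Nlim by (simp add: filterlim_at_top)
    then show "\<forall>\<^sub>F n in sequentially. admissible_segment m k (\<phi> n) \<and> \<phi> n m = X (N n) m \<and> \<phi> n k = X (N n) k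
        \<longrightarrow> gen_action m k (X (N n)) \<le> gen_action m k (\<phi> n)"
    proof eventually_elim
      case (elim n)
      then show ?case using periodic_min_segment[OF X(1)[of "N n"], of "k - m" m "\<phi> n"] NK[of n] \<open>m < k\<close> by auto
    qed
  qed
  moreover have "\<bar>x i - 2 * pi * \<rho> * of_int i\<bar> \<le> 4 * pi" for i
  proof -
    have "(\<lambda>n. of_int (p (N n)) / of_nat (N n)) \<longlonglongrightarrow> \<rho>"
      using filterlim_compose[OF floor_ratio_tendsto Nlim] by (simp add: p_def)
    then have "(\<lambda>n. \<bar>X (N n) (0 + i) - X (N n) 0 - 2 * pi * (of_int (p (N n)) / of_nat (N n)) * of_int i\<bar>)
        \<longlonglongrightarrow> \<bar>x (0 + i) - x 0 - 2 * pi * \<rho> * of_int i\<bar>"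
      by (intro tendsto_rabs tendsto_diff tendsto_mult tendsto_const conv)
    then have "\<bar>x (0 + i) - x 0 - 2 * pi * \<rho> * of_int i\<bar> \<le> 2 * pi"
      by (rule Lim_bounded[where M = 0]) (intro allI impI dev NK)
    moreover have "0 \<le> x 0" "x 0 \<le> 2 * pi" using x by (auto simp: bounded_steps_def)
    ultimately show ?thesis unfolding add_0 by linarith
  qed
  ultimately show ?thesis by (intro exI conjI allI)
qed

section \<open>Mean action\<close>

text \<open>The competitor walks from \<open>x m\<close> to \<open>y\<close> in \<open>K\<close> equal steps, follows \<open>y\<close>, and walks back to \<open>x n\<close> in
  the last \<open>K\<close> steps.\<close>
lemma minimizing_compare:
  assumes x: "minimizing x" and y: "admissible y" and K: "0 < K" "m + K \<le> n - K" and d: "d < pi"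
    and left: "x m \<le> y (m + K)" "y (m + K) - x m \<le> of_int K * d"
    and right: "y (n - K) \<le> x n" "x n - y (n - K) \<le> of_int K * d"
  shows "gen_action m n x \<le> gen_action m n y + 2 * of_int K * cost d"
proof -
  define \<phi> where "\<phi> = (\<lambda>i. if i \<le> m + K then linear_path m K (x m) (y (m + K)) i
      else if i \<le> n - K then y i else linear_path (n - K) K (y (n - K)) (x n) i)"
  note L = linear_path[OF K(1) left] and R = linear_path[OF K(1) right]
  have eq1: "\<phi> i = linear_path m K (x m) (y (m + K)) i" if "i \<le> m + K" for i
    using that by (simp add: \<phi>_def)
  have eq2: "\<phi> i = y i" if "m + K \<le> i" "i \<le> n - K" for i
    using that L(2)[of m] by (auto simp: \<phi>_def)
  have eq3: "\<phi> i = linear_path (n - K) K (y (n - K)) (x n) i" if "n - K \<le> i" for i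
  proof (cases "i = n - K")
    case True then show ?thesis using eq2[of i] K R(1)[of "n - K"] by simp
  qed (use that K in \<open>simp add: \<phi>_def\<close>)
  have "admissible_segment m n \<phi>"
    unfolding admissible_segment_def
  proof
    fix i assume i: "i \<in> {m..<n}"
    consider "i < m + K" | "m + K \<le> i" "i < n - K" | "n - K \<le> i" by linarith
    then show "0 \<le> \<phi> (i + 1) - \<phi> i \<and> \<phi> (i + 1) - \<phi> i < pi"
    proof cases
      case 1 then show ?thesis using eq1[of i] eq1[of "i + 1"] L(3,4)[of m i] d by simp
    next
      case 2 then show ?thesis using eq2[of i] eq2[of "i + 1"] y by (simp add: admissible_def)
    next
      case 3 then show ?thesis using eq3[of i] eq3[of "i + 1"] R(3,4)[of "n - K" i] d by simp
    qed
  qed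
  moreover have "\<phi> m = x m" "\<phi> n = x n" using eq1[of m] eq3[of n] L(1)[of m] R(2)[of "n - K"] K by auto
  ultimately have "gen_action m n x \<le> gen_action m n \<phi>" using x K by (auto simp: minimizing_def)
  also have "\<dots> = gen_action m (m + K) \<phi> + gen_action (m + K) (n - K) \<phi> + gen_action (n - K) n \<phi>"
    using gen_action_append[of m "m + K" n \<phi>] gen_action_append[of "m + K" "n - K" n \<phi>] K by simp
  also have "gen_action m (m + K) \<phi> = gen_action m (m + K) (linear_path m K (x m) (y (m + K)))"
    by (intro gen_action_cong eq1)
  also have "\<dots> \<le> of_int K * cost d" by (rule gen_action_linear_path(2)[OF K(1) left d])
  also have "gen_action (n - K) n \<phi> = gen_action (n - K) (n - K + K) (linear_path (n - K) K (y (n - K)) (x n))"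
    using gen_action_cong[of "n - K" n \<phi>] eq3 by simp
  also have "\<dots> \<le> of_int K * cost d" by (rule gen_action_linear_path(2)[OF K(1) right d])
  also have "gen_action (m + K) (n - K) \<phi> = gen_action (m + K) (n - K) y" by (intro gen_action_cong eq2)
  also have "gen_action (m + K) (n - K) y \<le> gen_action m n y"
  proof -
    have "gen_action m n y = gen_action m (m + K) y + gen_action (m + K) (n - K) y + gen_action (n - K) n y"
      using gen_action_append[of m "m + K" n y] gen_action_append[of "m + K" "n - K" n y] K by simp
    moreover have "0 \<le> gen_action m (m + K) y" "0 \<le> gen_action (n - K) n y"
      by (intro gen_action_nonneg admissible_imp_segment y)+
    ultimately show ?thesis by simp
  qed
  finally show ?thesis by simp
qed

text \<open>For configurations at bounded distance from the same line the joining paths have a fixed length, so the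
  error does not depend on the window.\<close>
lemma minimizing_compare_bounded:
  assumes \<rho>: "0 < \<rho>" "\<rho> < 1/2"
  obtains K E where "0 < K" "0 \<le> E"
    "\<And>x y m n. minimizing x \<Longrightarrow> admissible y \<Longrightarrow> (\<And>i. \<bar>x i - 2 * pi * \<rho> * of_int i\<bar> \<le> C) \<Longrightarrow>
       (\<And>i. \<bar>y i - 2 * pi * \<rho> * of_int i\<bar> \<le> C) \<Longrightarrow> m + K \<le> n - K \<Longrightarrow> gen_action m n x \<le> gen_action m n y + E"
proof -
  define d where "d = mid_step \<rho>"
  have d: "2 * pi * \<rho> < d" "d < pi" "0 < d" using mid_step \<rho> by (simp_all add: d_def)
  obtain K0 :: nat where K0: "2 * C / (d - 2 * pi * \<rho>) + 2 * C / (2 * pi * \<rho>) \<le> real K0" using real_arch_simple by blast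
  show ?thesis
  proof (cases "0 \<le> C")
    case False
    show ?thesis
    proof (rule that[of 1 0])
      fix x y :: "int \<Rightarrow> real" and m n :: int
      assume "\<And>i. \<bar>x i - 2 * pi * \<rho> * of_int i\<bar> \<le> C"
      from this[of 0] False show "gen_action m n x \<le> gen_action m n y + 0" by linarith
    qed simp_all
  next
    case True
    define K where "K = int K0 + 1"
    have "0 \<le> 2 * C / (d - 2 * pi * \<rho>)" "0 \<le> 2 * C / (2 * pi * \<rho>)" using True d \<rho> by auto
    then have "2 * C / (d - 2 * pi * \<rho>) \<le> of_int K" "2 * C / (2 * pi * \<rho>) \<le> of_int K"
      using K0 by (simp_all add: K_def)
    then have K: "2 * C \<le> of_int K * (d - 2 * pi * \<rho>)" "2 * C \<le> of_int K * (2 * pi * \<rho>)"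
      using d \<rho> by (simp_all add: pos_divide_le_eq)
    have "0 \<le> cost d" using d h_upper_pos tan_gt_zero[of "d/2"] by (simp add: cost_def)
    show ?thesis
    proof (rule that[of K "2 * of_int K * cost d"])
      show "0 < K" "0 \<le> 2 * of_int K * cost d" using \<open>0 \<le> cost d\<close> by (simp_all add: K_def)
      fix x y m n
      assume *: "minimizing x" "admissible y" "\<And>i. \<bar>x i - 2 * pi * \<rho> * of_int i\<bar> \<le> C"
       "\<And>i. \<bar>y i - 2 * pi * \<rho> * of_int i\<bar> \<le> C" "m + K \<le> n - K"
      show "gen_action m n x \<le> gen_action m n y + 2 * of_int K * cost d"
      proof (rule minimizing_compare[OF *(1,2) \<open>0 < K\<close> *(5) d(2)])
        have split: "2 * pi * \<rho> * of_int (m + K) = 2 * pi * \<rho> * of_int m + of_int K * (2 * pi * \<rho>)"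
          "2 * pi * \<rho> * of_int (n - K) = 2 * pi * \<rho> * of_int n - of_int K * (2 * pi * \<rho>)"
          "of_int K * (d - 2 * pi * \<rho>) = of_int K * d - of_int K * (2 * pi * \<rho>)"
          by (simp_all add: algebra_simps)
        note bnd = *(3)[of m] *(4)[of "m + K"] *(3)[of n] *(4)[of "n - K"]
        show "x m \<le> y (m + K)" "y (m + K) - x m \<le> of_int K * d"
          "y (n - K) \<le> x n" "x n - y (n - K) \<le> of_int K * d"
          using bnd K unfolding split abs_le_iff by linarith+
      qed
    qed
  qed
qed

text \<open>Comparison with translates shows that the actions of windows of equal length differ by a bounded
  amount. The action is therefore additive up to bounded errors, and its mean is a Cauchy sequence.\<close>
theorem mean_converges:
  assumes \<rho>: "0 < \<rho>" "\<rho> < 1/2" and x: "minimizing x" and dev: "\<And>i. \<bar>x i - 2 * pi * \<rho> * of_int i\<bar> \<le> C"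
  shows "\<exists>b. mean_gen x \<longlonglongrightarrow> b"
proof -
  obtain K E where K: "0 < K" "0 \<le> E" and cmp:
    "\<And>x y m n. minimizing x \<Longrightarrow> admissible y \<Longrightarrow> (\<And>i. \<bar>x i - 2 * pi * \<rho> * of_int i\<bar> \<le> C + 2 * pi) \<Longrightarrow>
       (\<And>i. \<bar>y i - 2 * pi * \<rho> * of_int i\<bar> \<le> C + 2 * pi) \<Longrightarrow> m + K \<le> n - K \<Longrightarrow> gen_action m n x \<le> gen_action m n y + E"
    using minimizing_compare_bounded[OF \<rho>, of "C + 2 * pi"] by blast
  have adm: "admissible x" using x by (simp add: minimizing_def)
  have shift: "gen_action m (m + l) x \<le> gen_action m' (m' + l) x + E" if l: "2 * K \<le> l" for m m' l
  proof -
    define j where "j = m' - m"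
    obtain k where k: "2 * pi * \<rho> * of_int j + 2 * pi * of_int k \<in> {0..2*pi}"
      using periodic_reduce by blast
    define y where "y = (\<lambda>i. x (i + j) + 2 * pi * of_int k)"
    have "admissible y" unfolding y_def by (rule admissible_translate[OF adm])
    moreover have "\<bar>y i - 2 * pi * \<rho> * of_int i\<bar> \<le> C + 2 * pi" for i
    proof -
      have "y i - 2 * pi * \<rho> * of_int i = (x (i + j) - 2 * pi * \<rho> * of_int (i + j))
          + (2 * pi * \<rho> * of_int j + 2 * pi * of_int k)" by (simp add: y_def algebra_simps)
      then show ?thesis using dev[of "i + j"] k unfolding atLeastAtMost_iff by linarith
    qed
    moreover have "\<bar>x i - 2 * pi * \<rho> * of_int i\<bar> \<le> C + 2 * pi" for i
      using dev[of i] pi_gt_zero by linarith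
    ultimately have "gen_action m (m + l) x \<le> gen_action m (m + l) y + E"
      using l by (intro cmp x) auto
    also have "gen_action m (m + l) y = gen_action m' (m' + l) x"
      unfolding y_def gen_action_translate by (simp add: j_def add.commute)
    finally show ?thesis .
  qed
  define b where "b = (\<lambda>l. gen_action 0 l x)"
  have mult: "\<bar>b (int q * l) - of_nat q * b l\<bar> \<le> of_nat q * E" if l: "2 * K \<le> l" for q l
  proof (induction q)
    case (Suc q)
    have "0 \<le> l" using l K by simp
    then have "b (int (Suc q) * l) = b (int q * l) + gen_action (int q * l) (int q * l + l) x"
      unfolding b_def using gen_action_append[of 0 "int q * l" "int q * l + l" x] by (simp add: algebra_simps)
    moreover have "\<bar>gen_action (int q * l) (int q * l + l) x - b l\<bar> \<le> E"
      using shift[OF l, of "int q * l" 0] shift[OF l, of 0 "int q * l"] by (simp add: b_def abs_le_iff)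
    moreover have "of_nat (Suc q) * b l = of_nat q * b l + b l" "of_nat (Suc q) * E = of_nat q * E + E"
      by (simp_all add: algebra_simps)
    ultimately show ?case using Suc.IH by linarith
  qed (simp add: b_def gen_action_def)
  have ratio: "\<bar>b (int l) / l - b (int l') / l'\<bar> \<le> E / l + E / l'" if l: "2 * K \<le> int l" "2 * K \<le> int l'" for l l' :: nat
  proof -
    have p: "0 < l" "0 < l'" using l K by auto
    have "\<bar>b (int l' * int l) - real l' * b (int l)\<bar> \<le> real l' * E" using mult[OF l(1), of l'] by simp
    moreover have "\<bar>b (int l * int l') - real l * b (int l')\<bar> \<le> real l * E" using mult[OF l(2), of l] by simp
    ultimately have "\<bar>real l' * b (int l) - real l * b (int l')\<bar> \<le> real l' * E + real l * E"
      by (simp add: mult.commute)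
    then have "\<bar>real l' * b (int l) - real l * b (int l')\<bar> / (real l * real l') \<le> (real l' * E + real l * E) / (real l * real l')"
      by (intro divide_right_mono) auto
    moreover have "\<bar>real l' * b (int l) - real l * b (int l')\<bar> / (real l * real l') = \<bar>b (int l) / l - b (int l') / l'\<bar>"
    proof -
      have "b (int l) / l - b (int l') / l' = (real l' * b (int l) - real l * b (int l')) / (real l * real l')"
        using p by (simp add: field_simps)
      then show ?thesis by (simp add: abs_mult)
    qed
    moreover have "(real l' * E + real l * E) / (real l * real l') = E / l + E / l'"
      using p by (simp add: field_simps)
    ultimately show ?thesis by simp
  qed
  define c where "c = (\<lambda>N::nat. b (int (2 * N)) / real (2 * N))"
  have "Cauchy c"
  proof (rule CauchyI)
    fix e :: real assume e: "0 < e"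
    obtain M0 :: nat where M0: "E / e < real M0" using reals_Archimedean2 by blast
    define M where "M = M0 + nat K + 1"
    have small: "E / real (2 * n) < e / 2" if "M \<le> n" for n
    proof -
      have "E < real M0 * e" using M0 e by (simp add: pos_divide_less_eq)
      also have "\<dots> \<le> real n * e" using that e by (intro mult_right_mono) (auto simp: M_def)
      finally show ?thesis using that by (simp add: M_def field_simps)
    qed
    have "norm (c m - c n) < e" if "M \<le> m" "M \<le> n" for m n
    proof -
      have "\<bar>c m - c n\<bar> \<le> E / real (2 * m) + E / real (2 * n)"
        unfolding c_def by (rule ratio) (use that in \<open>auto simp: M_def\<close>)
      then show ?thesis using small[OF that(1)] small[OF that(2)] by simp
    qed
    then show "\<exists>M. \<forall>m\<ge>M. \<forall>n\<ge>M. norm (c m - c n) < e" by blast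
  qed
  then obtain \<beta> where \<beta>: "c \<longlonglongrightarrow> \<beta>" using Cauchy_convergent convergent_def by blast
  let ?a = "\<lambda>N. gen_action (- int N) (int N) x / (2 * real N)"
  have "(\<lambda>N. ?a N - c N) \<longlonglongrightarrow> 0"
  proof (rule Lim_null_comparison)
    show "\<forall>\<^sub>F N in sequentially. norm (?a N - c N) \<le> E / real N"
    proof (rule eventually_mono[OF eventually_ge_at_top[of "nat K"]])
      fix N assume N: "nat K \<le> N"
      have "2 * K \<le> int (2 * N)" "0 < N" using N K by auto
      from shift[OF this(1), of "- int N" 0] shift[OF this(1), of 0 "- int N"]
      have "\<bar>gen_action (- int N) (int N) x - b (int (2 * N))\<bar> \<le> E" by (simp add: b_def abs_le_iff)
      then have "\<bar>gen_action (- int N) (int N) x - b (int (2 * N))\<bar> / real (2 * N) \<le> E / real (2 * N)"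
        by (intro divide_right_mono) auto
      also have "\<dots> \<le> E / real N" using \<open>0 < N\<close> K by (intro divide_left_mono) auto
      finally show "norm (?a N - c N) \<le> E / real N"
        by (simp add: c_def diff_divide_distrib[symmetric])
    qed
    show "(\<lambda>N. E / real N) \<longlonglongrightarrow> 0" by (rule lim_const_over_n)
  qed
  from tendsto_add[OF this \<beta>] show ?thesis by auto
qed

text \<open>Here only the rotation numbers are known, so at distance \<open>N\<close> the two configurations may be \<open>o(N)\<close>
  apart. They are joined within about \<open>e N\<close> steps, which changes the mean action by \<open>O(e)\<close>.\<close>
theorem mean_le:
  assumes \<rho>: "0 < \<rho>" "\<rho> < 1/2" and x: "minimizing x" and y: "admissible y"
    and rot: "has_rotation_number x \<rho>" "has_rotation_number y \<rho>"
    and a: "mean_gen x \<longlonglongrightarrow> a"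
    and b: "mean_gen y \<longlonglongrightarrow> b"
  shows "a \<le> b"
proof -
  define d where "d = mid_step \<rho>"
  define r where "r = 2 * pi * \<rho>"
  have d: "r < d" "d < pi" "0 < d" and r: "0 < r" using mid_step \<rho> by (simp_all add: d_def r_def)
  define c where "c = cost d"
  have c: "0 \<le> c" using d h_upper_pos tan_gt_zero[of "d/2"] by (simp add: c_def cost_def)
  define \<mu> where "\<mu> = min r (d - r)"
  have \<mu>: "0 < \<mu>" "\<mu> \<le> r" "\<mu> \<le> d - r" using d r by (auto simp: \<mu>_def)
  have bound: "a \<le> b + e * c" if e: "0 < e" "e \<le> 1/4" for e
  proof -
    (* With this tolerance both discrepancies together are at most mu * K, the distance that can be gained
       or lost against the line of slope r by K steps of size between 0 and d. *)
    define \<eta> where "\<eta> = e * \<mu> / 2"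
    have "0 < \<eta>" using e \<mu> by (simp add: \<eta>_def)
    obtain I1 I2 where I: "\<And>i. I1 \<le> \<bar>i\<bar> \<Longrightarrow> \<bar>x i - r * of_int i\<bar> \<le> \<eta> * of_int \<bar>i\<bar>"
      "\<And>i. I2 \<le> \<bar>i\<bar> \<Longrightarrow> \<bar>y i - r * of_int i\<bar> \<le> \<eta> * of_int \<bar>i\<bar>"
      using rotation_deviation[OF rot(1) \<open>0 < \<eta>\<close>] rotation_deviation[OF rot(2) \<open>0 < \<eta>\<close>]
      unfolding r_def by blast
    have main: "gen_action (- int N) (int N) x / (2 * real N) \<le> gen_action (- int N) (int N) y / (2 * real N) + (e + 1 / real N) * c"
      if N: "4 \<le> N" "2 * nat \<bar>I1\<bar> \<le> N" "2 * nat \<bar>I2\<bar> \<le> N" for N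
    proof -
      define K where "K = \<lceil>e * real N\<rceil>"
      have K: "e * real N \<le> of_int K" "of_int K \<le> e * real N + 1" unfolding K_def by linarith+
      have "0 < e * real N" using e N by simp
      then have K0: "0 < K" using K(1) by linarith
      have "e * real N \<le> 1/4 * real N" using e by (intro mult_right_mono) auto
      then have K2: "2 * K \<le> int N" using K(2) N(1) by linarith
      have eN: "\<eta> * real N \<le> of_int K * \<mu> / 2"
      proof -
        have "e * real N * \<mu> \<le> of_int K * \<mu>" using K(1) \<mu> by (intro mult_right_mono) auto
        then show ?thesis by (simp add: \<eta>_def algebra_simps)
      qed
      have "of_int K * \<mu> \<le> of_int K * r" "of_int K * \<mu> \<le> of_int K * (d - r)"
        using \<mu> K0 by (intro mult_left_mono; simp)+
      then have K\<mu>: "of_int K * \<mu> \<le> of_int K * r" "of_int K * \<mu> \<le> of_int K * d - of_int K * r"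
        by (simp_all add: algebra_simps)
      have xN: "\<bar>x (- int N) - r * of_int (- int N)\<bar> \<le> \<eta> * real N" "\<bar>x (int N) - r * of_int (int N)\<bar> \<le> \<eta> * real N"
        using I(1)[of "- int N"] I(1)[of "int N"] N by auto
      have yN: "\<bar>y i - r * of_int i\<bar> \<le> \<eta> * real N" if "\<bar>i\<bar> = int N - K" for i
      proof -
        have "I2 \<le> \<bar>i\<bar>" using that N(3) K2 by linarith
        from I(2)[OF this] have "\<bar>y i - r * of_int i\<bar> \<le> \<eta> * of_int \<bar>i\<bar>" .
        also have "\<dots> \<le> \<eta> * real N" unfolding that using K0 \<open>0 < \<eta>\<close> by (intro mult_left_mono) simp_all
        finally show ?thesis .
      qed
      have y1: "\<bar>y (- int N + K) - r * of_int (- int N + K)\<bar> \<le> \<eta> * real N"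
        and y2: "\<bar>y (int N - K) - r * of_int (int N - K)\<bar> \<le> \<eta> * real N"
        by (rule yN, use K2 K0 in simp)+
      have split: "r * of_int (- int N + K) = r * of_int (- int N) + of_int K * r"
        "r * of_int (int N - K) = r * of_int (int N) - of_int K * r" by (simp_all add: algebra_simps)
      have "gen_action (- int N) (int N) x \<le> gen_action (- int N) (int N) y + 2 * of_int K * cost d"
      proof (rule minimizing_compare[OF x y K0 _ d(2)])
        show "- int N + K \<le> int N - K" using K2 by simp
        show "x (- int N) \<le> y (- int N + K)" "y (- int N + K) - x (- int N) \<le> of_int K * d"
          "y (int N - K) \<le> x (int N)" "x (int N) - y (int N - K) \<le> of_int K * d"
          using xN y1 y2 eN K\<mu> unfolding split abs_le_iff by linarith+
      qed
      also have "2 * of_int K * cost d \<le> 2 * (e * real N + 1) * c"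
        unfolding c_def[symmetric] using K(2) c by (intro mult_right_mono) auto
      finally have "gen_action (- int N) (int N) x / (2 * real N)
          \<le> (gen_action (- int N) (int N) y + 2 * (e * real N + 1) * c) / (2 * real N)"
        by (intro divide_right_mono) auto
      also have "\<dots> = gen_action (- int N) (int N) y / (2 * real N) + (e + 1 / real N) * c"
        using N by (simp add: field_simps)
      finally show ?thesis .
    qed
    have lim: "(\<lambda>N. gen_action (- int N) (int N) y / (2 * real N) + (e + 1 / real N) * c) \<longlonglongrightarrow> b + (e + 0) * c"
      by (intro tendsto_add tendsto_mult b tendsto_const lim_1_over_n)
    have "a \<le> b + (e + 0) * c"
      by (rule LIMSEQ_le[OF a lim], rule exI[of _ "4 + 2 * nat \<bar>I1\<bar> + 2 * nat \<bar>I2\<bar>"]) (intro allI impI main; simp)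
    then show ?thesis by simp
  qed
  show ?thesis
  proof (rule ccontr)
    assume "\<not> ?thesis"
    then have ab: "0 < a - b" by simp
    define e where "e = min (1/4) ((a - b) / (2 * (c + 1)))"
    have c1: "0 < 2 * (c + 1)" using c by simp
    have "0 < (a - b) / (2 * (c + 1))" using ab c1 by (rule divide_pos_pos)
    then have e: "0 < e" "e \<le> 1/4" "e \<le> (a - b) / (2 * (c + 1))" unfolding e_def by linarith+
    have "e * c \<le> (a - b) / (2 * (c + 1)) * c" using c e(3) by (intro mult_right_mono)
    also have "\<dots> < a - b"
    proof -
      have "(a - b) * c < (a - b) * (2 * (c + 1))" using ab c by (intro mult_strict_left_mono) auto
      then show ?thesis using c1 by (simp add: pos_divide_less_eq)
    qed
    finally show False using bound[OF e(1,2)] by simp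
  qed
qed

section \<open>Upper bound by averaging and its first variation\<close>

lemma gen_periodic: "gen (x + 2 * pi) (y + 2 * pi) = gen x y"
  using gen_shift[of x 1 y] by simp

lemma continuous_on_h_comp: "continuous_on X f \<Longrightarrow> continuous_on X (\<lambda>s. h (f s))"
  by (rule continuous_on_compose2[OF h_cont[of UNIV]]) auto

lemma continuous_on_h'_comp: "continuous_on X f \<Longrightarrow> continuous_on X (\<lambda>s. h' (f s))"
  by (rule continuous_on_compose2[OF h'_cont]) auto

lemma continuous_on_half_tan_comp:
  fixes f g :: "'z::t2_space \<Rightarrow> real"
  assumes "continuous_on X f" "continuous_on X g" "\<And>s. s \<in> X \<Longrightarrow> \<bar>g s - f s\<bar> < pi"
  shows "continuous_on X (\<lambda>s. half_tan (f s) (g s))"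
proof -
  have "cos ((g s - f s) / 2) \<noteq> 0" if "s \<in> X" for s
    using assms(3)[OF that] by (intro less_imp_neq[symmetric] cos_gt_zero_pi) auto
  then show ?thesis unfolding half_tan_def tan_def by (intro continuous_intros assms ballI) auto
qed

lemma continuous_on_gen_comp:
  fixes f g :: "'z::t2_space \<Rightarrow> real"
  assumes "continuous_on X f" "continuous_on X g" "\<And>s. s \<in> X \<Longrightarrow> \<bar>g s - f s\<bar> < pi"
  shows "continuous_on X (\<lambda>s. gen (f s) (g s))"
  unfolding gen_def by (intro continuous_intros continuous_on_h_comp continuous_on_half_tan_comp assms)

text \<open>The sequence \<open>i \<mapsto> f (s + 2 \<pi> \<rho> i)\<close> is admissible and stays close to a line, uniformly in \<open>s\<close>. Averaging
  the comparison over \<open>s\<close> turns the action into the integral, since each shift preserves it.\<close>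
theorem mean_le_integral:
  assumes \<rho>: "0 < \<rho>" "\<rho> < 1/2" and x: "minimizing x" and dev: "\<And>i. \<bar>x i - 2 * pi * \<rho> * of_int i\<bar> \<le> C"
    and lim: "mean_gen x \<longlonglongrightarrow> b"
    and f: "continuous_on UNIV f" "\<And>s. f (s + 2 * pi) = f s + 2 * pi" "\<And>s. \<bar>f s - s\<bar> \<le> c"
    and step: "\<And>s. f s \<le> f (s + 2 * pi * \<rho>)" "\<And>s. f (s + 2 * pi * \<rho>) < f s + pi"
  shows "2 * pi * b \<le> integral {0..2*pi} (\<lambda>s. gen (f s) (f (s + 2 * pi * \<rho>)))"
proof -
  define \<delta> where "\<delta> = 2 * pi * \<rho>"
  define F where "F = (\<lambda>s. gen (f s) (f (s + \<delta>)))"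
  have fc: "continuous_on X (\<lambda>s. f (s + a))" for X a
    by (rule continuous_on_compose2[OF f(1)]) (auto intro!: continuous_intros)
  have Fc: "continuous_on UNIV F"
    unfolding F_def using step fc[of UNIV 0] by (intro continuous_on_gen_comp fc) (auto simp: \<delta>_def abs_less_iff, smt (verit))
  have Fper: "F (s + 2 * pi) = F s" for s
    using f(2)[of s] f(2)[of "s + \<delta>"] gen_periodic[of "f s" "f (s + \<delta>)"] by (simp add: F_def add_ac)
  define y where "y = (\<lambda>s i. f (s + \<delta> * of_int i))"
  have adm: "admissible (y s)" for s
    unfolding admissible_def
  proof
    fix i
    have e: "s + \<delta> * of_int (i + 1) = (s + \<delta> * of_int i) + \<delta>" by (simp add: algebra_simps)
    show "0 \<le> y s (i + 1) - y s i \<and> y s (i + 1) - y s i < pi"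
      using step[of "s + \<delta> * of_int i", folded \<delta>_def] unfolding y_def e by simp
  qed
  define C' where "C' = max C (c + 2 * pi)"
  have devx: "\<bar>x i - 2 * pi * \<rho> * of_int i\<bar> \<le> C'" for i using dev[of i] by (simp add: C'_def)
  have devy: "\<bar>y s i - 2 * pi * \<rho> * of_int i\<bar> \<le> C'" if "s \<in> {0..2*pi}" for s i
    using f(3)[of "s + \<delta> * of_int i"] that unfolding y_def C'_def \<delta>_def atLeastAtMost_iff by linarith
  obtain K E where K: "0 < K" "0 \<le> E" and cmp:
    "\<And>x y m n. minimizing x \<Longrightarrow> admissible y \<Longrightarrow> (\<And>i. \<bar>x i - 2 * pi * \<rho> * of_int i\<bar> \<le> C') \<Longrightarrow>
       (\<And>i. \<bar>y i - 2 * pi * \<rho> * of_int i\<bar> \<le> C') \<Longrightarrow> m + K \<le> n - K \<Longrightarrow> gen_action m n x \<le> gen_action m n y + E"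
    using minimizing_compare_bounded[OF \<rho>, of C'] by blast
  have gen_action_y: "gen_action m n (y s) = (\<Sum>i\<in>{m..<n}. F (s + \<delta> * of_int i))" for m n s
    unfolding gen_action_def F_def y_def by (simp add: algebra_simps)
  have Fshift: "continuous_on X (\<lambda>s. F (s + a))" for X a
    by (rule continuous_on_compose2[OF Fc]) (auto intro!: continuous_intros)
  have ineq: "2 * pi * (gen_action (- int N) (int N) x / (2 * real N)) \<le> integral {0..2*pi} F + 2 * pi * E / real N"
    if N: "nat K + 1 \<le> N" for N
  proof -
    have NK: "- int N + K \<le> int N - K" using N by linarith
    have "2 * pi * gen_action (- int N) (int N) x = integral {0..2*pi} (\<lambda>s. gen_action (- int N) (int N) x)" by simp
    also have "\<dots> \<le> integral {0..2*pi} (\<lambda>s. (\<Sum>i\<in>{- int N..<int N}. F (s + \<delta> * of_int i)) + E)"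
    proof (rule integral_le)
      show "gen_action (- int N) (int N) x \<le> (\<Sum>i\<in>{- int N..<int N}. F (s + \<delta> * of_int i)) + E" if "s \<in> {0..2*pi}" for s
        using cmp[OF x adm devx devy[OF that] NK] by (simp add: gen_action_y)
    qed (intro integrable_continuous_real continuous_intros Fshift)+
    also have "\<dots> = (\<Sum>i\<in>{- int N..<int N}. integral {0..2*pi} F) + 2 * pi * E"
    proof (rule integral_unique, rule has_integral_add)
      show "((\<lambda>s. \<Sum>i\<in>{- int N..<int N}. F (s + \<delta> * of_int i)) has_integral (\<Sum>i\<in>{- int N..<int N}. integral {0..2*pi} F)) {0..2*pi}"
      proof (rule has_integral_sum)
        fix i
        have "integral {0..2*pi} (\<lambda>s. F (s + \<delta> * of_int i)) = integral {0..2*pi} F"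
          by (rule integral_period_shift[OF Fc Fper]) simp
        then show "((\<lambda>s. F (s + \<delta> * of_int i)) has_integral integral {0..2*pi} F) {0..2*pi}"
          by (metis integrable_integral integrable_continuous_real Fshift)
      qed simp
      show "((\<lambda>s. E) has_integral 2 * pi * E) {0..2*pi}" using has_integral_const_real[of E 0 "2*pi"] by simp
    qed
    also have "\<dots> = 2 * real N * integral {0..2*pi} F + 2 * pi * E" by simp
    finally have "2 * pi * gen_action (- int N) (int N) x / (2 * real N) \<le> (2 * real N * integral {0..2*pi} F + 2 * pi * E) / (2 * real N)"
      by (intro divide_right_mono) auto
    also have "\<dots> = integral {0..2*pi} F + pi * E / real N" using N by (simp add: add_divide_distrib)
    also have "\<dots> \<le> integral {0..2*pi} F + 2 * pi * E / real N"
      using K by (intro add_left_mono divide_right_mono) (auto simp: mult_right_mono)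
    finally show ?thesis by simp
  qed
  have "2 * pi * b \<le> integral {0..2*pi} F + 0"
  proof (rule LIMSEQ_le)
    show "(\<lambda>N. 2 * pi * (gen_action (- int N) (int N) x / (2 * real N))) \<longlonglongrightarrow> 2 * pi * b"
      by (intro tendsto_mult tendsto_const lim)
    show "(\<lambda>N. integral {0..2*pi} F + 2 * pi * E / real N) \<longlonglongrightarrow> integral {0..2*pi} F + 0"
      by (intro tendsto_add tendsto_const lim_const_over_n)
    show "\<exists>M. \<forall>N\<ge>M. 2 * pi * (gen_action (- int N) (int N) x / (2 * real N)) \<le> integral {0..2*pi} F + 2 * pi * E / real N"
      using ineq by blast
  qed
  then show ?thesis by (simp add: F_def \<delta>_def)
qed

lemma integral_gen_rotation:
  shows "integral {0..2*pi} (\<lambda>s. gen s (s + \<delta>)) = 2 * tan (\<delta> / 2) * integral {0..2*pi} h"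
proof -
  have c: "continuous_on {0..2*pi} (\<lambda>s. h (s + \<delta>))" by (intro continuous_on_h_comp continuous_intros)
  have "integral {0..2*pi} (\<lambda>s. gen s (s + \<delta>)) = integral {0..2*pi} (\<lambda>s. (h s + h (s + \<delta>)) * tan (\<delta> / 2))"
    by (simp add: gen_def half_tan_def)
  also have "\<dots> = (integral {0..2*pi} h + integral {0..2*pi} (\<lambda>s. h (s + \<delta>))) * tan (\<delta> / 2)"
    by (intro integral_unique has_integral_mult_left has_integral_add integrable_integral integrable_continuous_real c h_cont)
  also have "integral {0..2*pi} (\<lambda>s. h (s + \<delta>)) = integral {0..2*pi} h"
    by (rule integral_period_shift[OF h_cont h_per]) simp
  finally show ?thesis by simp
qed

text \<open>Differentiation under the integral sign. The bounds on \<open>e0\<close> keep all steps of the deformed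
  configurations between \<open>0\<close> and \<open>\<pi>\<close>.\<close>
lemma variation_derivative:
  fixes \<eta> :: "real \<Rightarrow> real"
  assumes \<delta>: "0 < \<delta>" "\<delta> < pi" and \<eta>: "continuous_on UNIV \<eta>" "\<And>s. \<bar>\<eta> s\<bar> \<le> 1"
    and e0: "0 < e0" "2 * e0 < pi - \<delta>" "2 * e0 < \<delta>"
  shows "((\<lambda>e. integral {0..2*pi} (\<lambda>s. gen (s + e * \<eta> s) (s + \<delta> + e * \<eta> (s + \<delta>)))) has_real_derivative
     integral {0..2*pi} (\<lambda>s. D1 s (s + \<delta>) * \<eta> s + D2 s (s + \<delta>) * \<eta> (s + \<delta>))) (at 0)"
proof -
  let ?u = "\<lambda>e s. s + e * \<eta> s" and ?v = "\<lambda>e s. s + \<delta> + e * \<eta> (s + \<delta>)"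
  let ?d = "\<lambda>e s. (h' (?u e s) * \<eta> s + h' (?v e s) * \<eta> (s + \<delta>)) * half_tan (?u e s) (?v e s)
     + (h (?u e s) + h (?v e s)) * ((1 + (half_tan (?u e s) (?v e s))\<^sup>2) / 2 * (\<eta> (s + \<delta>) - \<eta> s))"
  have diff: "\<bar>?v e s - ?u e s\<bar> < pi" if "e \<in> {-e0<..<e0}" for e s
  proof -
    have "\<bar>e * \<eta> s\<bar> \<le> e0 * 1" "\<bar>e * \<eta> (s + \<delta>)\<bar> \<le> e0 * 1"
      unfolding abs_mult using that \<eta>(2) by (intro mult_mono; auto)+
    then show ?thesis using e0 \<delta> by (simp add: abs_less_iff abs_le_iff)
  qed
  have \<eta>c: "continuous_on X f \<Longrightarrow> continuous_on X (\<lambda>x. \<eta> (f x))" for X and f :: "'z::topological_space \<Rightarrow> real"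
    by (rule continuous_on_compose2[OF \<eta>(1)]) auto
  have "((\<lambda>e. integral (cbox 0 (2*pi)) (\<lambda>s. gen (?u e s) (?v e s))) has_field_derivative
     integral (cbox 0 (2*pi)) (?d 0)) (at 0 within {-e0<..<e0})"
  proof (rule leibniz_rule_field_derivative[where U = "{-e0<..<e0}"])
    show "(0::real) \<in> {-e0<..<e0}" using e0 by simp
    show "convex {-e0<..<e0}" by simp
    show "continuous_on ({-e0<..<e0} \<times> cbox 0 (2*pi)) (\<lambda>(e, s). ?d e s)"
      unfolding case_prod_unfold
      by (intro continuous_intros continuous_on_h_comp continuous_on_h'_comp continuous_on_half_tan_comp \<eta>c)
        (use diff in auto)
    show "(\<lambda>s. gen (?u e s) (?v e s)) integrable_on cbox 0 (2*pi)" if "e \<in> {-e0<..<e0}" for e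
      unfolding cbox_interval
      by (intro integrable_continuous_real continuous_on_gen_comp continuous_intros \<eta>c diff that)
    fix e s assume e: "e \<in> {-e0<..<e0}"
    have du: "((\<lambda>e. ?u e s) has_real_derivative \<eta> s) (at e)" "((\<lambda>e. ?v e s) has_real_derivative \<eta> (s + \<delta>)) (at e)"
      by (auto intro!: derivative_eq_intros)
    have "((\<lambda>e. ?v e s - ?u e s) has_real_derivative \<eta> (s + \<delta>) - \<eta> s) (at e)"
      by (intro DERIV_diff du)
    from DERIV_chain2[where g = "\<lambda>e. ?v e s - ?u e s" and x = e, OF tan_half_deriv[OF diff[OF e]] this]
    have dT: "((\<lambda>e. half_tan (?u e s) (?v e s)) has_real_derivative (1 + (half_tan (?u e s) (?v e s))\<^sup>2) / 2 * (\<eta> (s + \<delta>) - \<eta> s)) (at e)"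
      by (simp add: half_tan_def)
    have "((\<lambda>e. gen (?u e s) (?v e s)) has_real_derivative ?d e s) (at e)"
      unfolding gen_def
      by (rule DERIV_cong[OF DERIV_mult[OF DERIV_add[OF DERIV_chain2[OF h_deriv du(1)] DERIV_chain2[OF h_deriv du(2)]] dT]])
        (simp add: algebra_simps)
    then show "((\<lambda>e. gen (?u e s) (?v e s)) has_field_derivative ?d e s) (at e within {-e0<..<e0})"
      by (rule has_field_derivative_at_within)
  qed
  moreover have "?d 0 s = D1 s (s + \<delta>) * \<eta> s + D2 s (s + \<delta>) * \<eta> (s + \<delta>)" for s
    by (simp add: D1_def D2_def algebra_simps diff_divide_distrib add_divide_distrib)
  moreover have "at 0 within {-e0<..<e0} = at (0::real)"
    using e0 by (intro at_within_open) auto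
  ultimately show ?thesis by (simp add: cbox_interval)
qed

text \<open>Shifts of the variable and one integration by parts move everything onto \<open>h\<close>; the factor comes from
  \<open>2 tan (\<delta>/2) = (1 + tan\<^sup>2 (\<delta>/2)) sin \<delta>\<close>.\<close>
lemma variation_integral:
  assumes \<delta>: "0 < \<delta>" "\<delta> < pi"
  defines "t \<equiv> tan (\<delta> / 2)"
  shows "integral {0..2*pi} (\<lambda>s. D1 s (s + \<delta>) * cos (real k * s + a) + D2 s (s + \<delta>) * cos (real k * (s + \<delta>) + a))
     = (1 + t\<^sup>2) * (real k * sin \<delta> - sin (real k * \<delta>)) * integral {0..2*pi} (\<lambda>s. h s * sin (real k * s + a))"
proof -
  define \<eta> where "\<eta> = (\<lambda>s. cos (real k * s + a))"
  have \<eta>c: "continuous_on X f \<Longrightarrow> continuous_on X (\<lambda>x. \<eta> (f x))" for X and f :: "real \<Rightarrow> real"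
    unfolding \<eta>_def by (intro continuous_intros)
  have \<eta>p: "\<eta> (s + 2 * pi) = \<eta> s" for s
    unfolding \<eta>_def by (rule cos_affine_period)
  note c = continuous_on_h_comp continuous_on_h'_comp \<eta>c
  let ?I = "\<lambda>f. integral {0..2*pi} f"
  have h'p: "h' (x + 2 * pi) = h' x" for x
  proof -
    have "((\<lambda>x. h (x + 2 * pi)) has_real_derivative h' (x + 2 * pi)) (at x)"
      using DERIV_shift[of h "h' (x + 2 * pi)" x "2 * pi"] h_deriv by blast
    then show ?thesis using h_per DERIV_unique[OF h_deriv] by simp
  qed
  have shift: "?I (\<lambda>s. F (s + b)) = ?I F" if "continuous_on UNIV F" "\<And>s. F (s + 2 * pi) = F s" for F :: "real \<Rightarrow> real" and b
    by (rule integral_period_shift[OF that]) simp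
  have A: "?I (\<lambda>s. h' (s + \<delta>) * \<eta> (s + \<delta>)) = ?I (\<lambda>s. h' s * \<eta> s)"
    by (rule shift[of "\<lambda>s. h' s * \<eta> s"]) (intro continuous_intros c, simp add: h'p \<eta>p)
  have B: "?I (\<lambda>s. h (s + \<delta>) * \<eta> (s + \<delta>)) = ?I (\<lambda>s. h s * \<eta> s)"
    by (rule shift[of "\<lambda>s. h s * \<eta> s"]) (intro continuous_intros c, simp add: h_per \<eta>p)
  have C: "?I (\<lambda>s. h (s + \<delta>) * \<eta> s) = ?I (\<lambda>s. h s * \<eta> (s - \<delta>))"
  proof -
    have "\<eta> (s + 2 * pi - \<delta>) = \<eta> (s - \<delta>)" for s using \<eta>p[of "s - \<delta>"] by (simp add: algebra_simps)
    then show ?thesis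
      using shift[of "\<lambda>s. h s * \<eta> (s - \<delta>)" \<delta>] by (simp add: h_per continuous_intros c)
  qed
  have D: "?I (\<lambda>s. h' s * \<eta> s) = real k * ?I (\<lambda>s. h s * sin (real k * s + a))"
  proof -
    have "((\<lambda>s. h' s * \<eta> s - real k * (h s * sin (real k * s + a))) has_integral h (2*pi) * \<eta> (2*pi) - h 0 * \<eta> 0) {0..2*pi}"
      by (rule fundamental_theorem_of_calculus)
        (auto intro!: derivative_eq_intros h_deriv[THEN has_field_derivative_at_within] simp: \<eta>_def simp flip: has_real_derivative_iff_has_vector_derivative)
    moreover have "h (2*pi) * \<eta> (2*pi) - h 0 * \<eta> 0 = 0" using h_per[of 0] \<eta>p[of 0] by simp
    ultimately have "?I (\<lambda>s. h' s * \<eta> s - real k * (h s * sin (real k * s + a))) = 0" by (simp add: integral_unique)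
    moreover have "?I (\<lambda>s. h' s * \<eta> s - real k * (h s * sin (real k * s + a))) = ?I (\<lambda>s. h' s * \<eta> s) - real k * ?I (\<lambda>s. h s * sin (real k * s + a))"
      by (intro integral_unique has_integral_diff has_integral_mult_right integrable_integral integrable_continuous_real continuous_intros c)
    ultimately show ?thesis by simp
  qed
  have alg: "(1 + t\<^sup>2) * p * (q * Q) + (1 + t\<^sup>2) / 2 * (- 2 * r * Q) = (1 + t\<^sup>2) * (q * p - r) * Q" for p q r Q
    by (simp add: field_simps)
  have Tt: "half_tan s (s + \<delta>) = t" for s by (simp add: half_tan_def t_def)
  have "?I (\<lambda>s. D1 s (s + \<delta>) * \<eta> s + D2 s (s + \<delta>) * \<eta> (s + \<delta>)) =
    ?I (\<lambda>s. t * (h' s * \<eta> s) + t * (h' (s + \<delta>) * \<eta> (s + \<delta>)) + (1 + t\<^sup>2) / 2 * (h s * \<eta> (s + \<delta>) + h (s + \<delta>) * \<eta> (s + \<delta>) - h s * \<eta> s - h (s + \<delta>) * \<eta> s))"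
    by (rule integral_cong) (simp add: D1_def D2_def Tt field_simps)
  also have "\<dots> = t * ?I (\<lambda>s. h' s * \<eta> s) + t * ?I (\<lambda>s. h' (s + \<delta>) * \<eta> (s + \<delta>)) + (1 + t\<^sup>2) / 2 *
     (?I (\<lambda>s. h s * \<eta> (s + \<delta>)) + ?I (\<lambda>s. h (s + \<delta>) * \<eta> (s + \<delta>)) - ?I (\<lambda>s. h s * \<eta> s) - ?I (\<lambda>s. h (s + \<delta>) * \<eta> s))"
    by (intro integral_unique has_integral_add has_integral_diff has_integral_mult_right integrable_integral
      integrable_continuous_real continuous_intros c)
  also have "\<dots> = 2 * t * ?I (\<lambda>s. h' s * \<eta> s) + (1 + t\<^sup>2) / 2 * (?I (\<lambda>s. h s * \<eta> (s + \<delta>)) - ?I (\<lambda>s. h s * \<eta> (s - \<delta>)))"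
    unfolding A B C by simp
  also have "?I (\<lambda>s. h s * \<eta> (s + \<delta>)) - ?I (\<lambda>s. h s * \<eta> (s - \<delta>)) = ?I (\<lambda>s. h s * \<eta> (s + \<delta>) - h s * \<eta> (s - \<delta>))"
    by (intro integral_unique[symmetric] has_integral_diff integrable_integral
      integrable_continuous_real continuous_intros c)
  also have "(\<lambda>s. h s * \<eta> (s + \<delta>) - h s * \<eta> (s - \<delta>)) = (\<lambda>s. (- 2 * sin (real k * \<delta>)) * (h s * sin (real k * s + a)))"
  proof
    fix s
    have "\<eta> (s + \<delta>) = cos ((real k * s + a) + real k * \<delta>)" "\<eta> (s - \<delta>) = cos ((real k * s + a) - real k * \<delta>)"
      by (simp_all add: \<eta>_def algebra_simps)
    then have "\<eta> (s + \<delta>) - \<eta> (s - \<delta>) = - 2 * sin (real k * \<delta>) * sin (real k * s + a)"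
      by (simp add: cos_add cos_diff)
    then show "h s * \<eta> (s + \<delta>) - h s * \<eta> (s - \<delta>) = (- 2 * sin (real k * \<delta>)) * (h s * sin (real k * s + a))"
      by (simp add: right_diff_distrib[symmetric])
  qed
  also have "?I (\<lambda>s. (- 2 * sin (real k * \<delta>)) * (h s * sin (real k * s + a))) = (- 2 * sin (real k * \<delta>)) * ?I (\<lambda>s. h s * sin (real k * s + a))"
    by (rule integral_mult_right)
  also have "2 * t * ?I (\<lambda>s. h' s * \<eta> s) = (1 + t\<^sup>2) * sin \<delta> * (real k * ?I (\<lambda>s. h s * sin (real k * s + a)))"
  proof -
    have "cos (\<delta> / 2) \<noteq> 0" using \<delta> by (intro less_imp_neq[symmetric] cos_gt_zero_pi) auto
    then have "(1 + t\<^sup>2) * sin \<delta> = 2 * t"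
      using sin_double[of "\<delta> / 2"] by (simp add: t_def tan_sec) (simp add: tan_def field_simps power2_eq_square)
    then show ?thesis unfolding D by simp
  qed
  also have "(1 + t\<^sup>2) * sin \<delta> * (real k * ?I (\<lambda>s. h s * sin (real k * s + a)))
      + (1 + t\<^sup>2) / 2 * (- 2 * sin (real k * \<delta>) * ?I (\<lambda>s. h s * sin (real k * s + a)))
    = (1 + t\<^sup>2) * (real k * sin \<delta> - sin (real k * \<delta>)) * ?I (\<lambda>s. h s * sin (real k * s + a))"
    by (rule alg)
  finally show ?thesis unfolding \<eta>_def .
qed

text \<open>Equality makes the identity a minimum of the averaged action among deformations, so every first
  variation vanishes.\<close>
theorem equality_first_harmonic:
  assumes \<rho>: "0 < \<rho>" "\<rho> < 1/2" and x: "minimizing x" and dev: "\<And>i. \<bar>x i - 2 * pi * \<rho> * of_int i\<bar> \<le> C"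
    and lim: "mean_gen x \<longlonglongrightarrow> b"
    and eq: "2 * pi * b = 2 * tan (pi * \<rho>) * integral {0..2*pi} h"
  shows "\<exists>r w. \<forall>s. h s = r + w \<bullet> cis s"
proof (rule first_harmonic[OF h_cont h_per])
  fix k :: nat and a :: real assume k: "2 \<le> k"
  define \<delta> where "\<delta> = 2 * pi * \<rho>"
  have \<delta>: "0 < \<delta>" "\<delta> < pi" using \<rho> mult_strict_left_mono[OF \<rho>(2), of "2 * pi"] by (simp_all add: \<delta>_def)
  define \<eta> where "\<eta> = (\<lambda>s. cos (real k * s + a))"
  have \<eta>: "continuous_on UNIV \<eta>" "\<And>s. \<bar>\<eta> s\<bar> \<le> 1" unfolding \<eta>_def by (auto intro!: continuous_intros)
  have \<eta>p: "\<eta> (s + 2 * pi) = \<eta> s" for s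
    unfolding \<eta>_def by (rule cos_affine_period)
  define e0 where "e0 = min (pi - \<delta>) \<delta> / 3"
  have e0: "0 < e0" "2 * e0 < pi - \<delta>" "2 * e0 < \<delta>" using \<delta> by (auto simp: e0_def min_def)
  define J where "J = (\<lambda>e. integral {0..2*pi} (\<lambda>s. gen (s + e * \<eta> s) (s + \<delta> + e * \<eta> (s + \<delta>))))"
  have "2 * pi * b \<le> J e" if e: "\<bar>e\<bar> < e0" for e
    unfolding J_def \<delta>_def
  proof (rule mean_le_integral[OF \<rho> x dev lim])
    have small: "\<bar>e * \<eta> s\<bar> \<le> e0" for s
      using mult_mono[of "\<bar>e\<bar>" e0 "\<bar>\<eta> s\<bar>" 1] e \<eta>(2)[of s] by (simp add: abs_mult)
    show "continuous_on UNIV (\<lambda>s. s + e * \<eta> s)" by (intro continuous_intros \<eta>)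
    show "s + 2 * pi + e * \<eta> (s + 2 * pi) = s + e * \<eta> s + 2 * pi" for s by (simp add: \<eta>p)
    show "\<bar>s + e * \<eta> s - s\<bar> \<le> e0" for s using small[of s] by simp
    show "s + e * \<eta> s \<le> s + 2 * pi * \<rho> + e * \<eta> (s + 2 * pi * \<rho>)" 
      "s + 2 * pi * \<rho> + e * \<eta> (s + 2 * pi * \<rho>) < s + e * \<eta> s + pi" for s
      using small[of s] small[of "s + 2 * pi * \<rho>"] e0 unfolding \<delta>_def abs_le_iff by linarith+
  qed
  moreover have "J 0 = 2 * pi * b"
    using eq integral_gen_rotation[of \<delta>] by (simp add: J_def \<delta>_def)
  ultimately have "\<forall>y. \<bar>0 - y\<bar> < e0 \<longrightarrow> J 0 \<le> J y" by simp
  from DERIV_local_min[OF variation_derivative[OF \<delta> \<eta> e0, folded J_def] e0(1) this]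
  have "(1 + (tan (\<delta> / 2))\<^sup>2) * (real k * sin \<delta> - sin (real k * \<delta>)) * integral {0..2*pi} (\<lambda>s. h s * sin (real k * s + a)) = 0"
    using variation_integral[OF \<delta>, of k a] by (simp add: \<eta>_def)
  moreover have "real k * sin \<delta> - sin (real k * \<delta>) > 0" using sin_mult_less[OF \<delta> k] by linarith
  ultimately show "integral {0..2*pi} (\<lambda>s. h s * sin (real k * s + a)) = 0"
    using one_plus_sq_pos[of "tan (\<delta> / 2)"] by simp
qed

end

section \<open>Support function of a strictly convex domain\<close>

text \<open>The point \<open>z\<close> serves as origin for the support function; taking it inside the domain makes the support
  function positive.\<close>
locale convex_domain =
  fixes \<Omega> :: "complex set" and z :: complex
  assumes open_dom: "open \<Omega>" and z_in: "z \<in> \<Omega>" and bounded_dom: "bounded \<Omega>"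
    and strict: "strictly_convex \<Omega>"
begin

abbreviation p :: "real \<Rightarrow> complex" where "p \<equiv> bdry_point \<Omega>"

lemma interior_strict:
  assumes q: "\<forall>x\<in>closure \<Omega>. (x - q) \<bullet> cis \<theta> \<le> 0" and x: "x \<in> interior (closure \<Omega>)"
  shows "(x - q) \<bullet> cis \<theta> < 0"
proof -
  obtain e where e: "0 < e" "cball x e \<subseteq> closure \<Omega>"
    using x mem_interior_cball by blast
  have "x + e *\<^sub>R cis \<theta> \<in> cball x e" using e by (simp add: dist_norm)
  then have "(x + e *\<^sub>R cis \<theta> - q) \<bullet> cis \<theta> \<le> 0" using e q by blast
  moreover have "(x + e *\<^sub>R cis \<theta> - q) \<bullet> cis \<theta> = (x - q) \<bullet> cis \<theta> + e"
    by (simp add: inner_diff_left inner_add_left flip: power2_norm_eq_inner)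
  ultimately show ?thesis using e by simp
qed

lemma interior_subset_interior_closure: "interior \<Omega> \<subseteq> interior (closure \<Omega>)"
  by (intro interior_mono closure_subset)

lemma halfplane_closure:
  assumes "\<forall>x\<in>\<Omega>. (x - q) \<bullet> v \<le> 0" shows "\<forall>x\<in>closure \<Omega>. (x - q) \<bullet> v \<le> 0"
proof -
  have "closed {x. (x - q) \<bullet> v \<le> 0}" by (intro closed_Collect_le continuous_intros)
  then have "closure \<Omega> \<subseteq> {x. (x - q) \<bullet> v \<le> 0}" using assms by (intro closure_minimal) auto
  then show ?thesis by auto
qed

lemma support_exists:
  "\<exists>q. q \<in> frontier \<Omega> \<and> (\<forall>x\<in>closure \<Omega>. (x - q) \<bullet> cis \<theta> \<le> 0)"
proof -
  have "compact (closure \<Omega>)" using bounded_dom by simp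
  moreover have "closure \<Omega> \<noteq> {}" using z_in by auto
  moreover have "continuous_on (closure \<Omega>) (\<lambda>x. x \<bullet> cis \<theta>)" by (intro continuous_intros)
  ultimately obtain q where q: "q \<in> closure \<Omega>" "\<forall>x\<in>closure \<Omega>. x \<bullet> cis \<theta> \<le> q \<bullet> cis \<theta>"
    using continuous_attains_sup by blast
  then have le: "\<forall>x\<in>closure \<Omega>. (x - q) \<bullet> cis \<theta> \<le> 0" by (simp add: inner_diff_left)
  then have "q \<notin> interior \<Omega>" using interior_strict[OF le, of q] interior_subset_interior_closure by auto
  then show ?thesis using q le by (auto simp: frontier_def)
qed

lemma support_unique:
  assumes q: "q \<in> closure \<Omega>" "\<forall>x\<in>closure \<Omega>. (x - q) \<bullet> cis \<theta> \<le> 0"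
    and q': "q' \<in> closure \<Omega>" "\<forall>x\<in>closure \<Omega>. (x - q') \<bullet> cis \<theta> \<le> 0"
  shows "q = q'"
proof (rule ccontr)
  assume ne: "q \<noteq> q'"
  have "midpoint q q' \<in> open_segment q q'" using ne by simp
  then have "midpoint q q' \<in> interior \<Omega>" using strict q q' unfolding strictly_convex_def by blast
  then have "(midpoint q q' - q) \<bullet> cis \<theta> < 0"
    using interior_strict[OF q(2)] interior_subset_interior_closure by blast
  moreover have "(midpoint q q' - q) \<bullet> cis \<theta> = (1/2) * ((q' - q) \<bullet> cis \<theta>)"
    by (simp add: midpoint_def inner_complex_def algebra_simps)
  moreover have "(q' - q) \<bullet> cis \<theta> = 0"
    using q(2) q'(2) q(1) q'(1) by (smt (verit) inner_diff_left)
  ultimately show False by simp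
qed

lemma p_frontier: "p \<theta> \<in> frontier \<Omega>" and p_halfplane: "x \<in> closure \<Omega> \<Longrightarrow> (x - p \<theta>) \<bullet> cis \<theta> \<le> 0"
proof -
  obtain q where q: "q \<in> frontier \<Omega>" "\<forall>x\<in>closure \<Omega>. (x - q) \<bullet> cis \<theta> \<le> 0"
    using support_exists by blast
  have "p \<theta> \<in> frontier \<Omega> \<and> (\<forall>x\<in>\<Omega>. (x - p \<theta>) \<bullet> cis \<theta> \<le> 0)"
    unfolding bdry_point_def
  proof (rule theI)
    show "q \<in> frontier \<Omega> \<and> (\<forall>x\<in>\<Omega>. (x - q) \<bullet> cis \<theta> \<le> 0)" using q closure_subset by blast
    fix q' assume "q' \<in> frontier \<Omega> \<and> (\<forall>x\<in>\<Omega>. (x - q') \<bullet> cis \<theta> \<le> 0)"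
    then show "q' = q" using q support_unique[of q' \<theta> q] halfplane_closure by (auto simp: frontier_def)
  qed
  then show "p \<theta> \<in> frontier \<Omega>" "x \<in> closure \<Omega> \<Longrightarrow> (x - p \<theta>) \<bullet> cis \<theta> \<le> 0"
    using halfplane_closure by blast+
qed

lemma p_closure: "p \<theta> \<in> closure \<Omega>"
  using p_frontier by (auto simp: frontier_def)

lemma p_eqI:
  assumes "q \<in> closure \<Omega>" "\<And>x. x \<in> closure \<Omega> \<Longrightarrow> (x - q) \<bullet> cis \<theta> \<le> 0"
  shows "p \<theta> = q"
  using support_unique[of "p \<theta>" \<theta> q] p_closure p_halfplane assms by blast

lemma p_cong: "cis s = cis t \<Longrightarrow> p s = p t"
  by (simp add: bdry_point_def)

lemma p_periodic: "p (\<theta> + 2 * pi) = p \<theta>"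
  by (intro p_cong) (simp flip: cis_mult)

text \<open>The supporting points form a closed relation with values in a compact set.\<close>
lemma p_continuous: "continuous_on UNIV p"
proof (rule continuous_from_closed_graph[of "closure \<Omega>"])
  show "compact (closure \<Omega>)" using bounded_dom by simp
  show "p \<in> UNIV \<rightarrow> closure \<Omega>" using p_closure by auto
  have "(\<lambda>x. (x, p x)) ` UNIV = (UNIV \<times> closure \<Omega>) \<inter> (\<Inter>y\<in>closure \<Omega>. {w. (y - snd w) \<bullet> cis (fst w) \<le> 0})"
    (is "?L = ?R")
  proof
    show "?L \<subseteq> ?R" using p_closure p_halfplane by auto
    show "?R \<subseteq> ?L"
    proof
      fix w assume "w \<in> ?R"
      then have "p (fst w) = snd w" by (intro p_eqI) auto
      then show "w \<in> ?L" by (metis prod.collapse rangeI)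
    qed
  qed
  moreover have "closed ?R"
    by (intro closed_Int closed_Times closed_UNIV closed_closure closed_INT ballI closed_Collect_le continuous_intros)
  ultimately show "closed ((\<lambda>x. (x, p x)) ` UNIV)" by simp
qed

text \<open>The coordinates of the boundary point in the frame of its normal and tangent directions. The second
  is the derivative of the first.\<close>
definition supp :: "real \<Rightarrow> real" where "supp \<theta> = (p \<theta> - z) \<bullet> cis \<theta>"
definition supp' :: "real \<Rightarrow> real" where "supp' \<theta> = (p \<theta> - z) \<bullet> (\<i> * cis \<theta>)"

lemma supp_pos: "0 < supp \<theta>"
proof -
  have "z \<in> interior (closure \<Omega>)"
    using z_in open_dom interior_subset_interior_closure by (auto simp: interior_open)
  from interior_strict[OF _ this, of "p \<theta>" \<theta>] p_halfplane show ?thesis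
    by (auto simp: supp_def inner_diff_left)
qed

text \<open>Moving the point of tangency contributes only to second order: by the supporting property its
  contribution is bounded by the product of the displacements of the point and of the normal.\<close>
lemma supp_deriv: "(supp has_real_derivative supp' \<theta>) (at \<theta>)"
proof -
  define \<phi> where "\<phi> = (\<lambda>t. (p \<theta> - z) \<bullet> cis t)"
  define r where "r = (\<lambda>t. (p t - p \<theta>) \<bullet> cis t)"
  have d\<phi>: "(\<phi> has_real_derivative supp' \<theta>) (at \<theta>)"
    unfolding \<phi>_def supp'_def inner_complex_def
    by (auto intro!: derivative_eq_intros)
  have bnd: "\<bar>r t\<bar> \<le> norm (p t - p \<theta>) * (2 * \<bar>t - \<theta>\<bar>)" for t
  proof -
    have "0 \<le> r t" using p_halfplane[OF p_closure, of \<theta> t] by (simp add: r_def inner_diff_left)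
    moreover have "(p t - p \<theta>) \<bullet> cis \<theta> \<le> 0" by (rule p_halfplane[OF p_closure])
    ultimately have "\<bar>r t\<bar> \<le> (p t - p \<theta>) \<bullet> (cis t - cis \<theta>)" by (simp add: r_def inner_diff_right)
    also have "\<dots> \<le> norm (p t - p \<theta>) * norm (cis t - cis \<theta>)" by (rule norm_cauchy_schwarz)
    also have "\<dots> \<le> norm (p t - p \<theta>) * (2 * \<bar>t - \<theta>\<bar>)" by (intro mult_left_mono norm_cis_diff_le) auto
    finally show ?thesis .
  qed
  have "(r has_real_derivative 0) (at \<theta>)"
    unfolding has_field_derivative_iff
  proof (rule Lim_null_comparison)
    show "\<forall>\<^sub>F t in at \<theta>. norm ((r t - r \<theta>) / (t - \<theta>)) \<le> 2 * norm (p t - p \<theta>)"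
    proof (rule eventually_mono[OF eventually_neq_at_within[of \<theta>]])
      fix t assume "t \<noteq> \<theta>"
      then show "norm ((r t - r \<theta>) / (t - \<theta>)) \<le> 2 * norm (p t - p \<theta>)"
        using bnd[of t] by (simp add: r_def pos_divide_le_eq mult_ac)
    qed
    have "isCont p \<theta>" using p_continuous by (simp add: continuous_on_eq_continuous_at)
    then have "((\<lambda>t. 2 * norm (p t - p \<theta>)) \<longlongrightarrow> 2 * norm (p \<theta> - p \<theta>)) (at \<theta>)"
      unfolding isCont_def by (intro tendsto_intros)
    then show "((\<lambda>t. 2 * norm (p t - p \<theta>)) \<longlongrightarrow> 0) (at \<theta>)" by simp
  qed
  from DERIV_add[OF d\<phi> this] have "((\<lambda>t. \<phi> t + r t) has_real_derivative supp' \<theta>) (at \<theta>)" by simp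
  moreover have "(\<lambda>t. \<phi> t + r t) = supp" by (auto simp: \<phi>_def r_def supp_def inner_diff_left)
  ultimately show ?thesis by simp
qed

lemma supp'_continuous: "continuous_on UNIV supp'"
  unfolding supp'_def by (intro continuous_intros p_continuous)

lemma supp_periodic: "supp (\<theta> + 2 * pi) = supp \<theta>"
proof -
  have "cis (\<theta> + 2 * pi) = cis \<theta>" by (simp flip: cis_mult)
  then show ?thesis by (simp add: supp_def p_periodic)
qed

lemma p_decomp: "(p \<theta> - z) \<bullet> cis (\<theta> + d) = supp \<theta> * cos d + supp' \<theta> * sin d"
  by (simp add: supp_def supp'_def inner_complex_def cos_add sin_add algebra_simps)

lemma p_coord: "p \<theta> = z + (supp \<theta> + supp' \<theta> * \<i>) * cis \<theta>"
proof -
  have s: "cos \<theta> * cos \<theta> + sin \<theta> * sin \<theta> = 1" using sin_cos_squared_add3[of \<theta>] by simp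
  define u v where "u = Re (p \<theta> - z)" and "v = Im (p \<theta> - z)"
  have h: "supp \<theta> = u * cos \<theta> + v * sin \<theta>" "supp' \<theta> = v * cos \<theta> - u * sin \<theta>"
    by (simp_all add: supp_def supp'_def inner_complex_def u_def v_def)
  have "supp \<theta> * cos \<theta> - supp' \<theta> * sin \<theta> = u * (cos \<theta> * cos \<theta> + sin \<theta> * sin \<theta>)"
    "supp \<theta> * sin \<theta> + supp' \<theta> * cos \<theta> = v * (cos \<theta> * cos \<theta> + sin \<theta> * sin \<theta>)"
    unfolding h by (simp_all add: algebra_simps del: sin_cos_squared_add3)
  then have "u = supp \<theta> * cos \<theta> - supp' \<theta> * sin \<theta>" "v = supp \<theta> * sin \<theta> + supp' \<theta> * cos \<theta>"
    unfolding s by simp_all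
  then show ?thesis by (simp add: complex_eq_iff u_def v_def algebra_simps)
qed

text \<open>Here \<open>a\<close> and \<open>b\<close> are the two tangent lengths, with sign. Multiplied by \<open>sin d\<close> they measure how far each
  point of tangency lies inside the other supporting half-plane, so they are nonnegative.\<close>
lemma gen_fun_lengths:
  fixes \<theta> d :: real
  assumes d: "0 < d" "d < pi"
  defines "a \<equiv> (supp (\<theta> + d) - supp \<theta> * cos d) / sin d - supp' \<theta>"
    and "b \<equiv> supp' (\<theta> + d) - (supp (\<theta> + d) * cos d - supp \<theta>) / sin d"
  shows "gen_fun \<Omega> \<theta> (\<theta> + d) = a + b" "0 \<le> a" "0 \<le> b" "p \<theta> \<noteq> p (\<theta> + d) \<Longrightarrow> 0 < a"
proof -
  have s: "0 < sin d" using d sin_gt_zero by blast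
  have a: "a * sin d = (p (\<theta> + d) - p \<theta>) \<bullet> cis (\<theta> + d)"
  proof -
    have "(p (\<theta> + d) - p \<theta>) \<bullet> cis (\<theta> + d) = supp (\<theta> + d) - (p \<theta> - z) \<bullet> cis (\<theta> + d)"
      by (simp add: supp_def inner_diff_left)
    moreover have "a * sin d = supp (\<theta> + d) - supp \<theta> * cos d - supp' \<theta> * sin d"
      unfolding a_def by (subst left_diff_distrib) (use s in simp)
    ultimately show ?thesis by (simp add: p_decomp)
  qed
  have b: "b * sin d = (p \<theta> - p (\<theta> + d)) \<bullet> cis \<theta>"
  proof -
    have "(p \<theta> - p (\<theta> + d)) \<bullet> cis \<theta> = supp \<theta> - (p (\<theta> + d) - z) \<bullet> cis (\<theta> + d + (- d))"
      by (simp add: supp_def inner_diff_left)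
    moreover have "b * sin d = supp' (\<theta> + d) * sin d - (supp (\<theta> + d) * cos d - supp \<theta>)"
      unfolding b_def by (subst left_diff_distrib) (use s in simp)
    ultimately show ?thesis unfolding p_decomp by simp
  qed
  have "0 \<le> a * sin d" unfolding a using p_halfplane[OF p_closure, of \<theta> "\<theta> + d"] by (simp add: inner_diff_left)
  then show a0: "0 \<le> a" using s by (simp add: zero_le_mult_iff)
  have "0 \<le> b * sin d" unfolding b using p_halfplane[OF p_closure, of "\<theta> + d" \<theta>] by (simp add: inner_diff_left)
  then show b0: "0 \<le> b" using s by (simp add: zero_le_mult_iff)
  show "0 < a" if ne: "p \<theta> \<noteq> p (\<theta> + d)"
  proof (rule ccontr)
    assume "\<not> 0 < a"
    then have "a = 0" using a0 by simp
    then have eq: "(p (\<theta> + d) - p \<theta>) \<bullet> cis (\<theta> + d) = 0" using a by simp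
    have "p (\<theta> + d) = p \<theta>"
    proof (rule p_eqI[OF p_closure])
      fix x assume "x \<in> closure \<Omega>"
      from p_halfplane[OF this, of "\<theta> + d"] eq show "(x - p \<theta>) \<bullet> cis (\<theta> + d) \<le> 0"
        by (simp add: inner_diff_left)
    qed
    with ne show False by simp
  qed
  define M where "M = p \<theta> + (a * \<i>) * cis \<theta>"
  have M': "M = p (\<theta> + d) - (b * \<i>) * cis (\<theta> + d)"
  proof -
    define c0 where "c0 = (supp (\<theta> + d) - supp \<theta> * cos d) / sin d"
    define c1 where "c1 = (supp (\<theta> + d) * cos d - supp \<theta>) / sin d"
    have "M = z + (supp \<theta> + c0 * \<i>) * cis \<theta>"
      unfolding M_def p_coord[of \<theta>] a_def c0_def[symmetric] by (simp add: complex_eq_iff algebra_simps)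
    moreover have "p (\<theta> + d) - (b * \<i>) * cis (\<theta> + d) = z + (supp (\<theta> + d) + c1 * \<i>) * cis d * cis \<theta>"
    proof -
      have cc: "cis (\<theta> + d) = cis d * cis \<theta>" by (simp add: cis_mult add.commute)
      show ?thesis unfolding p_coord[of "\<theta> + d"] b_def c1_def[symmetric] cc by (simp add: algebra_simps)
    qed
    moreover have "(supp (\<theta> + d) + c1 * \<i>) * cis d = supp \<theta> + c0 * \<i>"
    proof -
      have c1: "c1 * sin d = supp (\<theta> + d) * cos d - supp \<theta>" and c0: "c0 * sin d = supp (\<theta> + d) - supp \<theta> * cos d"
        using s by (simp_all add: c0_def c1_def)
      have "supp (\<theta> + d) * cos d - c1 * sin d = supp \<theta>" using c1 by simp
      moreover have "supp (\<theta> + d) * sin d + c1 * cos d = c0"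
      proof -
        have "(supp (\<theta> + d) * sin d + c1 * cos d) * sin d = supp (\<theta> + d) * (sin d * sin d) + (c1 * sin d) * cos d"
          by (simp add: algebra_simps)
        also have "\<dots> = supp (\<theta> + d) * (cos d * cos d + sin d * sin d) - supp \<theta> * cos d"
          unfolding c1 by (simp add: algebra_simps del: sin_cos_squared_add3)
        also have "\<dots> = c0 * sin d" unfolding c0 by simp
        finally show ?thesis using s by simp
      qed
      ultimately show ?thesis by (simp add: complex_eq_iff)
    qed
    ultimately show ?thesis by simp
  qed
  have perp: "((c * \<i>) * cis t) \<bullet> cis t = 0" for c t :: real
    by (simp add: inner_complex_def)
  have "tangent_meet \<Omega> \<theta> (\<theta> + d) = M"
    unfolding tangent_meet_def
  proof (rule the_equality)
    have "M \<in> tangent_line \<Omega> \<theta>" by (simp add: tangent_line_def M_def perp)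
    moreover have "M \<in> tangent_line \<Omega> (\<theta> + d)"
      unfolding tangent_line_def M' using perp[of "- b" "\<theta> + d"] by simp
    ultimately show "M \<in> tangent_line \<Omega> \<theta> \<and> M \<in> tangent_line \<Omega> (\<theta> + d)" by simp
    fix M2 assume "M2 \<in> tangent_line \<Omega> \<theta> \<and> M2 \<in> tangent_line \<Omega> (\<theta> + d)"
    with \<open>M \<in> tangent_line \<Omega> \<theta>\<close> \<open>M \<in> tangent_line \<Omega> (\<theta> + d)\<close>
    have z0: "(M2 - M) \<bullet> cis \<theta> = 0" "(M2 - M) \<bullet> cis (\<theta> + d) = 0"
      by (simp_all add: tangent_line_def inner_diff_left)
    define u v where "u = Re (M2 - M)" and "v = Im (M2 - M)"
    have e1: "u * cos \<theta> + v * sin \<theta> = 0" using z0(1) by (simp add: inner_complex_def u_def v_def)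
    have "u * cos (\<theta> + d) + v * sin (\<theta> + d) = 0" using z0(2) by (simp add: inner_complex_def u_def v_def)
    then have "cos d * (u * cos \<theta> + v * sin \<theta>) + sin d * (v * cos \<theta> - u * sin \<theta>) = 0"
      by (simp add: cos_add sin_add algebra_simps)
    then have e2: "v * cos \<theta> - u * sin \<theta> = 0" using e1 s by simp
    have sc: "cos \<theta> * cos \<theta> + sin \<theta> * sin \<theta> = 1" using sin_cos_squared_add3[of \<theta>] by simp
    have "u * (cos \<theta> * cos \<theta> + sin \<theta> * sin \<theta>) = cos \<theta> * (u * cos \<theta> + v * sin \<theta>) - sin \<theta> * (v * cos \<theta> - u * sin \<theta>)"
      "v * (cos \<theta> * cos \<theta> + sin \<theta> * sin \<theta>) = sin \<theta> * (u * cos \<theta> + v * sin \<theta>) + cos \<theta> * (v * cos \<theta> - u * sin \<theta>)"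
      by (simp_all add: algebra_simps del: sin_cos_squared_add3)
    then have "u = 0" "v = 0" unfolding e1 e2 sc by simp_all
    then show "M2 = M" by (simp add: u_def v_def complex_eq_iff)
  qed
  moreover have "dist M (p \<theta>) = a" using a0 by (simp add: M_def dist_norm norm_mult)
  moreover have "dist M (p (\<theta> + d)) = b" using b0 by (simp add: M' dist_norm norm_mult)
  ultimately show "gen_fun \<Omega> \<theta> (\<theta> + d) = a + b" using d by (simp add: gen_fun_def)
qed

lemma gen_fun_eq:
  assumes "s \<le> t" "t < s + pi"
  shows "gen_fun \<Omega> s t = (supp s + supp t) * tan ((t - s) / 2) + supp' t - supp' s"
proof (cases "s = t")
  case True then show ?thesis by (simp add: gen_fun_def)
next
  case False
  define d where "d = t - s"
  have d: "0 < d" "d < pi" and t: "t = s + d" using False assms by (auto simp: d_def)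
  have sd: "0 < sin d" using d sin_gt_zero by blast
  have "tan (d / 2) = sin d / (cos d + 1)" using tan_half[of "d / 2"] by simp
  also have "\<dots> = (1 - cos d) / sin d"
  proof -
    have "-1 < cos d" using cos_monotone_0_pi[of d pi] d by simp
    moreover have "sin d * sin d = (1 - cos d) * (cos d + 1)"
      using sin_cos_squared_add3[of d] by (simp add: algebra_simps)
    ultimately show ?thesis using sd by (simp add: frac_eq_eq)
  qed
  finally have tan: "tan (d / 2) = (1 - cos d) / sin d" .
  have "s + d - s = d" by simp
  then show ?thesis unfolding t gen_fun_lengths(1)[OF d]
    by (simp only: tan) (simp add: algebra_simps add_divide_distrib diff_divide_distrib)
qed

lemma convex_dom: "convex \<Omega>"
  unfolding convex_contains_open_segment
  using strict closure_subset[of \<Omega>] interior_subset[of \<Omega>] unfolding strictly_convex_def by blast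

text \<open>Every boundary point of a convex set lies on a supporting line.\<close>
lemma frontier_is_p:
  assumes q: "q \<in> frontier \<Omega>"
  obtains \<theta> where "q = p \<theta>"
proof -
  have "q \<in> closure \<Omega>" "q \<notin> rel_interior \<Omega>"
    using q open_dom by (auto simp: frontier_def rel_interior_open interior_open)
  then obtain a where a: "a \<noteq> 0" "\<And>y. y \<in> closure \<Omega> \<Longrightarrow> a \<bullet> q \<le> a \<bullet> y"
    using supporting_hyperplane_relative_frontier[OF convex_dom] by blast
  have "cis (Arg (- a)) = sgn (- a)" using a by (simp add: cis_Arg)
  then have e: "cis (Arg (- a)) = - (inverse (norm a) *\<^sub>R a)" by (simp add: sgn_div_norm)
  have "p (Arg (- a)) = q"
  proof (rule p_eqI[OF \<open>q \<in> closure \<Omega>\<close>])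
    fix x assume "x \<in> closure \<Omega>"
    then have "0 \<le> a \<bullet> (x - q)" using a(2)[of x] by (simp add: inner_diff_right)
    then have "0 \<le> (x - q) \<bullet> a" by (simp only: inner_commute)
    then show "(x - q) \<bullet> cis (Arg (- a)) \<le> 0" unfolding e by simp
  qed
  then show ?thesis using that by blast
qed

text \<open>Such a support function has all its boundary points on the circle with centre \<open>z + w\<close> and radius \<open>r\<close>.
  The domain lies in the disk, and by connectedness of the disk, which contains no frontier point, it
  is the whole disk.\<close>
lemma disk_if_first_harmonic:
  assumes h: "\<And>s. supp s = r + w \<bullet> cis s"
  shows "0 < r \<and> \<Omega> = ball (z + w) r"
proof -
  have r: "0 < r" using supp_pos[of 0] supp_pos[of pi] by (simp add: h inner_complex_def)
  have h': "supp' s = w \<bullet> (\<i> * cis s)" for s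
  proof -
    have "((\<lambda>s. r + w \<bullet> cis s) has_real_derivative w \<bullet> (\<i> * cis s)) (at s)"
      unfolding inner_complex_def by (auto intro!: derivative_eq_intros)
    moreover have "(\<lambda>s. r + w \<bullet> cis s) = supp" using h by auto
    ultimately show ?thesis using supp_deriv DERIV_unique by metis
  qed
  have p: "p s = z + w + of_real r * cis s" for s
  proof -
    have "(w \<bullet> cis s + w \<bullet> (\<i> * cis s) * \<i>) * cis s = w"
    proof -
      have "cos s * cos s + sin s * sin s = 1" by simp
      moreover have "Re ((w \<bullet> cis s + w \<bullet> (\<i> * cis s) * \<i>) * cis s) = Re w * (cos s * cos s + sin s * sin s)"
        "Im ((w \<bullet> cis s + w \<bullet> (\<i> * cis s) * \<i>) * cis s) = Im w * (cos s * cos s + sin s * sin s)"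
        by (simp_all add: inner_complex_def algebra_simps del: sin_cos_squared_add3)
      ultimately show ?thesis by (simp only: complex_eq_iff mult_1_right)
    qed
    moreover have "p s = z + of_real r * cis s + (w \<bullet> cis s + w \<bullet> (\<i> * cis s) * \<i>) * cis s"
      unfolding p_coord[of s] h h' by (simp add: algebra_simps)
    ultimately show ?thesis by simp
  qed
  have sub: "\<Omega> \<subseteq> ball (z + w) r"
  proof -
    have "x \<in> cball (z + w) r" if x: "x \<in> \<Omega>" for x
    proof (cases "x = z + w")
      case True then show ?thesis using r by simp
    next
      case False
      define \<theta> where "\<theta> = Arg (x - (z + w))"
      have e: "x - (z + w) = of_real (norm (x - (z + w))) * cis \<theta>"
        using rcis_cmod_Arg[of "x - (z + w)"] by (simp add: \<theta>_def rcis_def)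
      have "x \<in> closure \<Omega>" using x closure_subset by blast
      then have "(x - p \<theta>) \<bullet> cis \<theta> \<le> 0" by (rule p_halfplane)
      moreover have "x - p \<theta> = (norm (x - (z + w)) - r) *\<^sub>R cis \<theta>"
        unfolding p using e by (simp add: scaleR_conv_of_real algebra_simps)
      ultimately have "norm (x - (z + w)) - r \<le> 0" by (simp add: dot_square_norm)
      then show ?thesis by (simp add: dist_norm norm_minus_commute)
    qed
    then have "\<Omega> \<subseteq> interior (cball (z + w) r)" using open_dom by (intro interior_maximal) auto
    then show ?thesis by simp
  qed
  moreover have "ball (z + w) r \<subseteq> \<Omega>"
  proof (rule ccontr)
    assume "\<not> ?thesis"
    then have "ball (z + w) r - \<Omega> \<noteq> {}" by auto
    moreover have "ball (z + w) r \<inter> \<Omega> \<noteq> {}" using sub z_in by auto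
    ultimately have "ball (z + w) r \<inter> frontier \<Omega> \<noteq> {}" by (intro connected_Int_frontier) auto
    then obtain q where q: "q \<in> ball (z + w) r" "q \<in> frontier \<Omega>" by auto
    obtain \<theta> where "q = p \<theta>" using frontier_is_p[OF q(2)] by blast
    then have "dist (z + w) q = r" using r by (simp add: p dist_norm norm_mult)
    then show False using q(1) by simp
  qed
  ultimately show ?thesis using r by auto
qed

end

section \<open>Mean action of a smooth domain\<close>

text \<open>A boundary point has a single normal direction. This excludes corners, where the tangent lengths
  would vanish for distinct normal angles, and thereby yields the twist condition.\<close>
locale smooth_domain = convex_domain +
  assumes smooth: "p s = p t \<Longrightarrow> cis s = cis t"
begin

sublocale support_data supp supp'
proof
  fix x y :: real assume xy: "x < y" "y < x + pi"
  define d where "d = y - x"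
  have d: "0 < d" "d < pi" and y: "y = x + d" using xy by (auto simp: d_def)
  have "p x \<noteq> p (x + d)"
  proof
    assume "p x = p (x + d)"
    then have "cis d = 1" using smooth[of x "x + d"] by (simp flip: cis_mult)
    then have "sin d = 0" by (simp add: complex_eq_iff)
    then show False using sin_gt_zero[OF d] by simp
  qed
  then have "0 < gen_fun \<Omega> x y" unfolding y using gen_fun_lengths[OF d, of x] by simp
  then show "0 < (supp x + supp y) * tan ((y - x) / 2) + supp' y - supp' x"
    using gen_fun_eq[of x y] xy by simp
qed (rule supp_pos supp_periodic supp_deriv supp'_continuous)+

lemma action_eq_gen_action:
  assumes "admissible_segment m n x" "m \<le> n"
  shows "action \<Omega> m n x = gen_action m n x + (supp' (x n) - supp' (x m))"
proof -
  have "action \<Omega> m n x = (\<Sum>i\<in>{m..<n}. gen (x i) (x (i + 1)) + (supp' (x (i + 1)) - supp' (x i)))"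
    unfolding action_def
  proof (rule sum.cong)
    fix i assume "i \<in> {m..<n}"
    then have "x i \<le> x (i + 1)" "x (i + 1) < x i + pi" using assms by (auto simp: admissible_segment_def algebra_simps)
    then show "gen_fun \<Omega> (x i) (x (i + 1)) = gen (x i) (x (i + 1)) + (supp' (x (i + 1)) - supp' (x i))"
      by (simp add: gen_fun_eq gen_def half_tan_def)
  qed simp
  also have "\<dots> = gen_action m n x + (supp' (x n) - supp' (x m))"
    using sum_telescope_int[OF assms(2), of "\<lambda>i. supp' (x i)"] by (simp add: sum.distrib gen_action_def)
  finally show ?thesis .
qed

lemma action_minimizing_iff_minimizing: "action_minimizing \<Omega> x \<longleftrightarrow> minimizing x"
proof -
  have "action \<Omega> m n x \<le> action \<Omega> m n \<phi> \<longleftrightarrow> gen_action m n x \<le> gen_action m n \<phi>"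
    if "admissible x" "m < n" "admissible_segment m n \<phi>" "\<phi> m = x m" "\<phi> n = x n" for m n \<phi>
    using that by (simp add: action_eq_gen_action admissible_imp_segment)
  then show ?thesis unfolding action_minimizing_def minimizing_def by blast
qed

text \<open>The telescoping term is bounded, hence invisible in the mean.\<close>
lemma mean_limit_iff:
  assumes "admissible x"
  shows "(\<lambda>N. action \<Omega> (- int N) (int N) x / (2 * real N)) \<longlonglongrightarrow> b \<longleftrightarrow>
    mean_gen x \<longlonglongrightarrow> b"
proof -
  obtain B where B: "\<And>w. w \<in> closure \<Omega> \<Longrightarrow> norm w \<le> B"
    using bounded_closure[OF bounded_dom] by (auto simp: bounded_iff)
  have hb: "\<bar>supp' s\<bar> \<le> B + norm z" for s
  proof -
    have "\<bar>supp' s\<bar> \<le> norm (p s - z) * norm (\<i> * cis s)" unfolding supp'_def by (rule Cauchy_Schwarz_ineq2)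
    also have "\<dots> \<le> B + norm z" using norm_triangle_ineq4[of "p s" z] B[OF p_closure, of s] by (simp add: norm_mult)
    finally show ?thesis .
  qed
  have "(\<lambda>N. (supp' (x (int N)) - supp' (x (- int N))) / (2 * real N)) \<longlonglongrightarrow> 0"
  proof (rule Lim_null_comparison)
    show "\<forall>\<^sub>F N in sequentially. norm ((supp' (x (int N)) - supp' (x (- int N))) / (2 * real N)) \<le> (B + norm z) / real N"
    proof (rule always_eventually, rule allI)
      fix N :: nat
      have "\<bar>supp' (x (int N)) - supp' (x (- int N))\<bar> \<le> (B + norm z) + (B + norm z)"
        by (rule order_trans[OF abs_triangle_ineq4 add_mono[OF hb hb]])
      then have "\<bar>supp' (x (int N)) - supp' (x (- int N))\<bar> / (2 * real N) \<le> (2 * (B + norm z)) / (2 * real N)"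
        by (intro divide_right_mono) (simp_all only: mult_2 of_nat_0_le_iff mult_nonneg_nonneg zero_le_numeral)
      then show "norm ((supp' (x (int N)) - supp' (x (- int N))) / (2 * real N)) \<le> (B + norm z) / real N"
        unfolding mult_divide_mult_cancel_left_if by simp
    qed
    show "(\<lambda>N. (B + norm z) / real N) \<longlonglongrightarrow> 0" by (rule lim_const_over_n)
  qed
  moreover have "action \<Omega> (- int N) (int N) x / (2 * real N) =
      gen_action (- int N) (int N) x / (2 * real N) + (supp' (x (int N)) - supp' (x (- int N))) / (2 * real N)" for N
    using assms by (simp add: action_eq_gen_action admissible_imp_segment add_divide_distrib)
  ultimately show ?thesis
    using tendsto_add[of "\<lambda>N. gen_action (- int N) (int N) x / (2 * real N)" b sequentially]
      tendsto_diff[of "\<lambda>N. action \<Omega> (- int N) (int N) x / (2 * real N)" b sequentially] by fastforce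
qed

text \<open>Existence and uniqueness of the common mean value, so that the definite description denotes it.\<close>
theorem mean_action_attained:
  assumes \<rho>: "0 < \<rho>" "\<rho> < 1/2"
  obtains x where "minimizing x" "\<And>i. \<bar>x i - 2 * pi * \<rho> * of_int i\<bar> \<le> 4 * pi"
    "mean_gen x \<longlonglongrightarrow> mean_action \<Omega> \<rho>"
proof -
  obtain x where x: "minimizing x" "\<And>i. \<bar>x i - 2 * pi * \<rho> * of_int i\<bar> \<le> 4 * pi"
    using minimizing_exists[OF \<rho>] by blast
  obtain b where b: "mean_gen x \<longlonglongrightarrow> b"
    using mean_converges[OF \<rho> x] by blast
  have rot: "has_rotation_number x \<rho>" by (rule bounded_deviation_rotation[OF x(2)])
  have adm: "admissible y" if "minimizing y" for y using that by (simp add: minimizing_def)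
  have "mean_action \<Omega> \<rho> = b"
    unfolding mean_action_def
  proof (rule the_equality)
    show "\<exists>\<theta>. action_minimizing \<Omega> \<theta> \<and> has_rotation_number \<theta> \<rho> \<and>
        (\<lambda>N. action \<Omega> (- int N) (int N) \<theta> / (2 * real N)) \<longlonglongrightarrow> b"
      using x rot b mean_limit_iff[OF adm[OF x(1)]] action_minimizing_iff_minimizing by blast
    fix b' assume "\<exists>\<theta>. action_minimizing \<Omega> \<theta> \<and> has_rotation_number \<theta> \<rho> \<and>
        (\<lambda>N. action \<Omega> (- int N) (int N) \<theta> / (2 * real N)) \<longlonglongrightarrow> b'"
    then obtain y where y: "minimizing y" "has_rotation_number y \<rho>"
      "mean_gen y \<longlonglongrightarrow> b'"
      using action_minimizing_iff_minimizing mean_limit_iff adm by blast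
    show "b' = b"
      using mean_le[OF \<rho> x(1) adm[OF y(1)] rot y(2) b y(3)] mean_le[OF \<rho> y(1) adm[OF x(1)] y(2) rot y(3) b] by simp
  qed
  then show ?thesis using that x b by simp
qed

theorem mean_action_le:
  assumes \<rho>: "0 < \<rho>" "\<rho> < 1/2"
  shows "2 * pi * mean_action \<Omega> \<rho> \<le> 2 * tan (pi * \<rho>) * integral {0..2*pi} supp" and "0 \<le> mean_action \<Omega> \<rho>"
proof -
  obtain x where x: "minimizing x" "\<And>i. \<bar>x i - 2 * pi * \<rho> * of_int i\<bar> \<le> 4 * pi"
    "mean_gen x \<longlonglongrightarrow> mean_action \<Omega> \<rho>"
    using mean_action_attained[OF \<rho>] by blast
  have r: "2 * pi * \<rho> < pi" using \<rho> mult_strict_left_mono[OF \<rho>(2), of "2 * pi"] by simp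
  have "2 * pi * mean_action \<Omega> \<rho> \<le> integral {0..2*pi} (\<lambda>s. gen s (s + 2 * pi * \<rho>))"
    by (rule mean_le_integral[OF \<rho> x, where f = "\<lambda>s. s" and c = 0]) (use \<rho> r in \<open>auto intro!: continuous_intros\<close>)
  then show "2 * pi * mean_action \<Omega> \<rho> \<le> 2 * tan (pi * \<rho>) * integral {0..2*pi} supp"
    using integral_gen_rotation[of "2 * pi * \<rho>"] by simp
  show "0 \<le> mean_action \<Omega> \<rho>"
  proof (rule LIMSEQ_le_const[OF x(3)], intro exI allI impI)
    fix N :: nat
    have "0 \<le> gen_action (- int N) (int N) x" using x(1) by (intro gen_action_nonneg admissible_imp_segment) (simp add: minimizing_def)
    then show "0 \<le> gen_action (- int N) (int N) x / (2 * real N)" by simp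
  qed
qed

theorem mean_action_equality:
  assumes \<rho>: "0 < \<rho>" "\<rho> < 1/2"
    and eq: "2 * pi * mean_action \<Omega> \<rho> = 2 * tan (pi * \<rho>) * integral {0..2*pi} supp"
  shows "\<exists>r w. \<forall>s. supp s = r + w \<bullet> cis s"
proof -
  obtain x where x: "minimizing x" "\<And>i. \<bar>x i - 2 * pi * \<rho> * of_int i\<bar> \<le> 4 * pi"
    "mean_gen x \<longlonglongrightarrow> mean_action \<Omega> \<rho>"
    using mean_action_attained[OF \<rho>] by blast
  show ?thesis by (rule equality_first_harmonic[OF \<rho> x eq])
qed

lemma mather_beta_zero: "mather_beta \<Omega> 0 = 0"
proof -
  have ev: "\<forall>\<^sub>F \<rho> in at_right 0. 0 < \<rho> \<and> \<rho> < (1/2::real)"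
    by (intro eventually_conj eventually_at_right_less eventually_at_rightI[of 0 "1/2"]) auto
  have "(mean_action \<Omega> \<longlongrightarrow> 0) (at_right 0)"
  proof (rule tendsto_sandwich)
    show "\<forall>\<^sub>F \<rho> in at_right 0. 0 \<le> mean_action \<Omega> \<rho>" using ev by eventually_elim (simp add: mean_action_le)
    show "\<forall>\<^sub>F \<rho> in at_right 0. mean_action \<Omega> \<rho> \<le> tan (pi * \<rho>) * integral {0..2*pi} supp / pi"
      using ev
    proof eventually_elim
      case (elim \<rho>)
      then show ?case using mean_action_le(1)[of \<rho>] by (simp add: pos_le_divide_eq mult.commute)
    qed
    have "isCont (\<lambda>\<rho>. tan (pi * \<rho>) * integral {0..2*pi} supp / pi) 0"
      by (intro continuous_intros isCont_tan') auto
    then have "((\<lambda>\<rho>. tan (pi * \<rho>) * integral {0..2*pi} supp / pi) \<longlongrightarrow> 0) (at 0)"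
      by (simp add: isCont_def)
    then show "((\<lambda>\<rho>. tan (pi * \<rho>) * integral {0..2*pi} supp / pi) \<longlongrightarrow> 0) (at_right 0)"
      by (rule filterlim_mono) (simp_all add: at_within_le_at)
  qed simp
  then show ?thesis unfolding mather_beta_def by (simp add: tendsto_Lim)
qed

end

section \<open>Perimeter as the integral of the support function\<close>

locale curve_domain = convex_domain +
  fixes c :: "real \<Rightarrow> complex"
  assumes C2: "C2_closed_curve c" and range_c: "range c = frontier \<Omega>" and curv: "curvature c t > 0"
begin

definition vel where "vel t = vector_derivative c (at t)"
definition acc where "acc t = vector_derivative vel (at t)"

lemma vel_eq: "vel = (\<lambda>t. vector_derivative c (at t))" by (auto simp: vel_def)

lemma deriv_c: "(c has_vector_derivative vel t) (at t)"
  and deriv_vel: "(vel has_vector_derivative acc t) (at t)"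
  and cont_vel: "continuous_on A vel" and cont_acc: "continuous_on A acc"
  and vel_nz: "vel t \<noteq> 0" and c_per: "c (t + 1) = c t" and c_inj: "inj_on c {0..<1}"
proof -
  note C = C2[unfolded C2_closed_curve_def, folded vel_eq vel_def]
  have C1: "c C1_differentiable_on UNIV" "vel C1_differentiable_on UNIV" using C by auto
  from C1(1)[unfolded C1_differentiable_on_eq] show "(c has_vector_derivative vel t) (at t)"
    by (simp add: vel_def vector_derivative_works)
  from C1(2)[unfolded C1_differentiable_on_eq] show "(vel has_vector_derivative acc t) (at t)"
    by (simp add: acc_def vector_derivative_works)
  have "continuous_on UNIV vel" "continuous_on UNIV acc"
    using C1[unfolded C1_differentiable_on_eq] by (auto simp: vel_def[abs_def] acc_def[abs_def])
  then show "continuous_on A vel" "continuous_on A acc" using continuous_on_subset by blast+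
  show "vel t \<noteq> 0" "c (t + 1) = c t" "inj_on c {0..<1}" using C by auto
qed

lemma vel_per: "vel (t + 1) = vel t"
proof -
  have "((c \<circ> (\<lambda>s. s + 1)) has_vector_derivative 1 *\<^sub>R vel (t + 1)) (at t)"
    by (rule vector_diff_chain_at) (auto intro!: derivative_eq_intros deriv_c)
  moreover have "c \<circ> (\<lambda>s. s + 1) = c" by (auto simp: c_per)
  ultimately have "(c has_vector_derivative vel (t + 1)) (at t)" by simp
  then show ?thesis using deriv_c vector_derivative_unique_at by blast
qed

definition vx where "vx t = Re (vel t)"
definition vy where "vy t = Im (vel t)"
definition ax where "ax t = Re (acc t)"
definition ay where "ay t = Im (acc t)"
definition speed where "speed t = norm (vel t)"
text \<open>The angular velocity of the tangent direction.\<close>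
definition turning where "turning t = (vx t * ay t - vy t * ax t) / (speed t)\<^sup>2"

lemma speed_pos: "0 < speed t" and speed_sq: "(speed t)\<^sup>2 = (vx t)\<^sup>2 + (vy t)\<^sup>2"
  using vel_nz by (simp_all add: speed_def vx_def vy_def cmod_power2)

lemma deriv_vx: "(vx has_real_derivative ax t) (at t)" and deriv_vy: "(vy has_real_derivative ay t) (at t)"
  unfolding vx_def[abs_def] vy_def[abs_def] ax_def ay_def
  by (rule has_vector_derivative_Re_Im[OF deriv_vel])+

lemma det_pos: "0 < vx t * ay t - vy t * ax t" and turning_pos: "0 < turning t"
proof -
  have "curvature c t = (vx t * ay t - vy t * ax t) / speed t ^ 3"
    by (simp add: curvature_def Let_def vx_def vy_def ax_def ay_def speed_def vel_def[abs_def] acc_def)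
  then show "0 < vx t * ay t - vy t * ax t" using curv[of t] speed_pos[of t] by (simp add: zero_less_divide_iff)
  then show "0 < turning t" using speed_pos[of t] by (simp add: turning_def)
qed

lemma cont_turning: "continuous_on A turning"
  unfolding turning_def[abs_def] vx_def[abs_def] vy_def[abs_def] ax_def ay_def speed_def[abs_def]
  by (intro continuous_intros cont_vel cont_acc) (use vel_nz in auto)

text \<open>The distance to a supporting line has a maximum along the curve, so the first derivative makes the
  normal orthogonal to the velocity and the second derivative, together with positive curvature,
  decides its sign.\<close>
lemma normal_unique:
  assumes eq: "c t = p \<phi>"
  shows "cis \<phi> = - \<i> * vel t / of_real (speed t)"
proof -
  define f where "f = (\<lambda>s. (c s - c t) \<bullet> cis \<phi>)"
  define f1 where "f1 = (\<lambda>s. vx s * cos \<phi> + vy s * sin \<phi>)"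
  have f: "(f has_real_derivative f1 s) (at s)" for s
  proof -
    have "((\<lambda>s. Re (c s)) has_real_derivative vx s) (at s)" "((\<lambda>s. Im (c s)) has_real_derivative vy s) (at s)"
      unfolding vx_def vy_def by (rule has_vector_derivative_Re_Im[OF deriv_c])+
    from DERIV_add[OF DERIV_cmult_right[OF DERIV_diff[OF this(1) DERIV_const[of "Re (c t)"]], of "cos \<phi>"]
        DERIV_cmult_right[OF DERIV_diff[OF this(2) DERIV_const[of "Im (c t)"]], of "sin \<phi>"]]
    show ?thesis unfolding f_def f1_def inner_complex_def by simp
  qed
  have f1: "(f1 has_real_derivative ax t * cos \<phi> + ay t * sin \<phi>) (at t)"
    unfolding f1_def by (auto intro!: derivative_eq_intros deriv_vx deriv_vy)
  have max: "f s \<le> 0" for s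
  proof -
    have "c s \<in> closure \<Omega>" using range_c by (auto simp: frontier_def)
    then show ?thesis unfolding f_def eq by (rule p_halfplane)
  qed
  have ft: "f t = 0" by (simp add: f_def)
  have z: "f1 t = 0" using DERIV_local_max[OF f[of t], where d = 1] max ft by auto
  have neg: "ax t * cos \<phi> + ay t * sin \<phi> \<le> 0"
  proof (rule ccontr)
    assume "\<not> ?thesis"
    then obtain d where d: "0 < d" "\<And>e. 0 < e \<Longrightarrow> e < d \<Longrightarrow> f1 t < f1 (t + e)"
      using DERIV_pos_inc_right[OF f1] by (meson not_le)
    have "f t < f (t + d / 2)"
    proof (rule DERIV_pos_imp_increasing_open[where f = f and a = t and b = "t + d / 2"])
      fix s assume "t < s" "s < t + d / 2"
      then have "0 < f1 s" using d(2)[of "s - t"] z by simp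
      then show "\<exists>y. (f has_real_derivative y) (at s) \<and> 0 < y" using f by blast
    next
      show "continuous_on {t..t + d / 2} f" using f by (intro continuous_at_imp_continuous_on ballI DERIV_isCont) auto
    qed (use d in simp)
    then show False using max[of "t + d / 2"] ft by simp
  qed
  define w where "w = vy t * cos \<phi> - vx t * sin \<phi>"
  have sc: "cos \<phi> * cos \<phi> + sin \<phi> * sin \<phi> = 1" by simp
  have z': "vx t * cos \<phi> + vy t * sin \<phi> = 0" using z by (simp add: f1_def)
  have "vy t * (cos \<phi> * cos \<phi> + sin \<phi> * sin \<phi>) = w * cos \<phi> + sin \<phi> * (vx t * cos \<phi> + vy t * sin \<phi>)"
    "vx t * (cos \<phi> * cos \<phi> + sin \<phi> * sin \<phi>) = - w * sin \<phi> + cos \<phi> * (vx t * cos \<phi> + vy t * sin \<phi>)"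
    unfolding w_def by (simp_all add: algebra_simps del: sin_cos_squared_add3)
  then have ab: "vy t = w * cos \<phi>" "vx t = - w * sin \<phi>" unfolding sc z' by simp_all
  have "(ax t * cos \<phi> + ay t * sin \<phi>) * w = - (vx t * ay t - vy t * ax t)" unfolding ab by (simp add: algebra_simps)
  then have "(ax t * cos \<phi> + ay t * sin \<phi>) * w < 0" using det_pos[of t] by simp
  then have w: "0 < w" using neg by (simp add: mult_less_0_iff)
  have "(speed t)\<^sup>2 = w\<^sup>2 * (cos \<phi> * cos \<phi> + sin \<phi> * sin \<phi>)" unfolding speed_sq ab
    by (simp add: algebra_simps power2_eq_square del: sin_cos_squared_add3)
  then have "(speed t)\<^sup>2 = w\<^sup>2" by simp
  then have "speed t = w" using w speed_pos[of t] by (simp add: power2_eq_iff_nonneg)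
  moreover have "- \<i> * vel t = of_real w * cis \<phi>"
    using ab by (simp add: complex_eq_iff vx_def vy_def)
  ultimately show ?thesis using w by simp
qed

lemma smooth_p: "p s = p t \<Longrightarrow> cis s = cis t"
proof -
  assume eq: "p s = p t"
  have "p s \<in> range c" using p_frontier range_c by simp
  then obtain \<tau> where "p s = c \<tau>" by blast
  then show ?thesis using normal_unique[of \<tau> s] normal_unique[of \<tau> t] eq by simp
qed

sublocale smooth_domain by unfold_locales (rule smooth_p)

text \<open>A lift of the normal angle along the curve, as the integral of the angular velocity. In the frame
  rotating with this angle the velocity keeps its direction: the quotient of the squared transversal
  component by the squared speed has derivative zero and vanishes initially.\<close>
lemma normal_angle:
  obtains \<psi> where "\<And>t. t \<in> {-1<..<2} \<Longrightarrow> (\<psi> has_real_derivative turning t) (at t)"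
    "\<And>t. t \<in> {0..1} \<Longrightarrow> vel t = of_real (speed t) * (\<i> * cis (\<psi> t))"
    "\<And>t. t \<in> {0..1} \<Longrightarrow> c t = p (\<psi> t)"
proof -
  define \<Theta> where "\<Theta> = (\<lambda>t. integral {-1..t} turning - integral {-1..0} turning + Arg (vel 0))"
  have d\<Theta>: "(\<Theta> has_real_derivative turning t) (at t)" if "t \<in> {-1<..<2}" for t
  proof -
    have "((\<lambda>t. integral {-1..t} turning) has_real_derivative turning t) (at t within {-1..2})"
      using that by (intro integral_has_real_derivative cont_turning) auto
    then have "((\<lambda>t. integral {-1..t} turning) has_real_derivative turning t) (at t)"
      using that by (simp add: at_within_Icc_at)
    then show ?thesis unfolding \<Theta>_def by (auto intro!: derivative_eq_intros)
  qed
  define x where "x = (\<lambda>t. vx t * cos (\<Theta> t) + vy t * sin (\<Theta> t))"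
  define y where "y = (\<lambda>t. vy t * cos (\<Theta> t) - vx t * sin (\<Theta> t))"
  define Q where "Q = (\<lambda>t. (y t)\<^sup>2 / ((vx t)\<^sup>2 + (vy t)\<^sup>2))"
  have nz: "(vx t)\<^sup>2 + (vy t)\<^sup>2 \<noteq> 0" for t using zero_less_power[OF speed_pos[of t], of 2] unfolding speed_sq by linarith
  have xy: "(x t)\<^sup>2 + (y t)\<^sup>2 = (vx t)\<^sup>2 + (vy t)\<^sup>2" for t
  proof -
    have "(x t)\<^sup>2 + (y t)\<^sup>2 = ((vx t)\<^sup>2 + (vy t)\<^sup>2) * (cos (\<Theta> t) * cos (\<Theta> t) + sin (\<Theta> t) * sin (\<Theta> t))"
      unfolding x_def y_def by (simp add: algebra_simps power2_eq_square del: sin_cos_squared_add3)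
    then show ?thesis by simp
  qed
  have 0: "x 0 = speed 0" "y 0 = 0"
  proof -
    have e: "vel 0 = of_real (speed 0) * cis (Arg (vel 0))" unfolding speed_def
      using rcis_cmod_Arg[of "vel 0"] by (simp add: rcis_def)
    have ab: "vx 0 = speed 0 * cos (Arg (vel 0))" "vy 0 = speed 0 * sin (Arg (vel 0))"
      unfolding vx_def vy_def by (subst e, simp)+
    have "x 0 = speed 0 * (cos (Arg (vel 0)) * cos (Arg (vel 0)) + sin (Arg (vel 0)) * sin (Arg (vel 0)))"
      unfolding x_def ab by (simp add: \<Theta>_def algebra_simps del: sin_cos_squared_add3)
    then show "x 0 = speed 0" by simp
    show "y 0 = 0" unfolding y_def ab by (simp add: \<Theta>_def)
  qed
  have dQ: "(Q has_real_derivative 0) (at t)" if t: "t \<in> {-1<..<2}" for t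
  proof -
    let ?y' = "ay t * cos (\<Theta> t) - vy t * sin (\<Theta> t) * turning t - (ax t * sin (\<Theta> t) + vx t * cos (\<Theta> t) * turning t)"
    have dy: "(y has_real_derivative ?y') (at t)"
      unfolding y_def by (rule derivative_eq_intros deriv_vx deriv_vy d\<Theta>[OF t] refl | simp)+
    have y': "?y' * ((vx t)\<^sup>2 + (vy t)\<^sup>2) = (vx t * ax t + vy t * ay t) * y t"
    proof -
      have gg: "turning t * ((vx t)\<^sup>2 + (vy t)\<^sup>2) = vx t * ay t - vy t * ax t" using nz[of t] by (simp add: turning_def speed_sq)
      have "?y' * ((vx t)\<^sup>2 + (vy t)\<^sup>2) = (ay t * cos (\<Theta> t) - ax t * sin (\<Theta> t)) * ((vx t)\<^sup>2 + (vy t)\<^sup>2)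
        - (vy t * sin (\<Theta> t) + vx t * cos (\<Theta> t)) * (turning t * ((vx t)\<^sup>2 + (vy t)\<^sup>2))" by (simp add: algebra_simps)
      also have "\<dots> = (vx t * ax t + vy t * ay t) * y t"
        unfolding gg y_def by (simp add: algebra_simps power2_eq_square)
      finally show ?thesis .
    qed
    have "(Q has_real_derivative ((2 * y t * ?y') * ((vx t)\<^sup>2 + (vy t)\<^sup>2) - (y t)\<^sup>2 * (2 * vx t * ax t + 2 * vy t * ay t))
        / (((vx t)\<^sup>2 + (vy t)\<^sup>2) * ((vx t)\<^sup>2 + (vy t)\<^sup>2))) (at t)"
      unfolding Q_def by (rule derivative_eq_intros deriv_vx deriv_vy dy refl nz | simp)+
    moreover have "(2 * y t * ?y') * ((vx t)\<^sup>2 + (vy t)\<^sup>2) - (y t)\<^sup>2 * (2 * vx t * ax t + 2 * vy t * ay t)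
       = 2 * y t * (?y' * ((vx t)\<^sup>2 + (vy t)\<^sup>2) - (vx t * ax t + vy t * ay t) * y t)"
      by (simp add: algebra_simps power2_eq_square)
    ultimately show ?thesis unfolding y' by simp
  qed
  have y0: "y t = 0" if t: "t \<in> {-1<..<2}" for t
  proof -
    have "Q t = Q 0" by (rule DERIV_isconst3[of "-1" 2]) (use t dQ in auto)
    then show ?thesis using 0 nz[of t] by (auto simp: Q_def)
  qed
  have xL: "x t = speed t" if t: "t \<in> {0..1}" for t
  proof -
    have sq: "(x s)\<^sup>2 = (speed s)\<^sup>2" if "s \<in> {0..1}" for s using xy[of s] y0[of s] that speed_sq[of s] by simp
    have nzx: "x s \<noteq> 0" if "s \<in> {0..1}" for s using sq[OF that] speed_pos[of s] by auto
    have cx: "isCont x s" if "s \<in> {0..1}" for s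
    proof -
      have "isCont \<Theta> s" "isCont vx s" "isCont vy s"
        using that by (auto intro!: DERIV_isCont[OF d\<Theta>] DERIV_isCont[OF deriv_vx] DERIV_isCont[OF deriv_vy])
      then show ?thesis unfolding x_def by (intro continuous_intros)
    qed
    have "0 < x t"
    proof (rule ccontr)
      assume "\<not> 0 < x t"
      then have "\<exists>s. 0 \<le> s \<and> s \<le> t \<and> x s = 0"
        using 0(1) speed_pos[of 0] t by (intro IVT2) (auto intro!: cx)
      then show False using nzx t by auto
    qed
    then show ?thesis using sq[OF t] speed_pos[of t] by (simp add: power2_eq_iff_nonneg)
  qed
  define \<psi> where "\<psi> = (\<lambda>t. \<Theta> t - pi / 2)"
  have tang: "vel t = of_real (speed t) * (\<i> * cis (\<psi> t))" if t: "t \<in> {0..1}" for t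
  proof -
    have x: "vx t * cos (\<Theta> t) + vy t * sin (\<Theta> t) = speed t" using xL[OF t] by (simp add: x_def)
    have y: "vy t * cos (\<Theta> t) - vx t * sin (\<Theta> t) = 0" using y0[of t] t by (simp add: y_def)
    have "vx t * (cos (\<Theta> t) * cos (\<Theta> t) + sin (\<Theta> t) * sin (\<Theta> t)) = cos (\<Theta> t) * (vx t * cos (\<Theta> t) + vy t * sin (\<Theta> t)) - sin (\<Theta> t) * (vy t * cos (\<Theta> t) - vx t * sin (\<Theta> t))"
      "vy t * (cos (\<Theta> t) * cos (\<Theta> t) + sin (\<Theta> t) * sin (\<Theta> t)) = sin (\<Theta> t) * (vx t * cos (\<Theta> t) + vy t * sin (\<Theta> t)) + cos (\<Theta> t) * (vy t * cos (\<Theta> t) - vx t * sin (\<Theta> t))"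
      by (simp_all add: algebra_simps del: sin_cos_squared_add3)
    then have "vx t = cos (\<Theta> t) * speed t" "vy t = sin (\<Theta> t) * speed t" unfolding x y by simp_all
    moreover have "\<i> * cis (\<psi> t) = cis (\<Theta> t)" by (simp add: \<psi>_def complex_eq_iff cos_diff sin_diff)
    ultimately show ?thesis by (simp add: complex_eq_iff vx_def vy_def)
  qed
  show ?thesis
  proof (rule that[of \<psi>])
    show "(\<psi> has_real_derivative turning t) (at t)" if "t \<in> {-1<..<2}" for t
      unfolding \<psi>_def using d\<Theta>[OF that] by (auto intro!: derivative_eq_intros)
    show "vel t = of_real (speed t) * (\<i> * cis (\<psi> t))" if "t \<in> {0..1}" for t by (rule tang[OF that])
    show "c t = p (\<psi> t)" if t: "t \<in> {0..1}" for t
    proof -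
      have "c t \<in> frontier \<Omega>" using range_c by auto
      then obtain \<phi> where \<phi>: "c t = p \<phi>" using frontier_is_p by blast
      have "cis \<phi> = cis (\<psi> t)" using normal_unique[OF \<phi>] speed_pos[of t] by (simp add: tang[OF t])
      then show ?thesis unfolding \<phi> by (rule p_cong)
    qed
  qed
qed

text \<open>Cauchy's formula. If \<open>\<psi>\<close> is the normal angle and \<open>H\<close> a primitive of the support function, then
  \<open>H(\<psi>(t)) + (c(t) - z) \<bullet> (\<i> cis \<psi>(t))\<close> has derivative \<open>speed t\<close>, and its second term is periodic. The angle
  increases by exactly \<open>2 \<pi>\<close>: if it went round twice, the curve would pass through its initial point
  at an intermediate time.\<close>
theorem curve_length_eq: "closed_curve_length c = integral {0..2*pi} supp"
proof -
  obtain \<psi> where d\<psi>: "\<And>t. t \<in> {-1<..<2} \<Longrightarrow> (\<psi> has_real_derivative turning t) (at t)"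
    and tang: "\<And>t. t \<in> {0..1} \<Longrightarrow> vel t = of_real (speed t) * (\<i> * cis (\<psi> t))"
    and cp: "\<And>t. t \<in> {0..1} \<Longrightarrow> c t = p (\<psi> t)" using normal_angle by blast
  have mono: "\<psi> s < \<psi> t" if "0 \<le> s" "s < t" "t \<le> 1" for s t
  proof (rule DERIV_pos_imp_increasing[OF that(2)])
    fix x assume "s \<le> x" "x \<le> t"
    then show "\<exists>y. (\<psi> has_real_derivative y) (at x) \<and> 0 < y" using d\<psi>[of x] turning_pos[of x] that by auto
  qed
  have c11: "vel 1 = vel 0" using vel_per[of 0] by simp
  have "vel 1 = of_real (speed 1) * (\<i> * cis (\<psi> 1))" "vel 0 = of_real (speed 0) * (\<i> * cis (\<psi> 0))"
    by (rule tang, simp)+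
  then have "of_real (speed 1) * (\<i> * cis (\<psi> 1)) = of_real (speed 0) * (\<i> * cis (\<psi> 0))" using c11 by metis
  moreover have "speed 1 = speed 0" unfolding speed_def c11 ..
  ultimately have "cis (\<psi> 1) = cis (\<psi> 0)" using speed_pos[of 0] by simp
  then have "sin (\<psi> 1) = sin (\<psi> 0) \<and> cos (\<psi> 1) = cos (\<psi> 0)" by (simp add: complex_eq_iff)
  then obtain m :: int where m: "\<psi> 1 = \<psi> 0 + 2 * pi * m" using sin_cos_eq_iff by blast
  have "0 < m" using mono[of 0 1] m by (simp add: zero_less_mult_iff)
  moreover have "\<not> 2 \<le> m"
  proof
    assume "2 \<le> m"
    then have "2 * pi * 2 \<le> 2 * pi * real_of_int m" by (intro mult_left_mono) auto
    then have gt: "\<psi> 0 + 2 * pi < \<psi> 1" using m pi_gt_zero by linarith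
    have "isCont \<psi> x" if "0 \<le> x" "x \<le> 1" for x using d\<psi>[of x] that DERIV_isCont by fastforce
    then obtain t where t: "0 \<le> t" "t \<le> 1" "\<psi> t = \<psi> 0 + 2 * pi"
      using IVT[of \<psi> 0 "\<psi> 0 + 2 * pi" 1] gt pi_gt_zero by fastforce
    have "t \<noteq> 0" "t \<noteq> 1" using t gt pi_gt_zero by auto
    have "c t = c 0" using cp[of t] cp[of 0] t p_periodic[of "\<psi> 0"] by simp
    then have "t = 0" using c_inj t \<open>t \<noteq> 1\<close> by (auto dest: inj_onD)
    with \<open>t \<noteq> 0\<close> show False by simp
  qed
  ultimately have "m = 1" by linarith
  then have \<psi>1: "\<psi> 1 = \<psi> 0 + 2 * pi" using m by simp
  define u where "u = \<psi> 0 - 1"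
  define H where "H = (\<lambda>\<theta>. integral {u..\<theta>} supp)"
  have dH: "(H has_real_derivative supp \<theta>) (at \<theta>)" if "\<psi> 0 \<le> \<theta>" "\<theta> \<le> \<psi> 1" for \<theta>
  proof -
    have "(H has_real_derivative supp \<theta>) (at \<theta> within {u..\<psi> 1 + 1})"
      unfolding H_def using that by (intro integral_has_real_derivative h_cont) (auto simp: u_def)
    then show ?thesis using that by (simp add: at_within_Icc_at u_def)
  qed
  define W where "W = (\<lambda>t. H (\<psi> t) + (c t - z) \<bullet> (\<i> * cis (\<psi> t)))"
  have dW: "(W has_real_derivative speed t) (at t)" if t: "t \<in> {0..1}" for t
  proof -
    have t': "t \<in> {-1<..<2}" using t by auto
    have range: "\<psi> 0 \<le> \<psi> t" "\<psi> t \<le> \<psi> 1" using mono[of 0 t] mono[of t 1] t by (cases "t = 0"; cases "t = 1"; auto)+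
    have 1: "((\<lambda>t. H (\<psi> t)) has_real_derivative supp (\<psi> t) * turning t) (at t)"
      by (rule DERIV_chain2[OF dH[OF range] d\<psi>[OF t']])
    have dc: "((\<lambda>s. Re (c s)) has_real_derivative vx t) (at t)" "((\<lambda>s. Im (c s)) has_real_derivative vy t) (at t)"
      unfolding vx_def vy_def by (rule has_vector_derivative_Re_Im[OF deriv_c])+
    have "((\<lambda>t. (Im (c t) - Im z) * cos (\<psi> t) - (Re (c t) - Re z) * sin (\<psi> t)) has_real_derivative
       vy t * cos (\<psi> t) - (Im (c t) - Im z) * sin (\<psi> t) * turning t - (vx t * sin (\<psi> t) + (Re (c t) - Re z) * cos (\<psi> t) * turning t)) (at t)"
      by (rule dc d\<psi>[OF t'] derivative_eq_intros refl | simp)+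
    moreover have "(\<lambda>t. (Im (c t) - Im z) * cos (\<psi> t) - (Re (c t) - Re z) * sin (\<psi> t)) = (\<lambda>t. (c t - z) \<bullet> (\<i> * cis (\<psi> t)))"
      by (auto simp: inner_complex_def)
    ultimately have 2: "((\<lambda>t. (c t - z) \<bullet> (\<i> * cis (\<psi> t))) has_real_derivative
       vy t * cos (\<psi> t) - (Im (c t) - Im z) * sin (\<psi> t) * turning t - (vx t * sin (\<psi> t) + (Re (c t) - Re z) * cos (\<psi> t) * turning t)) (at t)"
      by simp
    have hfe: "supp (\<psi> t) = (Re (c t) - Re z) * cos (\<psi> t) + (Im (c t) - Im z) * sin (\<psi> t)"
      by (simp add: supp_def cp[OF t, symmetric] inner_complex_def)
    have ble: "vy t * cos (\<psi> t) - vx t * sin (\<psi> t) = speed t"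
    proof -
      have "vx t = - speed t * sin (\<psi> t)" "vy t = speed t * cos (\<psi> t)" by (simp_all add: vx_def vy_def tang[OF t])
      then have "vy t * cos (\<psi> t) - vx t * sin (\<psi> t) = speed t * (cos (\<psi> t) * cos (\<psi> t) + sin (\<psi> t) * sin (\<psi> t))"
        by (simp add: algebra_simps del: sin_cos_squared_add3)
      then show ?thesis by simp
    qed
    have "supp (\<psi> t) * turning t + (vy t * cos (\<psi> t) - (Im (c t) - Im z) * sin (\<psi> t) * turning t - (vx t * sin (\<psi> t) + (Re (c t) - Re z) * cos (\<psi> t) * turning t)) = vy t * cos (\<psi> t) - vx t * sin (\<psi> t)"
      unfolding hfe by (simp add: algebra_simps)
    with DERIV_add[OF 1 2] show ?thesis unfolding W_def ble by simp
  qed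
  have "(speed has_integral W 1 - W 0) {0..1}"
    by (rule fundamental_theorem_of_calculus)
      (auto simp flip: has_real_derivative_iff_has_vector_derivative intro!: has_field_derivative_at_within dW)
  then have "closed_curve_length c = W 1 - W 0"
    unfolding closed_curve_length_def by (simp add: speed_def[abs_def] vel_def integral_unique)
  also have "\<dots> = H (\<psi> 1) - H (\<psi> 0)"
  proof -
    have "cis (\<psi> 1) = cis (\<psi> 0)" unfolding \<psi>1 by (simp flip: cis_mult)
    then show ?thesis unfolding W_def using c_per[of 0] by simp
  qed
  also have "\<dots> = integral {\<psi> 0..\<psi> 0 + 2*pi} supp"
  proof -
    have "supp integrable_on {u..\<psi> 1}" by (intro integrable_continuous_real h_cont)
    then show ?thesis using Henstock_Kurzweil_Integration.integral_combine[of u "\<psi> 0" "\<psi> 1" supp]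
      unfolding H_def \<psi>1 by (simp add: u_def)
  qed
  also have "\<dots> = integral {0..2*pi} (\<lambda>s. supp (s + \<psi> 0))"
    using integral_shift_Icc_real[of 0 "2*pi" supp "\<psi> 0"] by (simp add: o_def add.commute)
  also have "\<dots> = integral {0..2*pi} supp"
    by (rule integral_period_shift[OF h_cont supp_periodic]) simp
  finally show ?thesis .
qed

end

section \<open>The unit disk\<close>

lemma disk_convex_domain: "convex_domain (ball 0 1) 0"
proof
  show "strictly_convex (ball 0 1)"
    unfolding strictly_convex_def
  proof (intro ballI subsetI)
    fix x y u :: complex assume "x \<in> closure (ball 0 1)" "y \<in> closure (ball 0 1)" "u \<in> open_segment x y"
    then show "u \<in> interior (ball 0 1)"
      using dist_decreases_open_segment[of u x y 0] by fastforce
  qed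
qed auto

interpretation disk: convex_domain "ball 0 1" 0
  by (rule disk_convex_domain)

lemma disk_bdry_point: "bdry_point (ball 0 1) \<theta> = cis \<theta>"
proof (rule disk.p_eqI)
  fix x :: complex assume "x \<in> closure (ball 0 1)"
  then have "x \<bullet> cis \<theta> \<le> 1" using norm_cauchy_schwarz[of x "cis \<theta>"] by simp
  moreover have "cis \<theta> \<bullet> cis \<theta> = 1" by (simp add: dot_square_norm)
  ultimately show "(x - cis \<theta>) \<bullet> cis \<theta> \<le> 0" by (simp add: inner_diff_left)
qed simp

interpretation disk: smooth_domain "ball 0 1" 0
  by unfold_locales (simp add: disk_bdry_point)

lemma disk_supp: "disk.supp \<theta> = 1"
  by (simp add: disk.supp_def disk_bdry_point dot_square_norm)

text \<open>The upper bound is the general inequality. For the lower bound each edge is estimated by the tangent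
  line of the tangent function at the mean step; the linear terms add up to the displacement, which
  differs from that of the line by a bounded amount.\<close>
lemma disk_mean_action:
  assumes \<rho>: "0 < \<rho>" "\<rho> < 1/2"
  shows "mean_action (ball 0 1) \<rho> = 2 * tan (pi * \<rho>)"
proof (rule antisym)
  have "integral {0..2*pi} disk.supp = 2 * pi" unfolding disk_supp[abs_def] by simp
  then show "mean_action (ball 0 1) \<rho> \<le> 2 * tan (pi * \<rho>)"
    using disk.mean_action_le(1)[OF \<rho>] by simp
  obtain x where x: "disk.minimizing x" "\<And>i. \<bar>x i - 2 * pi * \<rho> * of_int i\<bar> \<le> 4 * pi"
    "disk.mean_gen x \<longlonglongrightarrow> mean_action (ball 0 1) \<rho>"
    using disk.mean_action_attained[OF \<rho>] by blast
  have adm: "admissible x" using x(1) by (simp add: disk.minimizing_def)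
  have r: "pi * \<rho> < pi / 2" "0 < pi * \<rho>" using \<rho> mult_strict_left_mono[OF \<rho>(2), of pi] by simp_all
  define t where "t = tan (pi * \<rho>)"
  have edge: "2 * t + (1 + t\<^sup>2) * (x (i + 1) - x i - 2 * pi * \<rho>) \<le> disk.gen (x i) (x (i + 1))" for i
  proof -
    define \<delta> where "\<delta> = x (i + 1) - x i"
    have "0 \<le> \<delta>" "\<delta> < pi" using adm by (simp_all add: \<delta>_def admissible_def)
    then have "t + (1 + t\<^sup>2) * (\<delta> / 2 - pi * \<rho>) \<le> tan (\<delta> / 2)"
      unfolding t_def using r by (intro tan_ge_tangent) auto
    moreover have "(1 + t\<^sup>2) * (\<delta> - 2 * pi * \<rho>) = 2 * ((1 + t\<^sup>2) * (\<delta> / 2 - pi * \<rho>))"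
      by (simp add: algebra_simps)
    moreover have "disk.gen (x i) (x (i + 1)) = 2 * tan (\<delta> / 2)"
      by (simp add: disk.gen_def disk.half_tan_def disk_supp \<delta>_def)
    ultimately show ?thesis unfolding \<delta>_def[symmetric] by linarith
  qed
  have low: "2 * t - (1 + t\<^sup>2) * (4 * pi) / real N \<le> disk.gen_action (- int N) (int N) x / (2 * real N)" if N: "0 < N" for N
  proof -
    have "2 * real N * (2 * t) + (1 + t\<^sup>2) * (x (int N) - x (- int N) - 2 * real N * (2 * pi * \<rho>))
      = (\<Sum>i\<in>{- int N..<int N}. 2 * t + (1 + t\<^sup>2) * ((x (i + 1) - x i) - 2 * pi * \<rho>))"
      using sum_telescope_int[of "- int N" "int N" x]
      by (simp only: sum.distrib sum_distrib_left[symmetric] sum_subtractf[of "\<lambda>i. x (i + 1) - x i"]) simp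
    also have "\<dots> \<le> disk.gen_action (- int N) (int N) x"
      unfolding disk.gen_action_def by (intro sum_mono edge)
    finally have *: "2 * real N * (2 * t) + (1 + t\<^sup>2) * (x (int N) - x (- int N) - 2 * real N * (2 * pi * \<rho>)) \<le> disk.gen_action (- int N) (int N) x" .
    have "- (8 * pi) \<le> x (int N) - x (- int N) - 2 * real N * (2 * pi * \<rho>)"
    proof -
      have "2 * real N * (2 * pi * \<rho>) = 2 * pi * \<rho> * of_int (int N) - 2 * pi * \<rho> * of_int (- int N)"
        by (simp add: algebra_simps)
      moreover have "\<bar>x (int N) - 2 * pi * \<rho> * of_int (int N)\<bar> \<le> 4 * pi"
        "\<bar>x (- int N) - 2 * pi * \<rho> * of_int (- int N)\<bar> \<le> 4 * pi" by (rule x(2))+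
      ultimately show ?thesis by linarith
    qed
    then have "(1 + t\<^sup>2) * (- (8 * pi)) \<le> (1 + t\<^sup>2) * (x (int N) - x (- int N) - 2 * real N * (2 * pi * \<rho>))"
      by (intro mult_left_mono) auto
    with * have "2 * real N * (2 * t) + (1 + t\<^sup>2) * (- (8 * pi)) \<le> disk.gen_action (- int N) (int N) x" by linarith
    then have "(2 * real N * (2 * t) + (1 + t\<^sup>2) * (- (8 * pi))) / (2 * real N) \<le> disk.gen_action (- int N) (int N) x / (2 * real N)"
      by (intro divide_right_mono) auto
    moreover have "(2 * real N * (2 * t) + (1 + t\<^sup>2) * (- (8 * pi))) / (2 * real N) = 2 * t - (1 + t\<^sup>2) * (4 * pi) / real N"
      using N by (simp add: field_simps)
    ultimately show ?thesis by simp
  qed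
  have "2 * t - 0 \<le> mean_action (ball 0 1) \<rho>"
  proof (rule LIMSEQ_le[OF _ x(3)])
    show "(\<lambda>N. 2 * t - (1 + t\<^sup>2) * (4 * pi) / real N) \<longlonglongrightarrow> 2 * t - 0"
      by (intro tendsto_diff tendsto_const lim_const_over_n)
    show "\<exists>M. \<forall>N\<ge>M. 2 * t - (1 + t\<^sup>2) * (4 * pi) / real N \<le> disk.gen_action (- int N) (int N) x / (2 * real N)"
      using low by (intro exI[of _ 1]) auto
  qed
  then show "2 * tan (pi * \<rho>) \<le> mean_action (ball 0 1) \<rho>" by (simp add: t_def)
qed

lemma mather_beta_disk:
  assumes "0 \<le> \<rho>" "\<rho> < 1/2"
  shows "mather_beta (ball 0 1) \<rho> = 2 * tan (pi * \<rho>)"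
  using assms disk_mean_action[of \<rho>] disk.mather_beta_zero by (cases "\<rho> = 0") (simp_all add: mather_beta_def[of _ \<rho>])

section \<open>Comparison with the disk\<close>

theorem theorem4p3:
  fixes \<Omega> :: "complex set" and c :: "real \<Rightarrow> complex"
  assumes "open \<Omega>" and "\<Omega> \<noteq> {}" and "bounded \<Omega>" and "strictly_convex \<Omega>"
    and "C2_closed_curve c" and "range c = frontier \<Omega>" and "\<And>t. curvature c t > 0"
  shows "(\<forall>\<rho>. 0 \<le> \<rho> \<and> \<rho> < 1/2 \<longrightarrow> mather_beta (ball 0 1) \<rho> = 2 * tan (pi * \<rho>)) \<and>
    (\<forall>\<rho>. 0 \<le> \<rho> \<and> \<rho> < 1/2 \<longrightarrow>
       mather_beta \<Omega> \<rho> \<le> closed_curve_length c / (2 * pi) * mather_beta (ball 0 1) \<rho>) \<and>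
    ((\<exists>\<rho>. 0 < \<rho> \<and> \<rho> < 1/2 \<and>
        mather_beta \<Omega> \<rho> = closed_curve_length c / (2 * pi) * mather_beta (ball 0 1) \<rho>) \<longrightarrow>
     (\<exists>z r. r > 0 \<and> \<Omega> = ball z r))"
proof -
  obtain z where z: "z \<in> \<Omega>" using assms(2) by blast
  interpret curve_domain \<Omega> z c
    using assms z by unfold_locales auto
  have len: "closed_curve_length c = integral {0..2*pi} supp" by (rule curve_length_eq)
  show ?thesis
  proof (intro conjI allI impI, elim conjE)
    fix \<rho> :: real assume "0 \<le> \<rho>" "\<rho> < 1/2"
    then show "mather_beta (ball 0 1) \<rho> = 2 * tan (pi * \<rho>)" by (rule mather_beta_disk)
  next
    fix \<rho> :: real assume \<rho>: "0 \<le> \<rho> \<and> \<rho> < 1/2"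
    show "mather_beta \<Omega> \<rho> \<le> closed_curve_length c / (2 * pi) * mather_beta (ball 0 1) \<rho>"
    proof (cases "\<rho> = 0")
      case True
      then show ?thesis by (simp add: mather_beta_zero disk.mather_beta_zero)
    next
      case False
      then show ?thesis using mean_action_le(1)[of \<rho>] \<rho>
        by (simp add: mather_beta_disk mather_beta_def[of \<Omega>] len field_simps)
    qed
  next
    assume "\<exists>\<rho>. 0 < \<rho> \<and> \<rho> < 1/2 \<and>
        mather_beta \<Omega> \<rho> = closed_curve_length c / (2 * pi) * mather_beta (ball 0 1) \<rho>"
    then obtain \<rho> where \<rho>: "0 < \<rho>" "\<rho> < 1/2"
      and eq: "mather_beta \<Omega> \<rho> = closed_curve_length c / (2 * pi) * mather_beta (ball 0 1) \<rho>" by blast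
    have "2 * pi * mean_action \<Omega> \<rho> = 2 * tan (pi * \<rho>) * integral {0..2*pi} supp"
      using eq \<rho> by (simp add: mather_beta_disk mather_beta_def[of \<Omega>] len field_simps)
    from mean_action_equality[OF \<rho> this] obtain r w where "\<And>s. supp s = r + w \<bullet> cis s" by blast
    then show "\<exists>z r. r > 0 \<and> \<Omega> = ball z r" using disk_if_first_harmonic by blast
  qed
qed

end
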